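(* Let $(W,S)$ be any Coxeter system (with $S$ finite), let $\mathcal{A}$ be its proper nerve, and let $\mathcal{L}=\mathcal{L}(W,S)\subset\mathcal{A}^*$ be its left greedy normal form. Then the characteristic series $\chi_{\mathcal{L}}=\sum_{\alpha\in\mathcal{L}}\alpha\in\mathbb{Q}\langle\langle\mathcal{A}\rangle\rangle$ is rational.
   Context: A Coxeter system $(W,S)$: $W$ is a group with presentation $\langle S\mid (ss')^{m(s,s')}=1\rangle$ (one relation for each pair with $m(s,s')<\infty$), where $m:S\times S\to\{1,2,\dots,\infty\}$ is symmetric and $m(s,s')=1$ iff $s=s'$. For $w\in W$, $|w|$ is the word length with respect to $S$. For $\sigma\subset S$, $W_\sigma$ is the subgroup generated by $\sigma$ ($W_\emptyset=\{1\}$); $\sigma$ is spherical if $W_\sigma$ is finite. The nerve $N$ is the set of all spherical subsets of $S$ (including $\emptyset$), and the proper nerve is $\mathcal{A}=N\setminus\{\emptyset\}$. For $\sigma\in N$, $w_\sigma$ is the unique longest element of $W_\sigma$. The left descent set of $w\in W$ is $\mathrm{Desc}(w)=\{s\in S: |sw|<|w|\}$. $\mathcal{A}^*$ is the free monoid on the alphabet $\mathcal{A}$. The left greedy normal form $\mathcal{L}(W,S)\subset\mathcal{A}^*$ is the set of all words $\sigma_n\sigma_{n-1}\cdots\sigma_1$ (including the empty word) such that $\sigma_i=\mathrm{Desc}(w_{\sigma_i}w_{\sigma_{i-1}}\cdots w_{\sigma_1})$ for $i=1,\dots,n$. $\mathbb{Q}\langle\langle\mathcal{A}\rangle\rangle$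 is the ring of formal power series over $\mathbb{Q}$ in the noncommuting variables $\mathcal{A}$, and $\mathbb{Q}\langle\mathcal{A}\rangle$ its subring of polynomials. A series $\lambda$ with zero constant term is quasi-regular, and its quasi-inverse is $\lambda^+=\sum_{n\ge1}\lambda^n$. A power series is rational if it can be obtained from a finite set of polynomials by a finite sequence of additions, multiplications and quasi-inversions. *)

theory Defs
  imports Complex_Main "HOL-Algebra.Generated_Groups" "HOL-Algebra.Ring"
    "HOL-Library.Extended_Nat" "HOL-Library.Groups_Big_Fun"
begin

section \<open>Group presentations\<close>

text \<open>A letter \<open>(s, True)\<close> stands for the generator \<open>s\<close>, and \<open>(s, False)\<close> for its formal inverse.\<close>

type_synonym 'a signed_word = "('a \<times> bool) list"

text \<open>
  Equality of words in the group presented by the generators \<open>S\<close> and the relators \<open>R\<close>: the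
  congruence on signed words that is generated by free cancellation and the relators.
\<close>

inductive pres_eq :: "'a set \<Rightarrow> 'a signed_word set \<Rightarrow> 'a signed_word \<Rightarrow> 'a signed_word \<Rightarrow> bool"
  for S R where
    cancel: "s \<in> S \<Longrightarrow> pres_eq S R [(s, b), (s, \<not> b)] []"
  | relator: "r \<in> R \<Longrightarrow> pres_eq S R r []"
  | refl: "u \<in> lists (S \<times> UNIV) \<Longrightarrow> pres_eq S R u u"
  | sym: "pres_eq S R u v \<Longrightarrow> pres_eq S R v u"
  | trans: "pres_eq S R u v \<Longrightarrow> pres_eq S R v w \<Longrightarrow> pres_eq S R u w"
  | cong: "x \<in> lists (S \<times> UNIV) \<Longrightarrow> y \<in> lists (S \<times> UNIV) \<Longrightarrow> pres_eq S R u v \<Longrightarrow>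
      pres_eq S R (x @ u @ y) (x @ v @ y)"

definition word_eval :: "('a, 'b) monoid_scheme \<Rightarrow> 'a signed_word \<Rightarrow> 'a" where
  "word_eval G u = foldr (\<lambda>(s, b) g. (if b then s else inv\<^bsub>G\<^esub> s) \<otimes>\<^bsub>G\<^esub> g) u \<one>\<^bsub>G\<^esub>"

text \<open>
  \<open>G\<close> is presented by \<open>S\<close> and \<open>R\<close>: the evaluation map from the free group on \<open>S\<close> to \<open>G\<close> is
  onto, and its kernel is the normal closure of \<open>R\<close>.
\<close>

definition has_presentation :: "('a, 'b) monoid_scheme \<Rightarrow> 'a set \<Rightarrow> 'a signed_word set \<Rightarrow> bool" where
  "has_presentation G S R \<longleftrightarrow>
     group G \<and> S \<subseteq> carrier G \<and> R \<subseteq> lists (S \<times> UNIV) \<and> generate G S = carrier G \<and>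
     (\<forall>u \<in> lists (S \<times> UNIV). word_eval G u = \<one>\<^bsub>G\<^esub> \<longleftrightarrow> pres_eq S R u [])"


section \<open>Coxeter systems\<close>

definition coxeter_matrix :: "'a set \<Rightarrow> ('a \<Rightarrow> 'a \<Rightarrow> enat) \<Rightarrow> bool" where
  "coxeter_matrix S m \<longleftrightarrow>
     (\<forall>s\<in>S. \<forall>t\<in>S. m s t \<ge> 1 \<and> m s t = m t s \<and> (m s t = 1 \<longleftrightarrow> s = t))"

definition coxeter_relators :: "'a set \<Rightarrow> ('a \<Rightarrow> 'a \<Rightarrow> enat) \<Rightarrow> 'a signed_word set" where
  "coxeter_relators S m =
     {concat (replicate k [(s, True), (t, True)]) | s t k. s \<in> S \<and> t \<in> S \<and> m s t = enat k}"

definition coxeter_system ::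
    "('a, 'b) monoid_scheme \<Rightarrow> 'a set \<Rightarrow> ('a \<Rightarrow> 'a \<Rightarrow> enat) \<Rightarrow> bool" where
  "coxeter_system W S m \<longleftrightarrow> coxeter_matrix S m \<and> has_presentation W S (coxeter_relators S m)"

definition word_length :: "('a, 'b) monoid_scheme \<Rightarrow> 'a set \<Rightarrow> 'a \<Rightarrow> nat" where
  "word_length W S w = (LEAST n. \<exists>u \<in> lists (S \<times> UNIV). length u = n \<and> word_eval W u = w)"

definition nerve :: "('a, 'b) monoid_scheme \<Rightarrow> 'a set \<Rightarrow> 'a set set" where
  "nerve W S = {\<sigma>. \<sigma> \<subseteq> S \<and> finite (generate W \<sigma>)}"

definition proper_nerve :: "('a, 'b) monoid_scheme \<Rightarrow> 'a set \<Rightarrow> 'a set set" where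
  "proper_nerve W S = nerve W S - {{}}"

definition longest :: "('a, 'b) monoid_scheme \<Rightarrow> 'a set \<Rightarrow> 'a set \<Rightarrow> 'a" where
  "longest W S \<sigma> =
     (THE w. w \<in> generate W \<sigma> \<and> (\<forall>v \<in> generate W \<sigma>. word_length W S v \<le> word_length W S w))"

definition left_descents :: "('a, 'b) monoid_scheme \<Rightarrow> 'a set \<Rightarrow> 'a \<Rightarrow> 'a set" where
  "left_descents W S w = {s \<in> S. word_length W S (s \<otimes>\<^bsub>W\<^esub> w) < word_length W S w}"

definition longest_prod :: "('a, 'b) monoid_scheme \<Rightarrow> 'a set \<Rightarrow> 'a set list \<Rightarrow> 'a" where
  "longest_prod W S \<alpha> = foldr (\<lambda>\<sigma> g. longest W S \<sigma> \<otimes>\<^bsub>W\<^esub> g) \<alpha> \<one>\<^bsub>W\<^esub>"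

text \<open>
  The word \<open>\<sigma>\<^sub>n \<dots> \<sigma>\<^sub>1\<close> is the list \<open>[\<sigma>\<^sub>n, \<dots>, \<sigma>\<^sub>1]\<close>. So \<open>\<alpha> ! j\<close> is \<open>\<sigma>\<^sub>i\<close> with
  \<open>i = n - j\<close>, and \<open>drop j \<alpha>\<close> is the tail \<open>\<sigma>\<^sub>i \<dots> \<sigma>\<^sub>1\<close>.
\<close>

definition left_greedy_nf :: "('a, 'b) monoid_scheme \<Rightarrow> 'a set \<Rightarrow> 'a set list set" where
  "left_greedy_nf W S =
     {\<alpha> \<in> lists (proper_nerve W S).
        \<forall>j < length \<alpha>. \<alpha> ! j = left_descents W S (longest_prod W S (drop j \<alpha>))}"


section \<open>Noncommutative rational series\<close>

text \<open>
  A series in the noncommuting variables \<open>X\<close> is its coefficient function on words; it vanishes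
  on all words that are not words over \<open>X\<close>.
\<close>

type_synonym 'x ncseries = "'x list \<Rightarrow> rat"

definition nc_series_ring :: "'x set \<Rightarrow> 'x ncseries ring" where
  "nc_series_ring X =
     \<lparr>carrier = {f. \<forall>w. f w \<noteq> 0 \<longrightarrow> w \<in> lists X},
      mult = (\<lambda>f g w. \<Sum>i\<le>length w. f (take i w) * g (drop i w)),
      one = (\<lambda>w. if w = [] then 1 else 0),
      zero = (\<lambda>w. 0),
      add = (\<lambda>f g w. f w + g w)\<rparr>"

lemma ring_nc_series_ring: "ring (nc_series_ring X)"
proof -
  let ?R = "nc_series_ring X"
  have mult_closed: "f \<otimes>\<^bsub>?R\<^esub> g \<in> carrier ?R" if "f \<in> carrier ?R" "g \<in> carrier ?R" for f g
  proof -
    have "w \<in> lists X" if nz: "(f \<otimes>\<^bsub>?R\<^esub> g) w \<noteq> 0" for w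
    proof -
      have "(\<Sum>i\<le>length w. f (take i w) * g (drop i w)) \<noteq> 0"
        using nz by (simp add: nc_series_ring_def)
      then obtain i where "f (take i w) * g (drop i w) \<noteq> 0"
        by (rule sum.not_neutral_contains_not_neutral)
      then have "take i w \<in> lists X" "drop i w \<in> lists X"
        using \<open>f \<in> carrier ?R\<close> \<open>g \<in> carrier ?R\<close> by (auto simp: nc_series_ring_def)
      then show ?thesis
        by (metis append_in_lists_conv append_take_drop_id)
    qed
    then show ?thesis
      by (simp add: nc_series_ring_def)
  qed
  have assoc: "(f \<otimes>\<^bsub>?R\<^esub> g) \<otimes>\<^bsub>?R\<^esub> h = f \<otimes>\<^bsub>?R\<^esub> (g \<otimes>\<^bsub>?R\<^esub> h)" for f g h
  proof
    fix w :: "'a list"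
    let ?n = "length w"
    have "((f \<otimes>\<^bsub>?R\<^esub> g) \<otimes>\<^bsub>?R\<^esub> h) w =
        (\<Sum>i\<le>?n. \<Sum>j\<le>i. f (take j w) * g (take (i - j) (drop j w)) * h (drop i w))"
      by (auto simp: nc_series_ring_def sum_distrib_right drop_take min_def intro!: sum.cong)
    also have "\<dots> = (\<Sum>(i, j)\<in>Sigma {..?n} (\<lambda>i. {..i}).
        f (take j w) * g (take (i - j) (drop j w)) * h (drop i w))"
      by (simp add: sum.Sigma)
    also have "\<dots> = (\<Sum>(j, k)\<in>Sigma {..?n} (\<lambda>j. {..?n - j}).
        f (take j w) * g (take k (drop j w)) * h (drop (j + k) w))"
      by (rule sum.reindex_bij_witness[where i = "\<lambda>(j, k). (j + k, j)" and j = "\<lambda>(i, j). (j, i - j)"])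
        auto
    also have "\<dots> = (f \<otimes>\<^bsub>?R\<^esub> (g \<otimes>\<^bsub>?R\<^esub> h)) w"
      by (simp add: nc_series_ring_def sum.Sigma[symmetric] sum_distrib_left mult.assoc add.commute)
    finally show "((f \<otimes>\<^bsub>?R\<^esub> g) \<otimes>\<^bsub>?R\<^esub> h) w = (f \<otimes>\<^bsub>?R\<^esub> (g \<otimes>\<^bsub>?R\<^esub> h)) w" .
  qed
  have l_one: "\<one>\<^bsub>?R\<^esub> \<otimes>\<^bsub>?R\<^esub> f = f" for f
  proof
    fix w :: "'a list"
    have "(\<one>\<^bsub>?R\<^esub> \<otimes>\<^bsub>?R\<^esub> f) w =
        (\<Sum>i\<le>length w. (if take i w = [] then 1 else 0) * f (drop i w))"
      by (simp add: nc_series_ring_def)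
    also have "\<dots> = (\<Sum>i\<le>length w. if i = 0 then f w else 0)"
      by (rule sum.cong) auto
    finally show "(\<one>\<^bsub>?R\<^esub> \<otimes>\<^bsub>?R\<^esub> f) w = f w" by simp
  qed
  have r_one: "f \<otimes>\<^bsub>?R\<^esub> \<one>\<^bsub>?R\<^esub> = f" for f
  proof
    fix w :: "'a list"
    have "(f \<otimes>\<^bsub>?R\<^esub> \<one>\<^bsub>?R\<^esub>) w =
        (\<Sum>i\<le>length w. f (take i w) * (if drop i w = [] then 1 else 0))"
      by (simp add: nc_series_ring_def)
    also have "\<dots> = (\<Sum>i\<le>length w. if i = length w then f w else 0)"
      by (rule sum.cong) auto
    finally show "(f \<otimes>\<^bsub>?R\<^esub> \<one>\<^bsub>?R\<^esub>) w = f w" by simp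
  qed
  show ?thesis
  proof (rule ringI)
    show "abelian_group ?R"
    proof (rule abelian_groupI)
      fix f assume "f \<in> carrier ?R"
      then show "\<exists>g\<in>carrier ?R. g \<oplus>\<^bsub>?R\<^esub> f = \<zero>\<^bsub>?R\<^esub>"
        by (intro bexI[of _ "\<lambda>w. - f w"]) (auto simp: nc_series_ring_def)
    next
      fix f g assume "f \<in> carrier ?R" "g \<in> carrier ?R"
      then show "f \<oplus>\<^bsub>?R\<^esub> g \<in> carrier ?R"
        by (simp add: nc_series_ring_def) (metis add.right_neutral)
    qed (auto simp: nc_series_ring_def add_ac)
  next
    show "Group.monoid ?R"
      by (rule monoidI)
        (simp_all only: mult_closed assoc l_one r_one, simp add: nc_series_ring_def)
  qed (auto simp: nc_series_ring_def algebra_simps sum.distrib)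
qed

definition nc_polynomials :: "'x set \<Rightarrow> 'x ncseries set" where
  "nc_polynomials X = {f \<in> carrier (nc_series_ring X). finite {w. f w \<noteq> 0}}"

definition quasi_regular :: "'x ncseries \<Rightarrow> bool" where
  "quasi_regular f \<longleftrightarrow> f [] = 0"

text \<open>
  The sum of \<open>f ^ n\<close> over \<open>n \<ge> 1\<close> is taken coefficientwise. For quasi-regular \<open>f\<close> the summand
  vanishes at \<open>w\<close> once \<open>n > length w\<close>.
\<close>

definition quasi_inverse :: "'x set \<Rightarrow> 'x ncseries \<Rightarrow> 'x ncseries" where
  "quasi_inverse X f = (\<lambda>w. Sum_any (\<lambda>n. (f [^]\<^bsub>nc_series_ring X\<^esub> Suc n) w))"

lemma pow_quasi_regular_eq_0:
  assumes "quasi_regular f" and "length w < n"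
  shows "(f [^]\<^bsub>nc_series_ring X\<^esub> n) w = 0"
  using assms(2)
proof (induction n arbitrary: w)
  case (Suc n)
  have "(f [^]\<^bsub>nc_series_ring X\<^esub> n) (take i w) * f (drop i w) = 0" if "i \<le> length w" for i
  proof (cases "i = length w")
    case True
    then show ?thesis using assms(1) by (simp add: quasi_regular_def)
  next
    case False
    with that Suc.prems have "length (take i w) < n" by simp
    then show ?thesis using Suc.IH by simp
  qed
  then have "(\<Sum>i\<le>length w. (f [^]\<^bsub>nc_series_ring X\<^esub> n) (take i w) * f (drop i w)) = 0"
    by (intro sum.neutral) auto
  moreover have "(f [^]\<^bsub>nc_series_ring X\<^esub> Suc n) w =
      (\<Sum>i\<le>length w. (f [^]\<^bsub>nc_series_ring X\<^esub> n) (take i w) * f (drop i w))"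
    by (subst nat_pow_Suc) (simp add: nc_series_ring_def)
  ultimately show ?case by (simp only:)
qed simp

inductive_set rational_series :: "'x set \<Rightarrow> 'x ncseries set" for X where
    poly: "f \<in> nc_polynomials X \<Longrightarrow> f \<in> rational_series X"
  | add: "f \<in> rational_series X \<Longrightarrow> g \<in> rational_series X \<Longrightarrow>
      f \<oplus>\<^bsub>nc_series_ring X\<^esub> g \<in> rational_series X"
  | mult: "f \<in> rational_series X \<Longrightarrow> g \<in> rational_series X \<Longrightarrow>
      f \<otimes>\<^bsub>nc_series_ring X\<^esub> g \<in> rational_series X"
  | quasi_inv: "f \<in> rational_series X \<Longrightarrow> quasi_regular f \<Longrightarrow>
      quasi_inverse X f \<in> rational_series X"

definition char_series :: "'x list set \<Rightarrow> 'x ncseries" where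
  "char_series L = (\<lambda>w. if w \<in> L then 1 else 0)"

end

theory Submission
  imports Defs "HOL-Computational_Algebra.Polynomial_Factorial" "HOL-Number_Theory.Cong"
begin

text \<open>
  Read from the right, a greedy word is accepted by an automaton whose state after the element \<open>g\<close>
  is the cone type of \<open>g\<close>. So the series is rational as soon as there are finitely many cone
  types. The cone type is determined by the small reflections among the inversions of \<open>g\<close>, that
  is, by those whose wall is not separated from the identity by another wall. To see that small
  reflections are close to the identity, reduce the geometric representation modulo a suitable
  integer. This colours the elements of \<open>W\<close> with finitely many colours in such a way that
  reflections of the same colour have non-crossing walls, because crossing walls meet in a finite
  rank 2 residue and the order of \<open>s \<otimes> t\<close> survives the reduction. On a long gallery to a wall one
  finds two walls of the same colour, and the product of their reflections moves the given wall to
  one that separates it from the identity.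
\<close>

section \<open>Rational series and automata\<close>

text \<open>The finiteness of the small reflections is the Brink-Howlett theorem, whose usual proof
  needs the real root system. Here there are no roots and no real geometry: a wall is given by its
  reflection, and its sides by the parity with which galleries cross it. The parity is well defined
  because the Cayley complex of the presentation is simply connected. The same principle, applied to
  another function on edges, puts two crossing walls into one finite rank 2 residue, and angles
  become a count of sectors around that residue.

  The modular representation need not be faithful; it only has to keep apart the powers of
  \<open>s \<otimes> t\<close> when \<open>m s t\<close> is finite. To this end
  \<open>2 * cos (\<pi> / k)\<close> becomes \<open>z + z'\<close>, where every
  \<open>z ^ j - 1\<close> with \<open>0 < j < 2 * k\<close> is invertible modulo \<open>N\<close>:
  mere non-vanishing would not allow the cancellations in the closed forms. One \<open>N\<close> has
  to serve all finite orders at once.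

  A cone type can be a state because it determines both which letters may come next and the cone
  type after each of them.\<close>

lemma nc_mult_apply: "(f \<otimes>\<^bsub>nc_series_ring X\<^esub> g) w = (\<Sum>i\<le>length w. f (take i w) * g (drop i w))"
  by (simp add: nc_series_ring_def)

lemma nc_add_apply: "(f \<oplus>\<^bsub>nc_series_ring X\<^esub> g) w = f w + g w"
  by (simp add: nc_series_ring_def)

lemma nc_one_apply: "\<one>\<^bsub>nc_series_ring X\<^esub> w = (if w = [] then 1 else 0)"
  by (simp add: nc_series_ring_def)

text \<open>The bound \<open>B\<close> is free so that the values at all suffixes of one word become
  sums over a common range, which can be exchanged with the sum over the cut points.\<close>

lemma quasi_inverse_apply:
  assumes "quasi_regular f" and "length w \<le> B"
  shows "quasi_inverse X f w = (\<Sum>n<B. (f [^]\<^bsub>nc_series_ring X\<^esub> Suc n) w)"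
  unfolding quasi_inverse_def
proof (rule Sum_any.expand_superset)
  show "{n. (f [^]\<^bsub>nc_series_ring X\<^esub> Suc n) w \<noteq> 0} \<subseteq> {..<B}"
  proof
    fix n assume "n \<in> {n. (f [^]\<^bsub>nc_series_ring X\<^esub> Suc n) w \<noteq> 0}"
    then have "\<not> length w < Suc n"
      using pow_quasi_regular_eq_0[OF assms(1), of w "Suc n" X] by blast
    with assms(2) show "n \<in> {..<B}" by simp
  qed
qed simp

lemma rational_series_carrier:
  assumes "f \<in> rational_series X"
  shows "f \<in> carrier (nc_series_ring X)"
  using assms
proof induction
  case (poly f)
  then show ?case by (simp add: nc_polynomials_def)
next
  case (add f g)
  interpret ring "nc_series_ring X" by (rule ring_nc_series_ring)
  from add show ?case by blast
next
  case (mult f g)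
  interpret ring "nc_series_ring X" by (rule ring_nc_series_ring)
  from mult show ?case by blast
next
  case (quasi_inv f)
  interpret ring "nc_series_ring X" by (rule ring_nc_series_ring)
  have "w \<in> lists X" if "quasi_inverse X f w \<noteq> 0" for w
  proof -
    from that have "(\<Sum>n<length w. (f [^]\<^bsub>nc_series_ring X\<^esub> Suc n) w) \<noteq> 0"
      by (simp only: quasi_inverse_apply[OF quasi_inv(2) order_refl] not_False_eq_True)
    then obtain n where n: "(f [^]\<^bsub>nc_series_ring X\<^esub> Suc n) w \<noteq> 0"
      by (rule sum.not_neutral_contains_not_neutral)
    have "f [^]\<^bsub>nc_series_ring X\<^esub> Suc n \<in> carrier (nc_series_ring X)"
      using quasi_inv by (intro nat_pow_closed)
    with n show ?thesis by (simp only: nc_series_ring_def) simp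
  qed
  then show ?case by (simp add: nc_series_ring_def)
qed

lemma quasi_inverse_unfold:
  assumes f: "f \<in> carrier (nc_series_ring X)" and "quasi_regular f"
  shows "quasi_inverse X f = f \<oplus>\<^bsub>nc_series_ring X\<^esub> (f \<otimes>\<^bsub>nc_series_ring X\<^esub> quasi_inverse X f)"
proof
  fix w :: "'a list"
  interpret ring "nc_series_ring X" by (rule ring_nc_series_ring)
  let ?p = "\<lambda>n. f [^]\<^bsub>nc_series_ring X\<^esub> (n::nat)"
  let ?n = "length w"
  have "(f \<otimes>\<^bsub>nc_series_ring X\<^esub> quasi_inverse X f) w
      = (\<Sum>i\<le>?n. f (take i w) * (\<Sum>n<?n. ?p (Suc n) (drop i w)))"
    unfolding nc_mult_apply
    using quasi_inverse_apply[OF assms(2)] by (intro sum.cong HOL.refl arg_cong2[where f = times]) simp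
  also have "\<dots> = (\<Sum>n<?n. (f \<otimes>\<^bsub>nc_series_ring X\<^esub> ?p (Suc n)) w)"
    unfolding nc_mult_apply sum_distrib_left by (rule sum.swap)
  also have "\<dots> = (\<Sum>n<?n. ?p (Suc (Suc n)) w)"
    using nat_pow_Suc2[OF f] by (intro sum.cong HOL.refl) metis
  finally have "(f \<oplus>\<^bsub>nc_series_ring X\<^esub> (f \<otimes>\<^bsub>nc_series_ring X\<^esub> quasi_inverse X f)) w
      = f w + (\<Sum>n<?n. ?p (Suc (Suc n)) w)"
    by (simp only: nc_add_apply)
  also have "\<dots> = (\<Sum>n<Suc ?n. ?p (Suc n) w)"
    using f by (subst sum.lessThan_Suc_shift) (simp only: nat_pow_Suc nat_pow_0 l_one)
  also have "\<dots> = quasi_inverse X f w"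
    using quasi_inverse_apply[OF assms(2), of w "Suc ?n" X] by simp
  finally show "quasi_inverse X f w
      = (f \<oplus>\<^bsub>nc_series_ring X\<^esub> (f \<otimes>\<^bsub>nc_series_ring X\<^esub> quasi_inverse X f)) w" ..
qed

lemma zero_rational: "(\<lambda>w. 0) \<in> rational_series X"
  by (rule rational_series.poly) (simp add: nc_polynomials_def nc_series_ring_def)

lemma one_rational: "\<one>\<^bsub>nc_series_ring X\<^esub> \<in> rational_series X"
proof (rule rational_series.poly)
  have "{w. \<one>\<^bsub>nc_series_ring X\<^esub> w \<noteq> 0} \<subseteq> {[]}"
    by (auto simp: nc_one_apply)
  then show "\<one>\<^bsub>nc_series_ring X\<^esub> \<in> nc_polynomials X"
    using finite_subset by (auto simp: nc_polynomials_def nc_series_ring_def)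
qed

lemma add_rational:
  "f \<in> rational_series X \<Longrightarrow> g \<in> rational_series X \<Longrightarrow> (\<lambda>w. f w + g w) \<in> rational_series X"
  using rational_series.add[of f X g] by (simp add: nc_series_ring_def)

lemma sum_rational:
  assumes "finite Q" "\<And>j. j \<in> Q \<Longrightarrow> f j \<in> rational_series X"
  shows "(\<lambda>w. \<Sum>j\<in>Q. f j w) \<in> rational_series X"
  using assms by (induction Q) (simp_all add: zero_rational add_rational)

text \<open>Arden's rule. Expanding \<open>x\<close> times the quasi-inverse \<open>b\<close> of
  \<open>a\<close> by the equation of \<open>b\<close> and by that of \<open>x\<close> yields the
  same term \<open>x a b\<close>; cancelling it leaves \<open>x a = y b\<close>.\<close>

lemma left_fixed_point_solution:
  assumes x: "x \<in> carrier (nc_series_ring X)" and y: "y \<in> carrier (nc_series_ring X)"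
    and a: "a \<in> rational_series X" "quasi_regular a"
    and eq: "x = y \<oplus>\<^bsub>nc_series_ring X\<^esub> (x \<otimes>\<^bsub>nc_series_ring X\<^esub> a)"
  shows "x = y \<otimes>\<^bsub>nc_series_ring X\<^esub> (\<one>\<^bsub>nc_series_ring X\<^esub> \<oplus>\<^bsub>nc_series_ring X\<^esub> quasi_inverse X a)"
proof -
  interpret ring "nc_series_ring X" by (rule ring_nc_series_ring)
  let ?b = "quasi_inverse X a"
  have ac: "a \<in> carrier (nc_series_ring X)" "?b \<in> carrier (nc_series_ring X)"
    using a rational_series.quasi_inv rational_series_carrier by blast+
  have b: "?b = a \<oplus>\<^bsub>nc_series_ring X\<^esub> (a \<otimes>\<^bsub>nc_series_ring X\<^esub> ?b)"
    using quasi_inverse_unfold ac a by blast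
  let ?xb = "x \<otimes>\<^bsub>nc_series_ring X\<^esub> ?b"
  have "?xb = x \<otimes>\<^bsub>nc_series_ring X\<^esub> (a \<oplus>\<^bsub>nc_series_ring X\<^esub> (a \<otimes>\<^bsub>nc_series_ring X\<^esub> ?b))"
    using b by simp
  also have "\<dots> = (x \<otimes>\<^bsub>nc_series_ring X\<^esub> a) \<oplus>\<^bsub>nc_series_ring X\<^esub> ((x \<otimes>\<^bsub>nc_series_ring X\<^esub> a) \<otimes>\<^bsub>nc_series_ring X\<^esub> ?b)"
    using x ac by (simp add: r_distr m_assoc)
  finally have 1: "?xb = (x \<otimes>\<^bsub>nc_series_ring X\<^esub> a) \<oplus>\<^bsub>nc_series_ring X\<^esub> ((x \<otimes>\<^bsub>nc_series_ring X\<^esub> a) \<otimes>\<^bsub>nc_series_ring X\<^esub> ?b)" .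
  have "?xb = (y \<oplus>\<^bsub>nc_series_ring X\<^esub> (x \<otimes>\<^bsub>nc_series_ring X\<^esub> a)) \<otimes>\<^bsub>nc_series_ring X\<^esub> ?b"
    using eq by (rule arg_cong)
  also have "\<dots> = (y \<otimes>\<^bsub>nc_series_ring X\<^esub> ?b) \<oplus>\<^bsub>nc_series_ring X\<^esub> ((x \<otimes>\<^bsub>nc_series_ring X\<^esub> a) \<otimes>\<^bsub>nc_series_ring X\<^esub> ?b)"
    using x y ac by (simp add: l_distr)
  finally have *: "x \<otimes>\<^bsub>nc_series_ring X\<^esub> a = y \<otimes>\<^bsub>nc_series_ring X\<^esub> ?b"
    using 1 x y ac add.right_cancel by simp
  then show ?thesis
    using eq[unfolded *] y ac by (simp add: r_distr)
qed

text \<open>Gaussian elimination: the equation of one unknown is solved by a quasi-inverse and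
  substituted into the others, which keeps the coefficients rational and quasi-regular.\<close>

lemma linear_system_rational:
  assumes "finite Q"
    and "\<And>i. i \<in> Q \<Longrightarrow> x i \<in> carrier (nc_series_ring X)"
    and "\<And>i. i \<in> Q \<Longrightarrow> b i \<in> rational_series X"
    and "\<And>i j. i \<in> Q \<Longrightarrow> j \<in> Q \<Longrightarrow> a j i \<in> rational_series X \<and> quasi_regular (a j i)"
    and "\<And>i w. i \<in> Q \<Longrightarrow> x i w = b i w + (\<Sum>j\<in>Q. (x j \<otimes>\<^bsub>nc_series_ring X\<^esub> a j i) w)"
  shows "\<forall>i\<in>Q. x i \<in> rational_series X"
  using assms
proof (induction Q arbitrary: b a rule: finite_induct)
  case (insert k Q)
  interpret ring "nc_series_ring X" by (rule ring_nc_series_ring)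
  let ?R = "nc_series_ring X"
  define c where "c = \<one>\<^bsub>?R\<^esub> \<oplus>\<^bsub>?R\<^esub> quasi_inverse X (a k k)"
  define y where "y = (\<lambda>w. b k w + (\<Sum>j\<in>Q. (x j \<otimes>\<^bsub>?R\<^esub> a j k) w))"
  have ak: "a k k \<in> rational_series X" "quasi_regular (a k k)"
    using insert.prems(3) by blast+
  have c: "c \<in> rational_series X"
    unfolding c_def by (intro rational_series.add one_rational rational_series.quasi_inv ak)
  have xc: "x j \<in> carrier ?R" if "j \<in> insert k Q" for j using insert.prems(1) that by blast
  have ac: "a j i \<in> carrier ?R" if "i \<in> insert k Q" "j \<in> insert k Q" for i j
    using insert.prems(3) that rational_series_carrier by blast
  have sum_carrier: "(\<lambda>w. \<Sum>j\<in>P. (x j \<otimes>\<^bsub>?R\<^esub> a j k) w) \<in> carrier ?R" if "P \<subseteq> Q" for P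
  proof -
    have "finite P" using that insert.hyps finite_subset by blast
    then show ?thesis using that
    proof (induction P)
      case empty
      then show ?case by (simp add: nc_series_ring_def)
    next
      case (insert j P)
      then have "x j \<otimes>\<^bsub>?R\<^esub> a j k \<in> carrier ?R"
        using xc ac by simp
      from add.m_closed[OF this insert.IH] insert show ?case
        by (simp add: nc_series_ring_def)
    qed
  qed
  have y_eq: "y = b k \<oplus>\<^bsub>?R\<^esub> (\<lambda>w. \<Sum>j\<in>Q. (x j \<otimes>\<^bsub>?R\<^esub> a j k) w)"
    by (simp add: y_def nc_series_ring_def)
  have y: "y \<in> carrier ?R"
    unfolding y_eq using insert.prems(2)[of k] sum_carrier[of Q] rational_series_carrier by blast
  have xk: "x k = y \<otimes>\<^bsub>?R\<^esub> c"
    unfolding c_def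
  proof (rule left_fixed_point_solution[OF xc y ak])
    show "x k = y \<oplus>\<^bsub>?R\<^esub> (x k \<otimes>\<^bsub>?R\<^esub> a k k)"
    proof
      fix w
      show "x k w = (y \<oplus>\<^bsub>?R\<^esub> (x k \<otimes>\<^bsub>?R\<^esub> a k k)) w"
        using insert.prems(4)[of k w] insert.hyps by (simp add: nc_add_apply y_def)
    qed
  qed simp
  have mult_sum: "((\<lambda>w. f w + (\<Sum>j\<in>Q. (x j \<otimes>\<^bsub>?R\<^esub> g j) w)) \<otimes>\<^bsub>?R\<^esub> h) w
      = (f \<otimes>\<^bsub>?R\<^esub> h) w + (\<Sum>j\<in>Q. ((x j \<otimes>\<^bsub>?R\<^esub> g j) \<otimes>\<^bsub>?R\<^esub> h) w)" for f g h w
    unfolding nc_mult_apply[where g = h]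
    by (simp only: distrib_right sum.distrib sum_distrib_right) (simp only: sum.swap[of _ Q])
  \<comment> \<open>The coefficients after the elimination of \<open>k\<close>: a direct step, or a
    passage through \<open>k\<close>, where \<open>c\<close> records any number of loops at
    \<open>k\<close>.\<close>
  define a' where "a' = (\<lambda>j i w. a j i w + (a j k \<otimes>\<^bsub>?R\<^esub> (c \<otimes>\<^bsub>?R\<^esub> a k i)) w)"
  define b' where "b' = (\<lambda>i w. b i w + (b k \<otimes>\<^bsub>?R\<^esub> (c \<otimes>\<^bsub>?R\<^esub> a k i)) w)"
  have IH: "\<forall>i\<in>Q. x i \<in> rational_series X"
  proof (rule insert.IH[of b' a'])
    fix i assume i: "i \<in> Q"
    show "x i \<in> carrier ?R" using xc i by blast
    show "b' i \<in> rational_series X"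
      unfolding b'_def using i insert.prems(2,3) c by (intro add_rational rational_series.mult) simp_all
    have cai: "c \<otimes>\<^bsub>?R\<^esub> a k i \<in> carrier ?R"
      using c rational_series_carrier ac i by blast
    fix w
    have "x i w = b i w + ((x k \<otimes>\<^bsub>?R\<^esub> a k i) w + (\<Sum>j\<in>Q. (x j \<otimes>\<^bsub>?R\<^esub> a j i) w))"
      using insert.prems(4)[of i w] insert.hyps i by simp
    also have "x k \<otimes>\<^bsub>?R\<^esub> a k i = y \<otimes>\<^bsub>?R\<^esub> (c \<otimes>\<^bsub>?R\<^esub> a k i)"
      unfolding xk using y c rational_series_carrier ac i by (intro m_assoc) auto
    also have "\<dots> w = (b k \<otimes>\<^bsub>?R\<^esub> (c \<otimes>\<^bsub>?R\<^esub> a k i)) w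
        + (\<Sum>j\<in>Q. ((x j \<otimes>\<^bsub>?R\<^esub> a j k) \<otimes>\<^bsub>?R\<^esub> (c \<otimes>\<^bsub>?R\<^esub> a k i)) w)"
      unfolding y_def by (rule mult_sum)
    also have "(\<Sum>j\<in>Q. ((x j \<otimes>\<^bsub>?R\<^esub> a j k) \<otimes>\<^bsub>?R\<^esub> (c \<otimes>\<^bsub>?R\<^esub> a k i)) w)
        = (\<Sum>j\<in>Q. (x j \<otimes>\<^bsub>?R\<^esub> (a j k \<otimes>\<^bsub>?R\<^esub> (c \<otimes>\<^bsub>?R\<^esub> a k i))) w)"
      using xc ac cai by (intro sum.cong HOL.refl) (simp add: m_assoc)
    finally show "x i w = b' i w + (\<Sum>j\<in>Q. (x j \<otimes>\<^bsub>?R\<^esub> a' j i) w)"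
      by (simp add: b'_def a'_def nc_mult_apply algebra_simps sum.distrib)
  next
    fix i j assume ij: "i \<in> Q" "j \<in> Q"
    then have *: "a j i \<in> rational_series X \<and> quasi_regular (a j i)"
      "a j k \<in> rational_series X \<and> quasi_regular (a j k)" "a k i \<in> rational_series X \<and> quasi_regular (a k i)"
      using insert.prems(3) by blast+
    have "a' j i \<in> rational_series X"
      unfolding a'_def using * c by (intro add_rational rational_series.mult) auto
    moreover have "quasi_regular (a' j i)"
      using * by (simp add: quasi_regular_def a'_def nc_mult_apply)
    ultimately show "a' j i \<in> rational_series X \<and> quasi_regular (a' j i)" ..
  qed
  have "y \<in> rational_series X"
    unfolding y_def using insert.prems(2,3) insert.hyps(1) IH
    by (intro add_rational sum_rational rational_series.mult) simp_all
  then have "x k \<in> rational_series X"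
    unfolding xk by (rule rational_series.mult[OF _ c])
  with IH show ?case by blast
qed simp

text \<open>The words of \<open>lang q\<close> are read from the right, starting in the state \<open>q\<close>.\<close>

lemma automaton_rational:
  assumes Q: "finite Q" and A: "finite A"
    and lang: "\<And>q. q \<in> Q \<Longrightarrow> lang q \<subseteq> lists A"
    and step: "\<And>q u a. q \<in> Q \<Longrightarrow> a \<in> A \<Longrightarrow> u @ [a] \<in> lang q \<longleftrightarrow> ok q a \<and> u \<in> lang (\<delta> q a)"
    and \<delta>: "\<And>q a. q \<in> Q \<Longrightarrow> a \<in> A \<Longrightarrow> ok q a \<Longrightarrow> \<delta> q a \<in> Q"
    and q: "q \<in> Q"
  shows "char_series (lang q) \<in> rational_series A"
proof -
  let ?R = "nc_series_ring A"
  define b :: "'a \<Rightarrow> 'b ncseries" where "b = (\<lambda>q w. if w = [] \<and> [] \<in> lang q then 1 else 0)"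
  \<comment> \<open>The letter read first is the last one of the word, so these coefficients
    multiply the unknown languages from the right. They are sums of one-letter words, hence
    quasi-regular.\<close>
  define t :: "'a \<Rightarrow> 'a \<Rightarrow> 'b ncseries"
    where "t = (\<lambda>q' q w. if \<exists>a\<in>A. w = [a] \<and> ok q a \<and> \<delta> q a = q' then 1 else 0)"
  have "\<forall>q\<in>Q. char_series (lang q) \<in> rational_series A"
  proof (rule linear_system_rational[OF Q, where b = b and a = t])
    fix q assume q: "q \<in> Q"
    show "char_series (lang q) \<in> carrier ?R"
      using lang[OF q] by (auto simp: nc_series_ring_def char_series_def split: if_splits)
    have "finite {w. b q w \<noteq> 0}"
      by (rule finite_subset[of _ "{[]}"]) (auto simp: b_def)
    then show "b q \<in> rational_series A"
      by (intro rational_series.poly) (auto simp: nc_polynomials_def nc_series_ring_def b_def)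
    fix w
    show "char_series (lang q) w = b q w + (\<Sum>q'\<in>Q. (char_series (lang q') \<otimes>\<^bsub>?R\<^esub> t q' q) w)"
    proof (cases w rule: rev_cases)
      case Nil
      then show ?thesis by (simp add: b_def t_def nc_mult_apply char_series_def)
    next
      case (snoc u a)
      have "(char_series (lang q') \<otimes>\<^bsub>?R\<^esub> t q' q) w = char_series (lang q') u * t q' q [a]" for q'
      proof -
        have "(char_series (lang q') \<otimes>\<^bsub>?R\<^esub> t q' q) w
            = (\<Sum>i\<le>length w. if i = length u then char_series (lang q') u * t q' q [a] else 0)"
          unfolding nc_mult_apply
        proof (rule sum.cong[OF HOL.refl])
          fix i assume "i \<in> {..length w}"
          show "char_series (lang q') (take i w) * t q' q (drop i w)
              = (if i = length u then char_series (lang q') u * t q' q [a] else 0)"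
          proof (cases "i = length u")
            case False
            then have "length (drop i w) \<noteq> 1" using snoc \<open>i \<in> {..length w}\<close> by auto
            then have "t q' q (drop i w) = 0" unfolding t_def by (metis length_Cons list.size(3) One_nat_def)
            with False show ?thesis by simp
          qed (simp add: snoc)
        qed
        then show ?thesis by (simp add: snoc)
      qed
      then have "(\<Sum>q'\<in>Q. (char_series (lang q') \<otimes>\<^bsub>?R\<^esub> t q' q) w)
          = (\<Sum>q'\<in>Q. char_series (lang q') u * t q' q [a])"
        by simp
      also have "\<dots> = (\<Sum>q'\<in>Q. if q' = \<delta> q a then (if a \<in> A \<and> ok q a then char_series (lang q') u else 0) else 0)"
        by (intro sum.cong) (auto simp: t_def)
      also have "\<dots> = (if a \<in> A \<and> ok q a then char_series (lang (\<delta> q a)) u else 0)"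
        using \<delta>[OF q, of a] Q by (simp add: sum.delta)
      also have "\<dots> = char_series (lang q) w"
        using step[OF q, of a u] lang[OF q] by (auto simp: char_series_def snoc)
      finally show ?thesis by (simp add: b_def snoc)
    qed
  next
    fix i j
    have "finite {w. t j i w \<noteq> 0}"
      by (rule finite_subset[of _ "(\<lambda>a. [a]) ` A"]) (use A in \<open>auto simp: t_def\<close>)
    then show "t j i \<in> rational_series A \<and> quasi_regular (t j i)"
      by (auto simp: nc_polynomials_def nc_series_ring_def t_def quasi_regular_def
          intro!: rational_series.poly split: if_splits)
  qed
  with q show ?thesis by blast
qed


section \<open>Roots of unity modulo an integer\<close>

lemma map_poly_of_int_mult:
  "map_poly (of_int :: int \<Rightarrow> 'a :: comm_ring_1) (p * q) = map_poly of_int p * map_poly of_int q"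
  by (rule poly_eqI) (simp add: coeff_map_poly coeff_mult)

lemma cis_root_of_unity_power_neq_1:
  assumes "0 < d" "d < n"
  shows "cis (2 * pi / real n) ^ d \<noteq> 1"
proof
  assume "cis (2 * pi / real n) ^ d = 1"
  then have "cis (2 * pi * real d / real n) = cis (2 * pi * real 0 / real n)"
    by (simp add: DeMoivre mult_ac)
  moreover have "inj_on (\<lambda>k. cis (2 * pi * real k / real n)) {..<n}"
    using bij_betw_roots_unity[of n] assms by (simp add: bij_betw_def)
  ultimately have "d = 0"
    using inj_onD[of "\<lambda>k. cis (2 * pi * real k / real n)" "{..<n}" d 0] assms by simp
  with assms show False by simp
qed

abbreviation (input) unity_poly :: "nat \<Rightarrow> int poly" where
  "unity_poly n \<equiv> monom 1 n - 1"

lemma unity_poly_mult_sum: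
  "unity_poly (d * e) = unity_poly d * (\<Sum>i<e. monom 1 d ^ i)"
proof -
  have "monom (1 :: int) (d * e) = monom 1 d ^ e" by (simp add: monom_power)
  then show ?thesis by (simp only: power_diff_1_eq)
qed

text \<open>\<open>l\<close> is a least common multiple of the \<open>x ^ d - 1\<close>. That it
  also divides their product is carried along for the degree of \<open>h\<close>: with
  \<open>h\<close> constant, \<open>x ^ n - 1\<close> would divide that product, of which
  \<open>cis (2 * pi / n)\<close> is not a root.\<close>

lemma primitive_factor_unity_poly:
  assumes "0 < n"
  obtains l h where "unity_poly n = l * h" "\<And>d. d dvd n \<Longrightarrow> d < n \<Longrightarrow> unity_poly d dvd l" "0 < degree h"
proof -
  define D where "D = {d. d dvd n \<and> d < n}"
  have "finite D" by (simp add: D_def)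
  have "\<exists>l. (\<forall>d\<in>B. unity_poly d dvd l) \<and> l dvd unity_poly n \<and> l dvd (\<Prod>d\<in>B. unity_poly d)"
    if "finite B" "B \<subseteq> D" for B
    using that
  proof (induction B)
    case empty
    show ?case by (intro exI[of _ 1]) simp
  next
    case (insert d B)
    then obtain l where l: "\<forall>d\<in>B. unity_poly d dvd l" "l dvd unity_poly n"
      "l dvd (\<Prod>d\<in>B. unity_poly d)" by auto
    from insert.prems obtain e where "n = d * e" by (auto simp: D_def)
    then have "unity_poly d dvd unity_poly n"
      using unity_poly_mult_sum by (metis dvd_triv_left)
    with l insert.hyps show ?case
      by (intro exI[of _ "lcm (unity_poly d) l"]) (auto intro: lcm_least dvd_mult dvd_lcmI2)
  qed
  from this[OF \<open>finite D\<close> order_refl] obtain l where l: "\<forall>d\<in>D. unity_poly d dvd l"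
    "l dvd unity_poly n" "l dvd (\<Prod>d\<in>D. unity_poly d)" by blast
  then obtain h where h: "unity_poly n = l * h" by (auto elim: dvdE)
  have "0 < degree h"
  proof (rule ccontr)
    assume "\<not> 0 < degree h"
    then obtain c where c: "h = [:c:]" using degree_eq_zeroE by blast
    have "coeff (unity_poly n) n = 1"
      using assms by simp
    then have "coeff l n * c = 1" by (simp add: h c mult.commute)
    then have "c dvd 1" by (metis dvd_triv_right)
    then have "is_unit h" by (simp add: c is_unit_const_poly_iff)
    then have "unity_poly n dvd l" unfolding h by (simp add: mult_unit_dvd_iff)
    then have "unity_poly n dvd (\<Prod>d\<in>D. unity_poly d)" using l dvd_trans by blast
    then obtain r where r: "(\<Prod>d\<in>D. unity_poly d) = unity_poly n * r" by (auto elim: dvdE)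
    define ev where "ev = (\<lambda>p. poly (map_poly of_int p) (cis (2 * pi / real n)))"
    have ev_mult: "ev (p * q) = ev p * ev q" for p q
      by (simp add: ev_def map_poly_of_int_mult)
    have ev_unity: "ev (unity_poly d) = cis (2 * pi / real n) ^ d - 1" for d
    proof -
      have "map_poly of_int (unity_poly d) = (monom 1 d - 1 :: complex poly)"
        by (rule poly_eqI) (simp add: coeff_map_poly)
      then show ?thesis by (simp add: ev_def poly_monom)
    qed
    have "ev (\<Prod>d\<in>D. unity_poly d) = (\<Prod>d\<in>D. ev (unity_poly d))"
      using \<open>finite D\<close> by (induction D) (simp_all add: ev_mult, simp add: ev_def)
    moreover have "ev (unity_poly d) \<noteq> 0" if "d \<in> D" for d
    proof -
      have "0 < d" using that assms by (auto simp: D_def intro: gr0I)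
      then show ?thesis
        using that cis_root_of_unity_power_neq_1[of d n] by (simp add: ev_unity D_def)
    qed
    moreover have "ev (unity_poly n) = 0"
      using assms by (simp add: ev_unity DeMoivre)
    ultimately show False
      using r \<open>finite D\<close> by (simp add: ev_mult)
  qed
  with h l that show ?thesis by (auto simp: D_def)
qed

lemma nonconstant_int_poly_large_value:
  fixes h :: "int poly"
  assumes "0 < degree h" "0 < n"
  obtains k where "1 < \<bar>poly h (int n * k)\<bar>"
proof -
  have "finite {x. poly h x = c}" for c
  proof -
    have "h - [:c:] \<noteq> 0" using assms by auto
    from poly_roots_finite[OF this] show ?thesis by simp
  qed
  then have "finite ({x. poly h x = 0} \<union> {x. poly h x = 1} \<union> {x. poly h x = -1})" by simp
  moreover have "infinite (range (\<lambda>k. int n * k))"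
    using assms(2) finite_imageD[of "\<lambda>k. int n * k" UNIV] infinite_UNIV_int by (auto intro: injI)
  ultimately have "\<not> range (\<lambda>k. int n * k) \<subseteq> {x. poly h x = 0} \<union> {x. poly h x = 1} \<union> {x. poly h x = -1}"
    using finite_subset by blast
  then obtain k where "poly h (int n * k) \<noteq> 0" "poly h (int n * k) \<noteq> 1" "poly h (int n * k) \<noteq> -1"
    by auto
  then have "1 < \<bar>poly h (int n * k)\<bar>" by linarith
  then show ?thesis by (rule that)
qed

text \<open>Up to sign, the modulus is the value of the \<open>n\<close>-th cyclotomic polynomial at a multiple \<open>z\<close> of \<open>n\<close>.
  A divisor that it shares with \<open>z ^ d - 1\<close> for some proper divisor \<open>d\<close> of \<open>n\<close> divides \<open>n\<close>, hence
  \<open>z\<close>, and is a unit.\<close>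

lemma strong_primitive_root_of_unity_mod:
  assumes "0 < n"
  obtains z N :: int where "1 < N" "[z ^ n = 1] (mod N)" "\<And>j. 0 < j \<Longrightarrow> j < n \<Longrightarrow> coprime (z ^ j - 1) N"
proof -
  obtain l h where lh: "unity_poly n = l * h" and l: "\<And>d. d dvd n \<Longrightarrow> d < n \<Longrightarrow> unity_poly d dvd l"
    and h: "0 < degree h"
    using primitive_factor_unity_poly[OF assms] by blast
  obtain k where k: "1 < \<bar>poly h (int n * k)\<bar>"
    using nonconstant_int_poly_large_value[OF h assms] .
  define z where "z = int n * k"
  define N where "N = \<bar>poly h z\<bar>"
  have eval: "poly (unity_poly d) z = z ^ d - 1" for d by (simp add: poly_monom)
  have N_dvd: "N dvd z ^ n - 1"
    unfolding eval[symmetric] lh N_def by simp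
  have "coprime (z ^ j - 1) N" if j: "0 < j" "j < n" for j
  proof (rule coprimeI)
    fix q assume q: "q dvd z ^ j - 1" "q dvd N"
    define d where "d = gcd j n"
    have "d dvd n" by (simp add: d_def)
    moreover have "d < n" unfolding d_def using j by (intro le_less_trans[OF gcd_le1_nat]) simp_all
    ultimately have "unity_poly d dvd l" by (rule l)
    then obtain m where m: "l = unity_poly d * m" by (auto elim: dvdE)
    from \<open>d dvd n\<close> obtain e where e: "n = d * e" by (auto elim: dvdE)
    have "0 < d" using e assms by (cases d) auto
    then have "coeff (unity_poly d) d = 1" by simp
    then have "unity_poly d \<noteq> 0" by (metis coeff_0 zero_neq_one)
    moreover have "unity_poly d * (\<Sum>i<e. monom 1 d ^ i) = unity_poly d * (m * h)"
      using unity_poly_mult_sum[of d e] lh by (simp add: e m mult.assoc)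
    \<comment> \<open>As \<open>x ^ d - 1\<close> already divides \<open>l\<close>, the cofactor
      \<open>h\<close> divides the quotient of \<open>x ^ n - 1\<close> by \<open>x ^ d - 1\<close>.
      At \<open>z\<close> this quotient is congruent to \<open>e\<close> modulo \<open>q\<close>,
      since \<open>z ^ d\<close> is congruent to 1.\<close>
    ultimately have "(\<Sum>i<e. monom 1 d ^ i) = m * h" using mult_left_cancel by blast
    then have "poly (\<Sum>i<e. monom 1 d ^ i) z = poly m z * poly h z" by simp
    then have "poly h z dvd (\<Sum>i<e. (z ^ d) ^ i)"
      by (simp add: poly_sum poly_power poly_monom)
    then have q_sum: "q dvd (\<Sum>i<e. (z ^ d) ^ i)"
      using q(2) by (auto simp: N_def dvd_trans)
    have zn: "[z ^ n = 1] (mod q)" and zj: "[z ^ j = 1] (mod q)"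
      using N_dvd q by (auto simp: cong_iff_dvd_diff dvd_trans)
    obtain x y where xy: "j * x = n * y + d"
      using bezout_nat[of j n] j by (auto simp: d_def)
    have zjx: "[z ^ (n * y) * z ^ d = 1] (mod q)"
      using cong_pow[OF zj, of x] by (simp add: power_mult[symmetric] power_add[symmetric] xy)
    have "[z ^ (n * y) = 1] (mod q)"
      using cong_pow[OF zn, of y] by (simp add: power_mult)
    then have "[z ^ (n * y) * z ^ d = 1 * z ^ d] (mod q)"
      by (intro cong_mult cong_refl)
    from cong_trans[OF cong_sym[OF this] zjx] have zd: "[z ^ d = 1] (mod q)" by simp
    have "[(\<Sum>i<e. (z ^ d) ^ i) = (\<Sum>i<e. 1)] (mod q)"
      using cong_pow[OF zd] by (intro cong_sum) simp
    with q_sum have "q dvd int e"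
      by (simp add: cong_dvd_iff)
    then have "q dvd z" by (simp add: z_def e)
    then have "[z ^ n = 0] (mod q)"
      unfolding cong_0_iff using assms dvd_power dvd_trans by blast
    with zn have "[1 = 0] (mod q)" using cong_sym cong_trans by blast
    then show "is_unit q" by (simp add: cong_0_iff)
  qed
  moreover have "[z ^ n = 1] (mod N)" using N_dvd by (simp add: cong_iff_dvd_diff)
  moreover have "1 < N" using k by (simp add: N_def z_def)
  ultimately show ?thesis using that by blast
qed


section \<open>The geometric representation modulo an integer\<close>

text \<open>Serves two actions: the reflections on vectors modulo \<open>N\<close>, and right
  multiplication on \<open>W\<close>, where it is a gallery around a rank 2 residue.\<close>

primrec alt_orbit :: "('a \<Rightarrow> 'x \<Rightarrow> 'x) \<Rightarrow> 'a \<Rightarrow> 'a \<Rightarrow> 'x \<Rightarrow> nat \<Rightarrow> 'x" where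
  "alt_orbit A s t x 0 = x"
| "alt_orbit A s t x (Suc j) = A (if even j then s else t) (alt_orbit A s t x j)"

lemma alt_orbit_even: "alt_orbit A s t x (2 * j) = ((A t \<circ> A s) ^^ j) x"
  by (induction j) simp_all

text \<open>The sequences \<open>a (j + 1) - z' * a j\<close> and \<open>a (j + 1) - z * a j\<close>
  are geometric with ratios \<open>z\<close> and \<open>z'\<close>. Their difference is
  \<open>(z - z') * a j\<close>; the factor stays because it need not be invertible here.\<close>

lemma linear_recurrence_mod_closed_form:
  fixes a :: "nat \<Rightarrow> int"
  assumes inv: "[z * z' = 1] (mod N)"
    and rec: "\<And>j. [a (j + 2) = (z + z') * a (j + 1) - a j] (mod N)"
  shows "[(z - z') * a j = z ^ j * (a 1 - z' * a 0) - z' ^ j * (a 1 - z * a 0)] (mod N)"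
proof -
  have step: "[a (j + 1) - y' * a j = y ^ j * (a 1 - y' * a 0)] (mod N)"
    if inv': "[y * y' = 1] (mod N)" and sum: "y + y' = z + z'" for y y' j
  proof (induction j)
    case (Suc j)
    have "[a (j + 2) - y' * a (j + 1) = ((y + y') * a (j + 1) - a j) - y' * a (j + 1)] (mod N)"
      using rec[of j] unfolding sum by (intro cong_diff cong_refl)
    also have "((y + y') * a (j + 1) - a j) - y' * a (j + 1) = y * a (j + 1) - 1 * a j"
      by (simp add: algebra_simps)
    also have "[\<dots> = y * a (j + 1) - (y * y') * a j] (mod N)"
      using inv' by (intro cong_diff cong_mult cong_refl cong_sym[OF inv'])
    also have "y * a (j + 1) - (y * y') * a j = y * (a (j + 1) - y' * a j)"
      by (simp add: algebra_simps)
    also have "[\<dots> = y * (y ^ j * (a 1 - y' * a 0))] (mod N)"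
      using Suc.IH by (intro cong_mult cong_refl)
    finally show ?case by (simp add: mult.assoc)
  qed simp
  have "[(a (j + 1) - z' * a j) - (a (j + 1) - z * a j)
      = z ^ j * (a 1 - z' * a 0) - z' ^ j * (a 1 - z * a 0)] (mod N)"
    using inv by (intro cong_diff step) (simp_all add: mult.commute)
  then show ?thesis by (simp add: algebra_simps)
qed

lemma cong_0_cancel_coprime:
  fixes x y :: int
  assumes "coprime x N" "[x * y = 0] (mod N)"
  shows "[y = 0] (mod N)"
  using assms by (simp add: cong_0_iff coprime_commute coprime_dvd_mult_right_iff)

text \<open>Here \<open>z\<close> plays the role of \<open>exp (\<pi> * \<i> / k)\<close>.\<close>

locale root_of_unity_mod =
  fixes z N :: int and k :: nat
  assumes k: "2 \<le> k" and root: "[z ^ (2 * k) = 1] (mod N)" and N: "1 < N"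
    and unit: "0 < j \<Longrightarrow> j < 2 * k \<Longrightarrow> coprime (z ^ j - 1) N"
begin

definition z' :: int where "z' = z ^ (2 * k - 1)"

lemma inverse: "[z * z' = 1] (mod N)"
proof -
  have "z * z' = z ^ (2 * k)" using k by (simp add: z'_def flip: power_Suc)
  with root show ?thesis by simp
qed

lemma coprime_diff: "coprime (z - z') N"
proof -
  have "[z * (z - z') = z ^ 2 - 1] (mod N)"
    using cong_diff[OF cong_refl inverse, of "z * z"] by (simp add: algebra_simps power2_eq_square)
  moreover have "coprime (z ^ 2 - 1) N" using unit[of 2] k by simp
  ultimately have "coprime (z * (z - z')) N"
    using cong_imp_coprime cong_sym by blast
  then show ?thesis by simp
qed

lemma geometric_sum_0:
  assumes "[y ^ (2 * k) = 1] (mod N)" "coprime (y ^ 2 - 1) N"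
  shows "[(\<Sum>i<k. y ^ (2 * i)) = 0] (mod N)"
proof -
  have "(y ^ 2 - 1) * (\<Sum>i<k. (y ^ 2) ^ i) = y ^ (2 * k) - 1"
    by (simp only: power_diff_1_eq[symmetric] power_mult)
  then have "[(y ^ 2 - 1) * (\<Sum>i<k. (y ^ 2) ^ i) = 0] (mod N)"
    using assms(1) by (simp add: cong_0_iff cong_iff_dvd_diff)
  with assms(2) have "[(\<Sum>i<k. (y ^ 2) ^ i) = 0] (mod N)" by (rule cong_0_cancel_coprime)
  then show ?thesis by (simp add: power_mult)
qed

text \<open>By \<open>orbit_sum\<close>, such sums over even and odd times are the total
  displacement after \<open>k\<close> rounds of two reflections; their vanishing is the braid
  relation.\<close>

lemma recurrence_sum_0:
  assumes rec: "\<And>j. [a (j + 2) = (z + z') * a (j + 1) - a j] (mod N)"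
  shows "[(\<Sum>i<k. a (2 * i)) = 0] (mod N)"
proof -
  let ?A = "a 1 - z' * a 0" and ?B = "a 1 - z * a 0"
  have z: "[(\<Sum>i<k. z ^ (2 * i)) = 0] (mod N)"
    using root unit[of 2] k by (intro geometric_sum_0) auto
  have z': "[(\<Sum>i<k. z' ^ (2 * i)) = 0] (mod N)"
  proof (rule geometric_sum_0)
    have "z' ^ (2 * k) = (z ^ (2 * k)) ^ (2 * k - 1)"
      by (simp only: z'_def power_mult[symmetric] mult.commute)
    then show "[z' ^ (2 * k) = 1] (mod N)"
      using cong_pow[OF root, of "2 * k - 1"] by simp
    \<comment> \<open>Rewrites \<open>z' ^ 2\<close> as a power of \<open>z\<close> with an exponent
      strictly between 0 and \<open>2 * k\<close>, where \<open>unit\<close> applies.\<close>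
    have "(2 * k - 1) * 2 = 2 * k + (2 * k - 2)" using k by linarith
    then have "z' ^ 2 = z ^ (2 * k) * z ^ (2 * k - 2)"
      by (simp only: z'_def power_mult[symmetric] power_add[symmetric])
    moreover have "[z ^ (2 * k) * z ^ (2 * k - 2) = 1 * z ^ (2 * k - 2)] (mod N)"
      by (intro cong_mult root cong_refl)
    ultimately have "[z' ^ 2 - 1 = z ^ (2 * k - 2) - 1] (mod N)"
      by (intro cong_diff) simp_all
    moreover have "coprime (z ^ (2 * k - 2) - 1) N" using k by (intro unit) auto
    ultimately show "coprime (z' ^ 2 - 1) N" using cong_imp_coprime cong_sym by blast
  qed
  have "[(z - z') * (\<Sum>i<k. a (2 * i)) = (\<Sum>i<k. z ^ (2 * i) * ?A - z' ^ (2 * i) * ?B)] (mod N)"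
    unfolding sum_distrib_left
    by (intro cong_sum linear_recurrence_mod_closed_form inverse rec)
  also have "(\<Sum>i<k. z ^ (2 * i) * ?A - z' ^ (2 * i) * ?B)
      = (\<Sum>i<k. z ^ (2 * i)) * ?A - (\<Sum>i<k. z' ^ (2 * i)) * ?B"
    by (simp only: sum_subtractf sum_distrib_right)
  also have "[\<dots> = 0 * ?A - 0 * ?B] (mod N)"
    by (intro cong_diff cong_mult z z' cong_refl)
  finally have "[(z - z') * (\<Sum>i<k. a (2 * i)) = 0] (mod N)" by simp
  with coprime_diff show ?thesis by (rule cong_0_cancel_coprime)
qed

text \<open>A nonzero remainder \<open>?r\<close> of the exponent would make
  \<open>z ^ ?r - 1\<close> coprime to \<open>N\<close> and at the same time divisible by
  \<open>N\<close>.\<close>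

lemma power_cong_imp:
  assumes "[z ^ (2 * a) = z ^ (2 * b)] (mod N)"
  shows "a mod k = b mod k"
proof -
  have coprime: "coprime (z ^ i) N" for i
  proof -
    have "coprime (z * z') N" using inverse cong_imp_coprime[of 1 "z * z'" N] cong_sym by auto
    then show ?thesis by simp
  qed
  have *: "a mod k = b mod k" if le: "a \<le> b" and ab: "[z ^ (2 * b) = z ^ (2 * a)] (mod N)" for a b
  proof -
    let ?d = "2 * (b - a)"
    have "2 * b = 2 * a + ?d" using le by simp
    then have "z ^ (2 * b) - z ^ (2 * a) = z ^ (2 * a) * (z ^ ?d - 1)"
      by (simp only: right_diff_distrib power_add[symmetric] mult_1_right)
    with ab have "[z ^ (2 * a) * (z ^ ?d - 1) = 0] (mod N)"
      by (simp add: cong_iff_dvd_diff)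
    then have "[z ^ ?d - 1 = 0] (mod N)"
      using coprime cong_0_cancel_coprime by blast
    then have d: "[z ^ ?d = 1] (mod N)" by (simp add: cong_iff_dvd_diff)
    let ?r = "?d mod (2 * k)"
    have "z ^ ?d = (z ^ (2 * k)) ^ (?d div (2 * k)) * z ^ ?r"
      by (simp only: power_mult[symmetric] power_add[symmetric] mult_div_mod_eq)
    moreover have "[(z ^ (2 * k)) ^ (?d div (2 * k)) * z ^ ?r = 1 ^ (?d div (2 * k)) * z ^ ?r] (mod N)"
      by (intro cong_mult cong_pow root cong_refl)
    ultimately have "[z ^ ?d = z ^ ?r] (mod N)" by simp
    with d have r: "[z ^ ?r = 1] (mod N)" using cong_sym cong_trans by blast
    have "?r = 0"
    proof (rule ccontr)
      assume "?r \<noteq> 0"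
      then have "coprime (z ^ ?r - 1) N" using k by (intro unit) auto
      moreover have "N dvd z ^ ?r - 1" using r by (simp add: cong_iff_dvd_diff)
      ultimately have "is_unit N" by (metis coprime_absorb_right coprime_commute dvd_refl coprime_common_divisor)
      with N show False by simp
    qed
    then have "k dvd b - a" by auto
    with le show ?thesis by (metis mod_eq_dvd_iff_nat)
  qed
  show ?thesis
  proof (cases "a \<le> b")
    case True
    then show ?thesis using *[OF _ cong_sym[OF assms]] by simp
  next
    case False
    then show ?thesis using *[OF _ assms] by simp
  qed
qed

end

text \<open>The geometric representation modulo \<open>N\<close>, in the coordinates dual to the simple roots. The
  matrix \<open>c\<close> has the entries \<open>-2\<close> on the diagonal and \<open>2 * cos (\<pi> / m s t)\<close> off the diagonal.\<close>

definition refl_mod :: "'a set \<Rightarrow> ('a \<Rightarrow> 'a \<Rightarrow> int) \<Rightarrow> int \<Rightarrow> 'a \<Rightarrow> ('a \<Rightarrow> int) \<Rightarrow> 'a \<Rightarrow> int" where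
  "refl_mod S c N s f = (\<lambda>u. if u \<in> S then (f u + c s u * f s) mod N else 0)"

text \<open>Reduced representatives that vanish off \<open>S\<close>: congruence becomes equality of
  functions, and for finite \<open>S\<close> the set is finite.\<close>

definition vectors_mod :: "'a set \<Rightarrow> int \<Rightarrow> ('a \<Rightarrow> int) set" where
  "vectors_mod S N = {f. f ` S \<subseteq> {0..<N} \<and> (\<forall>u. u \<notin> S \<longrightarrow> f u = 0)}"

lemma finite_vectors_mod:
  assumes "finite S"
  shows "finite (vectors_mod S N)"
proof -
  have "vectors_mod S N = {f. \<forall>u. (u \<in> S \<longrightarrow> f u \<in> {0..<N}) \<and> (u \<notin> S \<longrightarrow> f u = 0)}"
    unfolding vectors_mod_def by blast
  with finite_set_of_finite_funs[OF assms, of "{0..<N}" 0] show ?thesis by simp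
qed

lemma refl_mod_closed: "1 < N \<Longrightarrow> refl_mod S c N s f \<in> vectors_mod S N"
  by (auto simp: refl_mod_def vectors_mod_def)

lemma vectors_mod_eqI:
  assumes "f \<in> vectors_mod S N" "g \<in> vectors_mod S N" "\<And>u. u \<in> S \<Longrightarrow> [f u = g u] (mod N)"
  shows "f = g"
proof
  fix u
  show "f u = g u"
    using assms by (cases "u \<in> S") (auto simp: vectors_mod_def image_subset_iff intro: cong_less_imp_eq_int)
qed

lemma refl_mod_cong: "u \<in> S \<Longrightarrow> [refl_mod S c N s f u = f u + c s u * f s] (mod N)"
  by (simp add: refl_mod_def cong_def)

lemma refl_mod_involution:
  assumes "s \<in> S" "c s s = -2" "1 < N" "f \<in> vectors_mod S N"
  shows "refl_mod S c N s (refl_mod S c N s f) = f"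
proof (rule vectors_mod_eqI[OF refl_mod_closed[OF assms(3)] assms(4)])
  fix u assume u: "u \<in> S"
  let ?g = "refl_mod S c N s f"
  have "[refl_mod S c N s ?g u = ?g u + c s u * ?g s] (mod N)"
    by (rule refl_mod_cong[OF u])
  also have "[?g u + c s u * ?g s = (f u + c s u * f s) + c s u * (f s + c s s * f s)] (mod N)"
    by (intro cong_add cong_mult refl_mod_cong u assms(1) cong_refl)
  also have "(f u + c s u * f s) + c s u * (f s + c s s * f s) = f u" by (simp add: assms(2) algebra_simps)
  finally show "[refl_mod S c N s ?g u = f u] (mod N)" .
qed

context root_of_unity_mod
begin

context
  fixes S :: "'a set" and c :: "'a \<Rightarrow> 'a \<Rightarrow> int" and s t :: 'a
  assumes st: "s \<in> S" "t \<in> S" "s \<noteq> t"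
    and c: "c s s = -2" "c t t = -2" "c s t = z + z'" "c t s = z + z'"
begin

abbreviation (input) letter :: "nat \<Rightarrow> 'a" where "letter j \<equiv> if even j then s else t"
abbreviation (input) orb :: "('a \<Rightarrow> int) \<Rightarrow> nat \<Rightarrow> 'a \<Rightarrow> int" where
  "orb f j \<equiv> alt_orbit (refl_mod S c N) s t f j"
abbreviation (input) active :: "('a \<Rightarrow> int) \<Rightarrow> nat \<Rightarrow> int" where "active f j \<equiv> orb f j (letter j)"

lemma orbit_cong:
  "u \<in> S \<Longrightarrow> [orb f (Suc j) u = orb f j u + c (letter j) u * active f j] (mod N)"
  by (simp add: refl_mod_cong)

text \<open>The coordinate read at time \<open>j\<close> is read again at time \<open>j + 2\<close>.
  In between it changes twice, by the diagonal entry -2 times itself and by \<open>z + z'\<close>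
  times the value read at time \<open>j + 1\<close>.\<close>

lemma active_recurrence:
  "[active f (j + 2) = (z + z') * active f (j + 1) - active f j] (mod N)"
proof -
  let ?l = "letter j" and ?l' = "letter (j + 1)"
  have l: "letter (j + 2) = ?l" "?l \<in> S" "c ?l' ?l = z + z'" "c ?l ?l = -2"
    using st c by auto
  have "[orb f (Suc (j + 1)) ?l = orb f (j + 1) ?l + c ?l' ?l * active f (j + 1)] (mod N)"
    by (rule orbit_cong[OF l(2)])
  also have "[orb f (j + 1) ?l + c ?l' ?l * active f (j + 1) = (orb f j ?l + c ?l ?l * active f j) + c ?l' ?l * active f (j + 1)] (mod N)"
    by (rule cong_add[OF orbit_cong[OF l(2), of f j, unfolded Suc_eq_plus1] cong_refl])
  also have "(orb f j ?l + c ?l ?l * active f j) + c ?l' ?l * active f (j + 1)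
      = (z + z') * active f (j + 1) - active f j"
    unfolding l(3,4) by simp
  finally show ?thesis unfolding l(1) by simp
qed

lemma orbit_sum:
  assumes "u \<in> S"
  shows "[orb f (2 * j) u = f u + c s u * (\<Sum>i<j. active f (2 * i))
    + c t u * (\<Sum>i<j. active f (2 * i + 1))] (mod N)"
proof (induction j)
  case (Suc j)
  have "[orb f (Suc (2 * j + 1)) u = orb f (2 * j + 1) u + c t u * active f (2 * j + 1)] (mod N)"
    using orbit_cong[OF assms, of f "2 * j + 1"] by simp
  also have "[orb f (2 * j + 1) u + c t u * active f (2 * j + 1)
      = (orb f (2 * j) u + c s u * active f (2 * j)) + c t u * active f (2 * j + 1)] (mod N)"
    using orbit_cong[OF assms, of f "2 * j"] by (intro cong_add cong_refl) simp
  also have "[(orb f (2 * j) u + c s u * active f (2 * j)) + c t u * active f (2 * j + 1)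
      = (f u + c s u * (\<Sum>i<j. active f (2 * i))
    + c t u * (\<Sum>i<j. active f (2 * i + 1)) + c s u * active f (2 * j)) + c t u * active f (2 * j + 1)] (mod N)"
    by (intro cong_add cong_refl Suc.IH)
  finally show ?case by (simp add: algebra_simps)
qed simp

lemma relation_refl_mod:
  assumes f: "f \<in> vectors_mod S N"
  shows "((refl_mod S c N t \<circ> refl_mod S c N s) ^^ k) f = f"
proof -
  have even: "[(\<Sum>i<k. active f (2 * i)) = 0] (mod N)"
    by (rule recurrence_sum_0) (rule active_recurrence)
  have "[(\<Sum>i<k. active f (2 * i + 1)) = 0] (mod N)"
    using active_recurrence[of f "j + 1" for j]
    by (intro recurrence_sum_0[where a = "\<lambda>j. active f (j + 1)"]) simp
  note odd = this
  have "orb f (2 * k) = f"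
  proof (rule vectors_mod_eqI[OF _ f])
    obtain i where "2 * k = Suc i" using k by (cases k) auto
    then show "orb f (2 * k) \<in> vectors_mod S N" by (simp add: refl_mod_closed N)
    fix u assume u: "u \<in> S"
    have "[orb f (2 * k) u = f u + c s u * (\<Sum>i<k. active f (2 * i))
      + c t u * (\<Sum>i<k. active f (2 * i + 1))] (mod N)" by (rule orbit_sum[OF u])
    also have "[f u + c s u * (\<Sum>i<k. active f (2 * i)) + c t u * (\<Sum>i<k. active f (2 * i + 1))
      = f u + c s u * 0 + c t u * 0] (mod N)"
      by (intro cong_add cong_mult even odd cong_refl)
    finally show "[orb f (2 * k) u = f u] (mod N)" by simp
  qed
  then show ?thesis by (simp only: alt_orbit_even)
qed

lemma relation_refl_mod_exact:
  obtains f where "f \<in> vectors_mod S N"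
    and "\<And>a b. ((refl_mod S c N t \<circ> refl_mod S c N s) ^^ a) f
      = ((refl_mod S c N t \<circ> refl_mod S c N s) ^^ b) f \<Longrightarrow> a mod k = b mod k"
proof -
  \<comment> \<open>Chosen so that the values read at times 0 and 1 are 1 and
    \<open>- z' + (z + z') = z\<close>. Then the sequence is the pure power \<open>z ^ j\<close>,
    from which the exponent can be recovered.\<close>
  define f where "f = (\<lambda>u. if u = s then 1 else if u = t then (- z') mod N else 0)"
  have f: "f \<in> vectors_mod S N"
    using N st by (auto simp: f_def vectors_mod_def)
  have "[orb f (Suc 0) t = orb f 0 t + c s t * active f 0] (mod N)"
    using orbit_cong[of t f 0] st by simp
  also have "[orb f 0 t + c s t * active f 0 = - z' + c s t * active f 0] (mod N)"
    using st by (intro cong_add cong_refl) (simp add: f_def cong_def)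
  finally have a1: "[active f 1 = z] (mod N)" by (simp add: f_def c)
  have active: "[active f j = z ^ j] (mod N)" for j
  proof -
    have "[(z - z') * active f j = z ^ j * (active f 1 - z' * active f 0)
        - z' ^ j * (active f 1 - z * active f 0)] (mod N)"
      by (intro linear_recurrence_mod_closed_form[where a = "active f"] inverse active_recurrence)
    also have "[z ^ j * (active f 1 - z' * active f 0) - z' ^ j * (active f 1 - z * active f 0)
        = z ^ j * (z - z' * active f 0) - z' ^ j * (z - z * active f 0)] (mod N)"
      by (intro cong_diff cong_mult a1 cong_refl)
    also have "z ^ j * (z - z' * active f 0) - z' ^ j * (z - z * active f 0) = (z - z') * z ^ j"
      by (simp add: f_def)
    finally show ?thesis using coprime_diff by (simp add: cong_mult_lcancel coprime_commute)
  qed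
  show ?thesis
  proof (rule that[OF f])
    fix a b
    assume "((refl_mod S c N t \<circ> refl_mod S c N s) ^^ a) f
      = ((refl_mod S c N t \<circ> refl_mod S c N s) ^^ b) f"
    then have "orb f (2 * a) = orb f (2 * b)" by (simp only: alt_orbit_even)
    then have "active f (2 * a) = active f (2 * b)" by simp
    then have "[z ^ (2 * a) = z ^ (2 * b)] (mod N)"
      using active[of "2 * a"] active[of "2 * b"] by (metis cong_sym cong_trans)
    then show "a mod k = b mod k" by (rule power_cong_imp)
  qed
qed

end

end


section \<open>Words in a Coxeter group\<close>

locale coxeter = group W for W :: "('a, 'b) monoid_scheme" (structure) +
  fixes S :: "'a set" and m :: "'a \<Rightarrow> 'a \<Rightarrow> enat"
  assumes system: "coxeter_system W S m"
begin

lemma inv_cancel_left [simp]: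
  "g \<in> carrier W \<Longrightarrow> x \<in> carrier W \<Longrightarrow> inv g \<otimes> (g \<otimes> x) = x"
  "g \<in> carrier W \<Longrightarrow> x \<in> carrier W \<Longrightarrow> g \<otimes> (inv g \<otimes> x) = x"
  by (simp_all add: m_assoc[symmetric])

lemma S_carrier: "s \<in> S \<Longrightarrow> s \<in> carrier W"
  using system by (auto simp: coxeter_system_def has_presentation_def)

lemma generate_S: "generate W S = carrier W"
  using system by (auto simp: coxeter_system_def has_presentation_def)

lemma m_commute: "s \<in> S \<Longrightarrow> t \<in> S \<Longrightarrow> m s t = m t s"
  and m_eq_1_iff: "s \<in> S \<Longrightarrow> t \<in> S \<Longrightarrow> m s t = 1 \<longleftrightarrow> s = t"
  and m_ge_1: "s \<in> S \<Longrightarrow> t \<in> S \<Longrightarrow> 1 \<le> m s t"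
  using system by (auto simp: coxeter_system_def coxeter_matrix_def)

lemma m_pos: "s \<in> S \<Longrightarrow> t \<in> S \<Longrightarrow> m s t = enat k \<Longrightarrow> 0 < k"
  using m_ge_1[of s t] by (cases k) (simp_all add: one_enat_def)

lemma kernel:
  "u \<in> lists (S \<times> UNIV) \<Longrightarrow> word_eval W u = \<one> \<longleftrightarrow> pres_eq S (coxeter_relators S m) u []"
  using system by (auto simp: coxeter_system_def has_presentation_def)

lemma relator_eval:
  assumes "s \<in> S" "t \<in> S" "m s t = enat k"
  shows "word_eval W (concat (replicate k [(s, True), (t, True)])) = \<one>"
proof -
  have "concat (replicate k [(s, True), (t, True)]) \<in> lists (S \<times> UNIV)"
    using assms(1,2) by (induction k) auto
  moreover have "concat (replicate k [(s, True), (t, True)]) \<in> coxeter_relators S m"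
    using assms by (auto simp: coxeter_relators_def)
  ultimately show ?thesis using kernel pres_eq.relator by blast
qed

lemma S_square: "s \<in> S \<Longrightarrow> s \<otimes> s = \<one>"
  using relator_eval[of s s 1] m_eq_1_iff[of s s] S_carrier[of s]
  by (simp add: word_eval_def one_enat_def)

lemma S_inv: "s \<in> S \<Longrightarrow> inv s = s"
  using S_square S_carrier inv_equality by blast

definition ev :: "'a list \<Rightarrow> 'a" where
  "ev ws = foldr (\<otimes>) ws \<one>"

lemma ev_Nil [simp]: "ev [] = \<one>"
  and ev_Cons [simp]: "ev (s # ws) = s \<otimes> ev ws"
  by (simp_all add: ev_def)

lemma ev_closed [simp, intro]: "ws \<in> lists S \<Longrightarrow> ev ws \<in> carrier W"
  by (induction ws) (auto simp: S_carrier)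

lemma ev_append [simp]: "us \<in> lists S \<Longrightarrow> ws \<in> lists S \<Longrightarrow> ev (us @ ws) = ev us \<otimes> ev ws"
  by (induction us) (auto simp: S_carrier m_assoc)

lemma rev_in_lists [simp]: "rev ws \<in> lists A \<longleftrightarrow> ws \<in> lists A"
  by (simp add: in_lists_conv_set)

lemma inv_ev: "ws \<in> lists S \<Longrightarrow> inv (ev ws) = ev (rev ws)"
proof (induction ws)
  case (Cons a ws)
  then have "rev ws \<in> lists S" by auto
  with Cons show ?case
    using ev_append[of "rev ws" "[a]"] by (simp add: S_carrier S_inv inv_mult_group)
qed simp

lemma word_eval_conv_ev: "u \<in> lists (S \<times> UNIV) \<Longrightarrow> word_eval W u = ev (map fst u)"
  by (induction u) (auto simp: word_eval_def S_inv)

lemma generate_imp_word: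
  assumes "g \<in> generate W \<sigma>" "\<sigma> \<subseteq> S"
  obtains ws where "ws \<in> lists \<sigma>" "ev ws = g"
proof -
  from assms(1) have "\<exists>ws\<in>lists \<sigma>. ev ws = g"
  proof induction
    case one
    show ?case by (rule bexI[of _ "[]"]) simp_all
  next
    case (incl h)
    then show ?case using assms(2) S_carrier by (intro bexI[of _ "[h]"]) auto
  next
    case (inv h)
    then show ?case using assms(2) S_carrier S_inv[of h] by (intro bexI[of _ "[h]"]) auto
  next
    case (eng h1 h2)
    then obtain us ws where "us \<in> lists \<sigma>" "ev us = h1" "ws \<in> lists \<sigma>" "ev ws = h2" by blast
    moreover have "us \<in> lists S" "ws \<in> lists S"
      using calculation assms(2) lists_mono by blast+
    ultimately show ?case by (intro bexI[of _ "us @ ws"]) auto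
  qed
  then show ?thesis using that by blast
qed

lemma ev_generate: "ws \<in> lists \<sigma> \<Longrightarrow> ev ws \<in> generate W \<sigma>"
  by (induction ws) (auto intro: generate.intros)

lemma carrier_imp_word:
  assumes "g \<in> carrier W" obtains ws where "ws \<in> lists S" "ev ws = g"
  using assms generate_imp_word[of g S] generate_S by blast

lemma carrier_induct [consumes 1, case_names one step]:
  assumes "g \<in> carrier W" and "P \<one>"
    and "\<And>g s. g \<in> carrier W \<Longrightarrow> s \<in> S \<Longrightarrow> P g \<Longrightarrow> P (g \<otimes> s)"
  shows "P g"
proof -
  obtain ws where "ws \<in> lists S" "ev ws = g" using assms(1) by (rule carrier_imp_word)
  moreover have "P (ev ws)" if "ws \<in> lists S" for ws
    using that
  proof (induction ws rule: rev_induct)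
    case (snoc s ws)
    then show ?case using assms(3)[of "ev ws" s] S_carrier by auto
  qed (simp add: assms(2))
  ultimately show ?thesis by blast
qed

lemma fold_action_closed:
  assumes "\<And>s x. s \<in> S \<Longrightarrow> x \<in> X \<Longrightarrow> act s x \<in> X" "ws \<in> lists S" "x \<in> X"
  shows "fold act ws x \<in> X"
  using assms(2,3) by (induction ws arbitrary: x) (auto simp: assms(1))

lemma fold_concat_replicate:
  "fold act (concat (replicate k [s, t])) x = ((act t \<circ> act s) ^^ k) x"
  by (induction k arbitrary: x) (simp_all add: funpow_swap1)

text \<open>The universal property of the presentation for right actions on \<open>X\<close>: by
  induction on \<open>pres_eq\<close>, a word that evaluates to the identity acts trivially. It is
  applied to \<open>us\<close> followed by the reverse of \<open>ws\<close>.\<close>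

lemma fold_action_eq:
  assumes closed: "\<And>s x. s \<in> S \<Longrightarrow> x \<in> X \<Longrightarrow> act s x \<in> X"
    and invol: "\<And>s x. s \<in> S \<Longrightarrow> x \<in> X \<Longrightarrow> act s (act s x) = x"
    and rel: "\<And>s t k x. s \<in> S \<Longrightarrow> t \<in> S \<Longrightarrow> m s t = enat k \<Longrightarrow> x \<in> X \<Longrightarrow> ((act t \<circ> act s) ^^ k) x = x"
    and us: "us \<in> lists S" and ws: "ws \<in> lists S" and eq: "ev us = ev ws" and x: "x \<in> X"
  shows "fold act us x = fold act ws x"
proof -
  have fold_eq: "\<forall>x\<in>X. fold act (map fst u) x = fold act (map fst v) x"
    if "pres_eq S (coxeter_relators S m) u v" for u v
    using that
  proof induction
    case (relator r)
    then obtain s t k where r: "r = concat (replicate k [(s, True), (t, True)])" and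
      st: "s \<in> S" "t \<in> S" "m s t = enat k"
      by (auto simp: coxeter_relators_def)
    have "map fst r = concat (replicate k [s, t])" by (simp add: r map_concat)
    then show ?case using rel[OF st] by (simp add: fold_concat_replicate)
  next
    case (cong x y u v)
    have "map fst x \<in> lists S" using cong.hyps(1) by (induction x) auto
    then have "fold act (map fst x) z \<in> X" if "z \<in> X" for z
      using fold_action_closed[where act = act] closed that by blast
    then show ?case using cong.IH by simp
  qed (simp_all add: invol)
  have rev: "fold act (rev ws) (fold act ws y) = y" if "ws \<in> lists S" "y \<in> X" for ws y
    using that
  proof (induction ws arbitrary: y)
    case (Cons s ws)
    then show ?case using closed invol by simp
  qed simp
  let ?u = "map (\<lambda>s. (s, True)) (us @ rev ws)"
  have map_u: "map fst ?u = us @ rev ws" by (simp add: comp_def)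
  have u: "?u \<in> lists (S \<times> UNIV)" using us ws by auto
  have "word_eval W ?u = ev us \<otimes> inv (ev ws)"
    unfolding word_eval_conv_ev[OF u] map_u using us ws by (simp add: inv_ev)
  then have "word_eval W ?u = \<one>" using eq ws by simp
  then have "pres_eq S (coxeter_relators S m) ?u []" using kernel[OF u] by simp
  from fold_eq[OF this] have *: "fold act (us @ rev ws) y = y" if "y \<in> X" for y
    unfolding map_u using that by simp
  have "fold act us x \<in> X" using fold_action_closed[where act = act] closed us x by blast
  then have "fold act us x = fold act (rev (rev ws)) (fold act (rev ws) (fold act us x))"
    using rev[of "rev ws"] ws by simp
  then show ?thesis using *[OF x] by simp
qed

section \<open>Galleries around a rank 2 residue\<close>

abbreviation (input) gallery :: "'a \<Rightarrow> 'a \<Rightarrow> 'a \<Rightarrow> nat \<Rightarrow> 'a" where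
  "gallery g s t \<equiv> alt_orbit (\<lambda>s g. g \<otimes> s) s t g"

lemma gallery_closed: "g \<in> carrier W \<Longrightarrow> s \<in> S \<Longrightarrow> t \<in> S \<Longrightarrow> gallery g s t i \<in> carrier W"
  by (induction i) (auto simp: S_carrier)

lemma gallery_even:
  "g \<in> carrier W \<Longrightarrow> s \<in> S \<Longrightarrow> t \<in> S \<Longrightarrow> gallery g s t (2 * i) = g \<otimes> (s \<otimes> t) [^] i"
  by (induction i) (simp_all add: S_carrier m_assoc)

lemma gallery_odd:
  "g \<in> carrier W \<Longrightarrow> s \<in> S \<Longrightarrow> t \<in> S \<Longrightarrow> gallery g s t (2 * i + 1) = g \<otimes> (s \<otimes> t) [^] i \<otimes> s"
  using gallery_even by simp

lemma relation:
  assumes "s \<in> S" "t \<in> S" "m s t = enat k"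
  shows "(s \<otimes> t) [^] k = \<one>"
proof -
  have *: "word_eval W (concat (replicate k [(s, True), (t, True)])) = (s \<otimes> t) [^] k"
  proof (induction k)
    case (Suc k)
    have "word_eval W (concat (replicate (Suc k) [(s, True), (t, True)]))
        = s \<otimes> (t \<otimes> word_eval W (concat (replicate k [(s, True), (t, True)])))"
      by (simp add: word_eval_def)
    then show ?case
      using Suc assms S_carrier nat_pow_Suc2[of "s \<otimes> t" k] by (simp add: m_assoc)
  qed (simp add: word_eval_def)
  show ?thesis using relator_eval[OF assms] * by simp
qed

lemma S_pow_flip:
  assumes "s \<in> S" "t \<in> S"
  shows "(s \<otimes> t) [^] (i::nat) \<otimes> s = s \<otimes> inv ((s \<otimes> t) [^] i)"
proof (induction i)
  case (Suc i)
  have c: "s \<in> carrier W" "t \<in> carrier W" using assms S_carrier by auto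
  let ?x = "s \<otimes> t"
  have "?x [^] Suc i \<otimes> s = ?x \<otimes> (?x [^] i \<otimes> s)"
    using c nat_pow_Suc2[of ?x i] by (simp add: m_assoc)
  also have "\<dots> = (?x \<otimes> s) \<otimes> inv (?x [^] i)" using c Suc by (simp add: m_assoc)
  also have "?x \<otimes> s = s \<otimes> inv ?x" using c assms by (simp add: inv_mult_group S_inv m_assoc)
  also have "s \<otimes> inv ?x \<otimes> inv (?x [^] i) = s \<otimes> inv (?x [^] Suc i)"
    using c by (simp add: inv_mult_group m_assoc)
  finally show ?case .
qed (use assms S_carrier in simp)

text \<open>The reflection in the wall crossed by step \<open>i\<close> of the gallery, counted from
  0. One formula covers both parities, because conjugating \<open>s\<close> by
  \<open>(s \<otimes> t) [^] j\<close> gives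
  \<open>(s \<otimes> t) [^] (2 * j) \<otimes> s\<close>.\<close>

definition rank2_refl :: "'a \<Rightarrow> 'a \<Rightarrow> 'a \<Rightarrow> nat \<Rightarrow> 'a" where
  "rank2_refl g s t i = g \<otimes> ((s \<otimes> t) [^] i \<otimes> s) \<otimes> inv g"

lemma rank2_refl_closed: "g \<in> carrier W \<Longrightarrow> s \<in> S \<Longrightarrow> t \<in> S \<Longrightarrow> rank2_refl g s t i \<in> carrier W"
  by (simp add: rank2_refl_def S_carrier)

lemma gallery_wall:
  assumes g: "g \<in> carrier W" and st: "s \<in> S" "t \<in> S"
  shows "gallery g s t i \<otimes> (if even i then s else t) \<otimes> inv (gallery g s t i) = rank2_refl g s t i"
proof -
  have c: "s \<in> carrier W" "t \<in> carrier W" using st S_carrier by auto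
  let ?x = "s \<otimes> t"
  have flip: "s \<otimes> inv (?x [^] j) = ?x [^] j \<otimes> s" for j :: nat
    using S_pow_flip[OF st] by simp
  show ?thesis
  proof (cases "even i")
    case True
    then obtain j where i: "i = 2 * j" by (auto elim: evenE)
    have "gallery g s t i \<otimes> s \<otimes> inv (gallery g s t i) = g \<otimes> ?x [^] j \<otimes> s \<otimes> (inv (?x [^] j) \<otimes> inv g)"
      using g c st unfolding i gallery_even[OF g st] by (simp add: inv_mult_group)
    also have "\<dots> = g \<otimes> (?x [^] j \<otimes> (s \<otimes> inv (?x [^] j))) \<otimes> inv g"
      using g c by (simp add: m_assoc)
    also have "?x [^] j \<otimes> (s \<otimes> inv (?x [^] j)) = ?x [^] i \<otimes> s"
      unfolding flip i using c by (simp add: m_assoc[symmetric] nat_pow_mult mult_2)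
    finally show ?thesis using True by (simp add: rank2_refl_def)
  next
    case False
    then obtain j where i: "i = 2 * j + 1" by (auto elim: oddE)
    have "gallery g s t i \<otimes> t \<otimes> inv (gallery g s t i) = g \<otimes> ?x [^] j \<otimes> s \<otimes> t \<otimes> (s \<otimes> inv (?x [^] j) \<otimes> inv g)"
      using g c st unfolding i gallery_odd[OF g st] by (simp add: inv_mult_group S_inv m_assoc)
    also have "\<dots> = g \<otimes> (?x [^] j \<otimes> ?x \<otimes> (s \<otimes> inv (?x [^] j))) \<otimes> inv g"
      using g c by (simp add: m_assoc)
    also have "?x [^] j \<otimes> ?x \<otimes> (s \<otimes> inv (?x [^] j)) = ?x [^] (Suc j + j) \<otimes> s"
      unfolding flip using c nat_pow_mult[of ?x "Suc j" j] by (simp add: m_assoc[symmetric])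
    finally show ?thesis using False by (simp add: rank2_refl_def i mult_2)
  qed
qed

lemma rank2_refl_periodic:
  assumes "g \<in> carrier W" "s \<in> S" "t \<in> S" "(s \<otimes> t) [^] k = \<one>"
  shows "rank2_refl g s t (i + k) = rank2_refl g s t i"
proof -
  have "(s \<otimes> t) [^] (i + k) = (s \<otimes> t) [^] i"
    using assms S_carrier nat_pow_mult[of "s \<otimes> t" i k] by simp
  then show ?thesis by (simp add: rank2_refl_def)
qed

text \<open>First cohomology modulo 2 of the Cayley complex vanishes: an edge function with even sum
  around each relator loop is the coboundary of a potential \<open>P\<close>.\<close>

lemma edge_potential:
  assumes sym: "\<And>g s. g \<in> carrier W \<Longrightarrow> s \<in> S \<Longrightarrow> \<kappa> (g \<otimes> s) s = \<kappa> g s"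
    and loop: "\<And>g s t k. g \<in> carrier W \<Longrightarrow> s \<in> S \<Longrightarrow> t \<in> S \<Longrightarrow> m s t = enat k \<Longrightarrow>
      even (card {i. i < 2 * k \<and> \<kappa> (gallery g s t i) (if even i then s else t)})"
  obtains P where "\<not> P \<one>" "\<And>g s. g \<in> carrier W \<Longrightarrow> s \<in> S \<Longrightarrow> P (g \<otimes> s) = (P g \<noteq> \<kappa> g s)"
proof -
  \<comment> \<open>Walks along an edge and toggles a bit when \<open>\<kappa>\<close> holds there.
    The loop condition says that the relators restore the bit, so the bit depends only on the group
    element reached.\<close>
  define act where "act = (\<lambda>s (g, b). (g \<otimes> s, b \<noteq> \<kappa> g s))"
  define X where "X = carrier W \<times> (UNIV :: bool set)"
  have orbit: "alt_orbit act s t (g, b) j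
      = (gallery g s t j, b \<noteq> odd (card {i. i < j \<and> \<kappa> (gallery g s t i) (if even i then s else t)}))"
    for s t g b j
  proof (induction j)
    case (Suc j)
    have "{i. i < Suc j \<and> \<kappa> (gallery g s t i) (if even i then s else t)} =
      (if \<kappa> (gallery g s t j) (if even j then s else t)
        then insert j {i. i < j \<and> \<kappa> (gallery g s t i) (if even i then s else t)}
        else {i. i < j \<and> \<kappa> (gallery g s t i) (if even i then s else t)})"
      by (auto simp: less_Suc_eq)
    then have "odd (card {i. i < Suc j \<and> \<kappa> (gallery g s t i) (if even i then s else t)})
      = (odd (card {i. i < j \<and> \<kappa> (gallery g s t i) (if even i then s else t)})
        \<noteq> \<kappa> (gallery g s t j) (if even j then s else t))"
      by simp
    then show ?case using Suc.IH by (simp add: act_def del: alt_orbit.simps(2)) (auto simp: act_def)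
  qed simp
  have fold_eq: "fold act us x = fold act ws x"
    if "us \<in> lists S" "ws \<in> lists S" "ev us = ev ws" "x \<in> X" for us ws x
  proof (rule fold_action_eq[OF _ _ _ that])
    fix s x assume "s \<in> S" "x \<in> X"
    then show "act s x \<in> X" "act s (act s x) = x"
      using S_carrier sym by (auto simp: act_def X_def m_assoc S_square)
  next
    fix s t k x assume st: "s \<in> S" "t \<in> S" "m s t = enat k" and "x \<in> X"
    then obtain g b where x: "x = (g, b)" "g \<in> carrier W" by (auto simp: X_def)
    have "gallery g s t (2 * k) = g"
      using gallery_even[OF x(2) st(1,2)] relation[OF st] x(2) by simp
    then show "((act t \<circ> act s) ^^ k) x = x"
      unfolding alt_orbit_even[symmetric] x orbit using loop[OF x(2) st] by simp
  qed
  have fst_fold: "fst (fold act ws (\<one>, False)) = ev ws" if "ws \<in> lists S" for ws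
    using that by (induction ws rule: rev_induct) (auto simp: act_def S_carrier split: prod.splits)
  define word where "word g = (SOME ws. ws \<in> lists S \<and> ev ws = g)" for g
  have word: "word g \<in> lists S" "ev (word g) = g" if "g \<in> carrier W" for g
    using carrier_imp_word[OF that] someI_ex[of "\<lambda>ws. ws \<in> lists S \<and> ev ws = g"]
    unfolding word_def by blast+
  define P where "P g = snd (fold act (word g) (\<one>, False))" for g
  have P_ev: "P (ev ws) = snd (fold act ws (\<one>, False))" if "ws \<in> lists S" for ws
    unfolding P_def using that word by (subst fold_eq[of "word (ev ws)" ws]) (auto simp: X_def)
  show ?thesis
  proof (rule that[of P])
    show "\<not> P \<one>" using P_ev[of "[]"] by simp
    fix g s assume g: "g \<in> carrier W" and s: "s \<in> S"
    have "P (g \<otimes> s) = snd (fold act (word g @ [s]) (\<one>, False))"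
      using P_ev[of "word g @ [s]"] word[OF g] s S_carrier by simp
    also have "\<dots> = (P g \<noteq> \<kappa> g s)"
      using fst_fold[OF word(1)[OF g]] word[OF g]
      by (cases "fold act (word g) (\<one>, False)") (simp add: act_def P_def)
    finally show "P (g \<otimes> s) = (P g \<noteq> \<kappa> g s)" .
  qed
qed

text \<open>A relator loop has \<open>2 * k\<close> steps and repeats its walls after
  \<open>k\<close> of them, so it meets every wall in antipodal pairs.\<close>

lemma even_card_periodic:
  assumes "\<And>i. Q (i + k) = Q (i :: nat)"
  shows "even (card {i. i < 2 * k \<and> Q i})"
proof -
  have "{i. i < 2 * k \<and> Q i} = {i. i < k \<and> Q i} \<union> (\<lambda>i. i + k) ` {i. i < k \<and> Q i}"
  proof (rule Set.set_eqI)
    fix i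
    show "i \<in> {i. i < 2 * k \<and> Q i} \<longleftrightarrow> i \<in> {i. i < k \<and> Q i} \<union> (\<lambda>i. i + k) ` {i. i < k \<and> Q i}"
    proof (cases "i < k")
      case False
      then obtain j where "i = j + k" by (metis add.commute le_Suc_ex not_less)
      then show ?thesis using assms[of j] by auto
    qed auto
  qed
  moreover have "card ((\<lambda>i. i + k) ` {i. i < k \<and> Q i}) = card {i. i < k \<and> Q i}"
    by (intro card_image) simp
  moreover have "{i. i < k \<and> Q i} \<inter> (\<lambda>i. i + k) ` {i. i < k \<and> Q i} = {}" by auto
  ultimately show ?thesis by (simp add: card_Un_disjoint)
qed

end


section \<open>Inversions and length\<close>

context coxeter
begin

abbreviation (input) wall :: "'a \<Rightarrow> 'a \<Rightarrow> 'a" where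
  "wall g s \<equiv> g \<otimes> s \<otimes> inv g"

lemma wall_step: "g \<in> carrier W \<Longrightarrow> s \<in> S \<Longrightarrow> wall (g \<otimes> s) s = wall g s"
  by (simp add: S_carrier inv_mult_group S_inv m_assoc S_square)

lemma wall_conj:
  assumes "g \<in> carrier W" "h \<in> carrier W" "s \<in> S" "\<tau> \<in> carrier W"
  shows "wall (g \<otimes> h) s = \<tau> \<longleftrightarrow> wall h s = inv g \<otimes> \<tau> \<otimes> g"
proof
  assume "wall (g \<otimes> h) s = \<tau>"
  then show "wall h s = inv g \<otimes> \<tau> \<otimes> g"
    using assms S_carrier by (auto simp: inv_mult_group m_assoc inv_solve_left')
next
  assume *: "wall h s = inv g \<otimes> \<tau> \<otimes> g"
  have "wall (g \<otimes> h) s = g \<otimes> wall h s \<otimes> inv g"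
    using assms S_carrier by (simp add: inv_mult_group m_assoc)
  then show "wall (g \<otimes> h) s = \<tau>"
    unfolding * using assms by (simp add: m_assoc inv_solve_left')
qed

text \<open>The parity with which a gallery from the identity to \<open>g\<close> crosses the wall
  of \<tau>. The conditions determine \<open>P\<close> on the carrier; its existence says that the
  choice of gallery does not matter.\<close>

definition crossing_parity :: "'a \<Rightarrow> 'a \<Rightarrow> bool" where
  "crossing_parity \<tau> = (SOME P. \<not> P \<one> \<and>
    (\<forall>g\<in>carrier W. \<forall>s\<in>S. P (g \<otimes> s) = (P g \<noteq> (wall g s = \<tau>))))"

lemma crossing_parity:
  "\<not> crossing_parity \<tau> \<one>"
  "g \<in> carrier W \<Longrightarrow> s \<in> S \<Longrightarrow> crossing_parity \<tau> (g \<otimes> s) = (crossing_parity \<tau> g \<noteq> (wall g s = \<tau>))"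
proof -
  obtain P where "\<not> P \<one>" "\<And>g s. g \<in> carrier W \<Longrightarrow> s \<in> S \<Longrightarrow> P (g \<otimes> s) = (P g \<noteq> (wall g s = \<tau>))"
  proof (rule edge_potential[of "\<lambda>g s. wall g s = \<tau>"])
    fix g s t k assume g: "g \<in> carrier W" and st: "s \<in> S" "t \<in> S" "m s t = enat k"
    have "even (card {i. i < 2 * k \<and> rank2_refl g s t i = \<tau>})"
      using rank2_refl_periodic[OF g st(1,2) relation[OF st]] by (intro even_card_periodic) simp
    then show "even (card {i. i < 2 * k \<and>
        wall (gallery g s t i) (if even i then s else t) = \<tau>})"
      unfolding gallery_wall[OF g st(1,2)] .
  qed (auto simp: wall_step)
  then have "\<exists>P. \<not> P \<one> \<and> (\<forall>g\<in>carrier W. \<forall>s\<in>S. P (g \<otimes> s) = (P g \<noteq> (wall g s = \<tau>)))"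
    by blast
  from someI_ex[OF this]
  show "\<not> crossing_parity \<tau> \<one>"
    "g \<in> carrier W \<Longrightarrow> s \<in> S \<Longrightarrow> crossing_parity \<tau> (g \<otimes> s) = (crossing_parity \<tau> g \<noteq> (wall g s = \<tau>))"
    unfolding crossing_parity_def by blast+
qed

text \<open>The reflections \<open>\<tau>\<close> whose wall separates \<open>g\<close> from the identity.\<close>

definition inversions :: "'a \<Rightarrow> 'a set" where
  "inversions g = {\<tau> \<in> carrier W. crossing_parity \<tau> g}"

definition reflections :: "'a set" where
  "reflections = {wall g s | g s. g \<in> carrier W \<and> s \<in> S}"

lemma reflectionsI: "g \<in> carrier W \<Longrightarrow> s \<in> S \<Longrightarrow> wall g s \<in> reflections"
  by (auto simp: reflections_def)

lemma reflections_closed: "t \<in> reflections \<Longrightarrow> t \<in> carrier W"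
  by (auto simp: reflections_def S_carrier)

lemma S_reflection: "s \<in> S \<Longrightarrow> s \<in> reflections"
  using reflectionsI[of \<one> s] by (simp add: S_carrier)

lemma reflections_conj:
  assumes "t \<in> reflections" "g \<in> carrier W"
  shows "g \<otimes> t \<otimes> inv g \<in> reflections"
proof -
  obtain h s where h: "h \<in> carrier W" "s \<in> S" and t: "t = wall h s"
    using assms(1) by (auto simp: reflections_def)
  have "g \<otimes> t \<otimes> inv g = wall (g \<otimes> h) s"
    using h assms(2) S_carrier by (simp add: t inv_mult_group m_assoc)
  then show ?thesis using h assms(2) by (simp add: reflectionsI)
qed

lemma reflections_conj': "t \<in> reflections \<Longrightarrow> g \<in> carrier W \<Longrightarrow> inv g \<otimes> t \<otimes> g \<in> reflections"
  using reflections_conj[of t "inv g"] by simp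

lemma reflection_square:
  assumes "t \<in> reflections"
  shows "t \<otimes> t = \<one>"
proof -
  obtain h s where h: "h \<in> carrier W" "s \<in> S" and t: "t = wall h s"
    using assms by (auto simp: reflections_def)
  have "t \<otimes> t = h \<otimes> (s \<otimes> (inv h \<otimes> h) \<otimes> s) \<otimes> inv h"
    using h S_carrier by (simp add: t m_assoc)
  then show ?thesis using h S_carrier S_square by simp
qed

lemma reflection_inv: "t \<in> reflections \<Longrightarrow> inv t = t"
  using reflection_square reflections_closed inv_equality by blast

lemma inversions_one [simp]: "inversions \<one> = {}"
  using crossing_parity(1) by (simp add: inversions_def)

lemma inversions_step:
  "g \<in> carrier W \<Longrightarrow> s \<in> S \<Longrightarrow> \<tau> \<in> carrier W \<Longrightarrow>
    \<tau> \<in> inversions (g \<otimes> s) \<longleftrightarrow> (\<tau> \<in> inversions g) \<noteq> (wall g s = \<tau>)"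
  by (simp add: inversions_def crossing_parity(2))

lemma inversions_closed: "\<tau> \<in> inversions g \<Longrightarrow> \<tau> \<in> carrier W"
  by (simp add: inversions_def)

lemma inversions_reflections:
  assumes "g \<in> carrier W" "\<tau> \<in> inversions g"
  shows "\<tau> \<in> reflections"
  using assms
proof (induction rule: carrier_induct)
  case (step g s)
  then show ?case
    using inversions_step[of g s \<tau>] inversions_closed reflectionsI by blast
qed simp

text \<open>A gallery to \<open>g\<close>, continued by the \<open>g\<close>-translate of a gallery
  to \<open>h\<close>: the second part crosses the wall of \<tau> as the gallery to \<open>h\<close>
  crosses that of \<open>inv g \<otimes> \<tau> \<otimes> g\<close>.\<close>

lemma inversions_mult:
  assumes "h \<in> carrier W" "g \<in> carrier W" "\<tau> \<in> carrier W"
  shows "\<tau> \<in> inversions (g \<otimes> h) \<longleftrightarrow> (\<tau> \<in> inversions g) \<noteq> (inv g \<otimes> \<tau> \<otimes> g \<in> inversions h)"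
  using assms(1)
proof (induction rule: carrier_induct)
  case (step h s)
  have "\<tau> \<in> inversions (g \<otimes> (h \<otimes> s)) \<longleftrightarrow> (\<tau> \<in> inversions (g \<otimes> h)) \<noteq> (wall (g \<otimes> h) s = \<tau>)"
    using inversions_step[of "g \<otimes> h" s \<tau>] step.hyps assms S_carrier by (simp add: m_assoc)
  moreover have "inv g \<otimes> \<tau> \<otimes> g \<in> inversions (h \<otimes> s)
      \<longleftrightarrow> (inv g \<otimes> \<tau> \<otimes> g \<in> inversions h) \<noteq> (wall h s = inv g \<otimes> \<tau> \<otimes> g)"
    using step.hyps assms by (intro inversions_step) auto
  ultimately show ?case using step wall_conj[of g h s \<tau>] assms by blast
qed (simp add: assms)

lemma inversions_inv:
  assumes "g \<in> carrier W" "\<tau> \<in> carrier W"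
  shows "\<tau> \<in> inversions (inv g) \<longleftrightarrow> g \<otimes> \<tau> \<otimes> inv g \<in> inversions g"
  using inversions_mult[of g "inv g" \<tau>] assms by simp

lemma inversions_S:
  assumes "s \<in> S"
  shows "inversions s = {s}"
proof -
  have "\<tau> \<in> inversions s \<longleftrightarrow> \<tau> = s" if "\<tau> \<in> carrier W" for \<tau>
    using inversions_step[of \<one> s \<tau>] assms that S_carrier by auto
  then show ?thesis using inversions_closed S_carrier assms by blast
qed

text \<open>For \<open>t = wall g s\<close>, the crossings along \<open>g\<close> and along
  \<open>inv g\<close> cancel by \<open>inversions_inv\<close>, which leaves the single middle step
  \<open>s\<close>.\<close>

lemma reflection_self_inversion:
  assumes "t \<in> reflections"
  shows "t \<in> inversions t"
proof -
  obtain g s where g: "g \<in> carrier W" and s: "s \<in> S" and t: "t = wall g s"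
    using assms by (auto simp: reflections_def)
  have c: "s \<in> carrier W" "t \<in> carrier W" using s S_carrier g t by auto
  have "t = g \<otimes> (s \<otimes> inv g)" using g c by (simp add: t m_assoc)
  then have "t \<in> inversions t \<longleftrightarrow> (t \<in> inversions g) \<noteq> (inv g \<otimes> t \<otimes> g \<in> inversions (s \<otimes> inv g))"
    using inversions_mult[of "s \<otimes> inv g" g t] g c by simp
  also have "inv g \<otimes> t \<otimes> g = s" using g c by (simp add: t m_assoc inv_solve_left')
  also have "s \<in> inversions (s \<otimes> inv g) \<longleftrightarrow> (s \<in> inversions s) \<noteq> (inv s \<otimes> s \<otimes> s \<in> inversions (inv g))"
    using g c by (intro inversions_mult) auto
  also have "inv s \<otimes> s \<otimes> s = s" using c by simp
  also have "s \<in> inversions (inv g) \<longleftrightarrow> t \<in> inversions g"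
    using inversions_inv[OF g c(1)] t by simp
  finally show ?thesis using inversions_S[OF s] by auto
qed

lemma inversions_reflection_mult:
  assumes "t \<in> reflections" "g \<in> carrier W"
  shows "t \<in> inversions (t \<otimes> g) \<longleftrightarrow> t \<notin> inversions g"
proof -
  have "inv t \<otimes> t \<otimes> t = t" using assms reflections_closed by simp
  then show ?thesis
    using inversions_mult[of g t t] reflection_self_inversion[OF assms(1)] assms reflections_closed
    by simp
qed

section \<open>The exchange condition\<close>

definition word_wall :: "'a list \<Rightarrow> nat \<Rightarrow> 'a" where
  "word_wall ws i = wall (ev (take i ws)) (ws ! i)"

lemma take_lists: "ws \<in> lists S \<Longrightarrow> take i ws \<in> lists S"
  and drop_lists: "ws \<in> lists S \<Longrightarrow> drop i ws \<in> lists S"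
  and nth_S: "ws \<in> lists S \<Longrightarrow> i < length ws \<Longrightarrow> ws ! i \<in> S"
  by (auto simp: in_lists_conv_set dest: in_set_takeD in_set_dropD)

lemma word_wall_reflection: "ws \<in> lists S \<Longrightarrow> i < length ws \<Longrightarrow> word_wall ws i \<in> reflections"
  unfolding word_wall_def by (intro reflectionsI) (auto simp: take_lists nth_S)

lemma ev_take_Suc:
  "ws \<in> lists S \<Longrightarrow> i < length ws \<Longrightarrow> ev (take (Suc i) ws) = ev (take i ws) \<otimes> ws ! i"
  using take_lists[of ws i] nth_S[of ws i] S_carrier by (simp add: take_Suc_conv_app_nth)

lemma inversions_take_Suc:
  assumes "ws \<in> lists S" "i < length ws" "\<tau> \<in> carrier W"
  shows "\<tau> \<in> inversions (ev (take (Suc i) ws)) \<longleftrightarrow> (\<tau> \<in> inversions (ev (take i ws))) \<noteq> (word_wall ws i = \<tau>)"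
  unfolding ev_take_Suc[OF assms(1,2)] word_wall_def
  using assms by (intro inversions_step) (auto simp: take_lists nth_S)

lemma inversions_take_subset:
  assumes "ws \<in> lists S" "k \<le> length ws" "\<tau> \<in> inversions (ev (take k ws))"
  shows "\<exists>i<k. \<tau> = word_wall ws i"
  using assms(2,3)
proof (induction k)
  case (Suc k)
  then show ?case
    using inversions_take_Suc[OF assms(1), of k \<tau>] inversions_closed[of \<tau>]
    by (metis Suc_leD less_Suc_eq Suc_le_eq)
qed simp

abbreviation (input) delete_nth :: "nat \<Rightarrow> 'a list \<Rightarrow> 'a list" where
  "delete_nth i ws \<equiv> take i ws @ drop (Suc i) ws"

lemma delete_nth_lists: "ws \<in> lists S \<Longrightarrow> delete_nth i ws \<in> lists S"
  using take_lists drop_lists by simp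

text \<open>Folding: reflecting the part of the gallery behind its wall number \<open>i\<close>
  amounts to omitting letter \<open>i\<close>.\<close>

lemma word_wall_mult:
  assumes "ws \<in> lists S" "i < length ws"
  shows "word_wall ws i \<otimes> ev ws = ev (delete_nth i ws)"
proof -
  let ?u = "ev (take i ws)" and ?v = "ev (drop (Suc i) ws)" and ?s = "ws ! i"
  have c: "?u \<in> carrier W" "?v \<in> carrier W" "?s \<in> S" "?s \<in> carrier W"
    using assms take_lists drop_lists nth_S S_carrier by auto
  have d: "drop i ws \<in> lists S" using assms drop_lists by blast
  have "ev ws = ev (take i ws @ drop i ws)" by simp
  also have "\<dots> = ?u \<otimes> ev (drop i ws)"
    using ev_append[OF take_lists[OF assms(1)] d] .
  also have "ev (drop i ws) = ?s \<otimes> ?v"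
    using assms by (simp add: Cons_nth_drop_Suc[symmetric])
  finally have ev: "ev ws = ?u \<otimes> (?s \<otimes> ?v)" .
  have "word_wall ws i \<otimes> ev ws = ?u \<otimes> (?s \<otimes> (inv ?u \<otimes> ?u) \<otimes> ?s) \<otimes> ?v"
    unfolding ev word_wall_def using c by (simp add: m_assoc)
  also have "\<dots> = ?u \<otimes> ?v" using c S_square by simp
  finally show ?thesis using take_lists[OF assms(1)] drop_lists[OF assms(1)] by simp
qed

abbreviation len :: "'a \<Rightarrow> nat" where
  "len \<equiv> word_length W S"

lemma len_ev_le: "ws \<in> lists S \<Longrightarrow> len (ev ws) \<le> length ws"
proof -
  assume ws: "ws \<in> lists S"
  let ?u = "map (\<lambda>s. (s, True)) ws"
  have "?u \<in> lists (S \<times> UNIV)" using ws by auto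
  moreover have "word_eval W ?u = ev ws"
    unfolding word_eval_conv_ev[OF calculation] by (simp add: comp_def)
  ultimately show ?thesis
    unfolding word_length_def by (intro Least_le bexI[of _ ?u]) simp_all
qed

lemma reduced_word:
  assumes "g \<in> carrier W"
  obtains ws where "ws \<in> lists S" "ev ws = g" "length ws = len g"
proof -
  obtain vs where vs: "vs \<in> lists S" "ev vs = g" using assms by (rule carrier_imp_word)
  let ?P = "\<lambda>n. \<exists>u\<in>lists (S \<times> UNIV). length u = n \<and> word_eval W u = g"
  let ?v = "map (\<lambda>s. (s, True)) vs"
  have v: "?v \<in> lists (S \<times> UNIV)" using vs by auto
  have "?P (length ?v)"
    using v word_eval_conv_ev[OF v] vs by (intro bexI[of _ ?v]) (simp_all add: comp_def)
  then have "?P (len g)" unfolding word_length_def by (rule LeastI)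
  then obtain u where u: "u \<in> lists (S \<times> UNIV)" "length u = len g" "word_eval W u = g" by blast
  show ?thesis
  proof (rule that[of "map fst u"])
    show "map fst u \<in> lists S" using u(1) by (induction u) auto
    show "ev (map fst u) = g" using u word_eval_conv_ev by simp
  qed (simp add: u)
qed

text \<open>Strong exchange: an inversion of \<open>g\<close> is a wall of any reduced word for
  \<open>g\<close>, and the letter crossing it can be deleted.\<close>

lemma len_inversion_less:
  assumes "g \<in> carrier W" "t \<in> inversions g"
  shows "len (t \<otimes> g) < len g"
proof -
  obtain ws where ws: "ws \<in> lists S" "ev ws = g" "length ws = len g"
    using assms(1) by (rule reduced_word)
  then obtain i where i: "i < length ws" "t = word_wall ws i"
    using inversions_take_subset[of ws "length ws" t] assms(2) by auto
  have "t \<otimes> g = ev (delete_nth i ws)"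
    using word_wall_mult[OF ws(1) i(1)] ws i by simp
  then have "len (t \<otimes> g) \<le> length (delete_nth i ws)"
    using len_ev_le[OF delete_nth_lists[OF ws(1)]] by simp
  also have "\<dots> < len g" using i(1) ws(3) by simp
  finally show ?thesis .
qed

lemma inversion_iff_len:
  assumes "g \<in> carrier W" "t \<in> reflections"
  shows "t \<in> inversions g \<longleftrightarrow> len (t \<otimes> g) < len g"
proof (cases "t \<in> inversions g")
  case False
  have t: "t \<in> carrier W" using assms reflections_closed by blast
  have "t \<in> inversions (t \<otimes> g)" using False inversions_reflection_mult assms by blast
  then have "len (t \<otimes> (t \<otimes> g)) < len (t \<otimes> g)"
    using assms t by (intro len_inversion_less) auto
  also have "t \<otimes> (t \<otimes> g) = g"
    using assms t reflection_square by (simp add: m_assoc[symmetric])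
  finally show ?thesis using False by simp
qed (use len_inversion_less assms in blast)

text \<open>Folding twice at a wall that is crossed twice removes two letters without changing the
  element.\<close>

lemma reduced_word_wall_distinct:
  assumes ws: "ws \<in> lists S" "length ws = len (ev ws)" and ij: "i < j" "j < length ws"
  shows "word_wall ws i \<noteq> word_wall ws j"
proof
  assume eq: "word_wall ws i = word_wall ws j"
  let ?us = "delete_nth j ws"
  have us: "?us \<in> lists S" using ws delete_nth_lists by blast
  have "word_wall ?us i = word_wall ws i"
    using ij by (simp add: word_wall_def nth_append)
  then have "word_wall ws i \<otimes> (word_wall ws j \<otimes> ev ws) = ev (delete_nth i ?us)"
    using word_wall_mult[OF ws(1) ij(2)] word_wall_mult[OF us, of i] ij by simp
  moreover have r: "word_wall ws j \<in> reflections" using word_wall_reflection ws ij by blast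
  then have "word_wall ws i \<otimes> (word_wall ws j \<otimes> ev ws) = ev ws"
    using eq reflection_square reflections_closed ws by (simp add: m_assoc[symmetric])
  ultimately have "len (ev ws) \<le> length (delete_nth i ?us)"
    using len_ev_le[OF delete_nth_lists[OF us, of i]] by simp
  then show False using ij ws by simp
qed

lemma reduced_word_inversions:
  assumes ws: "ws \<in> lists S" "length ws = len (ev ws)" and "i < length ws" "k \<le> length ws"
  shows "word_wall ws i \<in> inversions (ev (take k ws)) \<longleftrightarrow> i < k"
  using assms(4)
proof (induction k)
  case (Suc k)
  have "word_wall ws i \<in> carrier W" using word_wall_reflection reflections_closed ws assms(3) by blast
  then have "word_wall ws i \<in> inversions (ev (take (Suc k) ws))
      \<longleftrightarrow> (word_wall ws i \<in> inversions (ev (take k ws))) \<noteq> (word_wall ws k = word_wall ws i)"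
    using Suc.prems ws by (intro inversions_take_Suc) auto
  also have "word_wall ws k = word_wall ws i \<longleftrightarrow> k = i"
    using reduced_word_wall_distinct[OF ws, of i k] reduced_word_wall_distinct[OF ws, of k i]
      assms(3) Suc.prems by (metis Suc_le_lessD linorder_neqE_nat)
  finally show ?case using Suc by auto
qed simp

text \<open>A reduced word crosses each wall at most once.\<close>

lemma halfspace_connected:
  assumes g: "g \<in> carrier W" and h: "h \<in> carrier W" and t: "t \<in> carrier W"
    and side: "t \<in> inversions g \<longleftrightarrow> t \<in> inversions h"
    and step: "\<And>x s. x \<in> carrier W \<Longrightarrow> s \<in> S \<Longrightarrow> (t \<in> inversions x \<longleftrightarrow> t \<in> inversions g) \<Longrightarrow>
      (t \<in> inversions (x \<otimes> s) \<longleftrightarrow> t \<in> inversions g) \<Longrightarrow> F (x \<otimes> s) = F x"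
  shows "F h = F g"
proof -
  have "inv g \<otimes> h \<in> carrier W" using g h by simp
  then obtain ws where ws: "ws \<in> lists S" "ev ws = inv g \<otimes> h" "length ws = len (ev ws)"
    by (metis reduced_word)
  let ?t = "inv g \<otimes> t \<otimes> g"
  have gh: "g \<otimes> ev ws = h" unfolding ws(2) using g h by (simp add: m_assoc[symmetric])
  have tk: "t \<in> inversions (g \<otimes> ev (take k ws)) \<longleftrightarrow> (t \<in> inversions g) \<noteq> (?t \<in> inversions (ev (take k ws)))" for k
    using g t take_lists[OF ws(1)] by (intro inversions_mult) auto
  have "?t \<notin> inversions (ev ws)"
    using tk[of "length ws"] side gh by auto
  then have no: "?t \<notin> inversions (ev (take k ws))" if "k \<le> length ws" for k
    using inversions_take_subset[OF ws(1) that, of ?t]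
      reduced_word_inversions[OF ws(1,3), of _ "length ws"] that
    by auto
  have "F (g \<otimes> ev (take k ws)) = F g" if "k \<le> length ws" for k
    using that
  proof (induction k)
    case (Suc k)
    have c: "ev (take k ws) \<in> carrier W" "ws ! k \<in> S"
      using ws take_lists nth_S Suc.prems by auto
    have eq: "g \<otimes> ev (take (Suc k) ws) = (g \<otimes> ev (take k ws)) \<otimes> ws ! k"
      using ev_take_Suc[OF ws(1), of k] Suc.prems c g S_carrier by (simp add: m_assoc)
    have "F (g \<otimes> ev (take k ws) \<otimes> ws ! k) = F (g \<otimes> ev (take k ws))"
      using no[of k] no[of "Suc k"] tk[of k] tk[of "Suc k"] Suc.prems c g
      by (intro step) (auto simp: eq)
    then show ?case using Suc eq by simp
  qed (simp add: g)
  from this[of "length ws"] show ?thesis by (simp add: gh)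
qed

end


section \<open>Crossing walls\<close>

text \<open>Three diameters of a cycle of \<open>2 * n\<close> points. The half-cycle on side
  \<open>w\<close> of the third is cut by the other two into only three pieces, which cannot show
  all four sign pairs.\<close>

lemma alternating_intervals_three:
  fixes a b c n :: nat
  assumes "a < n" "b < n" "c < n" "a \<noteq> b" "a \<noteq> c" "b \<noteq> c"
    and all: "\<And>u v. \<exists>j<2 * n. (a < j \<and> j \<le> a + n) = u \<and> (b < j \<and> j \<le> b + n) = v \<and> (c < j \<and> j \<le> c + n) = w"
  shows False
proof -
  have *: False
    if lt: "a < b" "b < n" "c < n" "a \<noteq> c" "b \<noteq> c"
      and all: "\<And>u v. \<exists>j<2 * n. (a < j \<and> j \<le> a + n) = u \<and> (b < j \<and> j \<le> b + n) = v \<and> (c < j \<and> j \<le> c + n) = w"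
    for a b
  proof -
    from lt consider "c < a" | "a < c" "c < b" | "b < c" by linarith
    then show False
    proof cases
      case 1
      show False
        using 1 lt all[of False True] all[of True False] by (cases w) auto
    next
      case 2
      show False
        using 2 lt all[of False False] all[of True True] by (cases w) auto
    next
      case 3
      show False
        using 3 lt all[of True False] all[of False True] by (cases w) auto
    qed
  qed
  show False
  proof (cases "a < b")
    case True
    then show False using *[of a b] assms by blast
  next
    case False
    have "\<exists>j<2 * n. (b < j \<and> j \<le> b + n) = u \<and> (a < j \<and> j \<le> a + n) = v \<and> (c < j \<and> j \<le> c + n) = w" for u v
      using all[of v u] by blast
    with False show False using *[of b a] assms(1-6) by force
  qed
qed

context coxeter
begin

definition cross :: "'a \<Rightarrow> 'a \<Rightarrow> bool" where
  "cross t u \<longleftrightarrow> (\<forall>a b. \<exists>g\<in>carrier W. (t \<in> inversions g) = a \<and> (u \<in> inversions g) = b)"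

lemma crossI:
  assumes "g1 \<in> carrier W" "t \<in> inversions g1" "u \<in> inversions g1"
    "g2 \<in> carrier W" "t \<in> inversions g2" "u \<notin> inversions g2"
    "g3 \<in> carrier W" "t \<notin> inversions g3" "u \<in> inversions g3"
  shows "cross t u"
  unfolding cross_def
proof (intro allI)
  fix a b
  show "\<exists>g\<in>carrier W. (t \<in> inversions g) = a \<and> (u \<in> inversions g) = b"
    using assms by (cases a; cases b) (auto intro: bexI[of _ \<one>])
qed

lemma gallery_inversions_step:
  assumes "g \<in> carrier W" "s \<in> S" "t \<in> S" "\<tau> \<in> carrier W"
  shows "\<tau> \<in> inversions (gallery g s t (Suc i))
    \<longleftrightarrow> (\<tau> \<in> inversions (gallery g s t i)) \<noteq> (rank2_refl g s t i = \<tau>)"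
  using inversions_step[of "gallery g s t i" "if even i then s else t" \<tau>]
    gallery_closed[of g s t i] gallery_wall[of g s t i] assms by (simp del: alt_orbit.simps(2)) auto

text \<open>If no relator loop meets both walls, the crossings of the first wall on the positive side of the
  second form a coboundary. On a tour through the four quadrants its potential would change exactly once.\<close>

lemma cross_rank2:
  assumes r: "r \<in> reflections" "r' \<in> reflections" "r \<noteq> r'" and cross: "cross r r'"
  obtains g s t k i j where "g \<in> carrier W" "s \<in> S" "t \<in> S" "m s t = enat k"
    "r = rank2_refl g s t i" "r' = rank2_refl g s t j"
proof (rule ccontr)
  assume none: "\<not> thesis"
  note witness = that
  have rc: "r \<in> carrier W" "r' \<in> carrier W" using r reflections_closed by auto
  obtain P where "\<not> P \<one>" and P: "\<And>g s. g \<in> carrier W \<Longrightarrow> s \<in> S \<Longrightarrow>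
      P (g \<otimes> s) = (P g \<noteq> (wall g s = r \<and> r' \<notin> inversions g))"
  proof (rule edge_potential[of "\<lambda>g s. wall g s = r \<and> r' \<notin> inversions g"])
    fix g s assume g: "g \<in> carrier W" "s \<in> S"
    show "(wall (g \<otimes> s) s = r \<and> r' \<notin> inversions (g \<otimes> s)) = (wall g s = r \<and> r' \<notin> inversions g)"
      using inversions_step[OF g rc(2)] wall_step[OF g] r(3) by auto
  next
    fix g s t k assume g: "g \<in> carrier W" and st: "s \<in> S" "t \<in> S" "m s t = enat k"
    show "even (card {i. i < 2 * k \<and> wall (gallery g s t i) (if even i then s else t) = r
        \<and> r' \<notin> inversions (gallery g s t i)})"
      unfolding gallery_wall[OF g st(1,2)]
    proof (cases "\<exists>i. rank2_refl g s t i = r")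
      case True
      then have "rank2_refl g s t j \<noteq> r'" for j
        using none witness[OF g st] True by metis
      then have "r' \<in> inversions (gallery g s t i) \<longleftrightarrow> r' \<in> inversions g" for i
        by (induction i) (simp_all add: gallery_inversions_step[OF g st(1,2) rc(2)] del: alt_orbit.simps(2))
      moreover have "even (card {i. i < 2 * k \<and> rank2_refl g s t i = r \<and> r' \<notin> inversions g})"
        using rank2_refl_periodic[OF g st(1,2) relation[OF st]] by (intro even_card_periodic) simp
      ultimately show "even (card {i. i < 2 * k \<and> rank2_refl g s t i = r
        \<and> r' \<notin> inversions (gallery g s t i)})" by simp
    qed simp
  qed auto
  have quadrant: "\<exists>g\<in>carrier W. (r \<in> inversions g) = a \<and> (r' \<in> inversions g) = b" for a b
    using cross by (simp add: cross_def)
  obtain A where A: "A \<in> carrier W" "r \<notin> inversions A" "r' \<notin> inversions A" using quadrant[of False False] by auto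
  obtain B where B: "B \<in> carrier W" "r \<in> inversions B" "r' \<notin> inversions B" using quadrant[of True False] by auto
  obtain C where C: "C \<in> carrier W" "r \<in> inversions C" "r' \<in> inversions C" using quadrant[of True True] by auto
  obtain D where D: "D \<in> carrier W" "r \<notin> inversions D" "r' \<in> inversions D" using quadrant[of False True] by auto
  \<comment> \<open>From \<open>A\<close> to \<open>B\<close>, on the positive side of
    \<open>r'\<close>, \<open>P\<close> toggles exactly when \<open>r\<close> is crossed. On the
    other three legs of the tour it is constant, so it fails to return to its initial value.\<close>
  have "(P B \<noteq> (r \<in> inversions B)) = (P A \<noteq> (r \<in> inversions A))"
  proof (rule halfspace_connected[OF A(1) B(1) rc(2)])
    fix x s assume x: "x \<in> carrier W" "s \<in> S" and "r' \<in> inversions x \<longleftrightarrow> r' \<in> inversions A"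
    then show "(P (x \<otimes> s) \<noteq> (r \<in> inversions (x \<otimes> s))) = (P x \<noteq> (r \<in> inversions x))"
      using P[OF x] inversions_step[OF x rc(1)] A(3) by auto
  qed (use A B in simp)
  moreover have "P C = P B"
  proof (rule halfspace_connected[OF B(1) C(1) rc(1)])
    fix x s assume x: "x \<in> carrier W" "s \<in> S" and "r \<in> inversions x \<longleftrightarrow> r \<in> inversions B"
      "r \<in> inversions (x \<otimes> s) \<longleftrightarrow> r \<in> inversions B"
    then show "P (x \<otimes> s) = P x" using P[OF x] inversions_step[OF x rc(1)] by auto
  qed (use B C in simp)
  moreover have "P D = P C"
  proof (rule halfspace_connected[OF C(1) D(1) rc(2)])
    fix x s assume x: "x \<in> carrier W" "s \<in> S" and "r' \<in> inversions x \<longleftrightarrow> r' \<in> inversions C"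
    then show "P (x \<otimes> s) = P x" using P[OF x] C by auto
  qed (use C D in simp)
  moreover have "P A = P D"
  proof (rule halfspace_connected[OF D(1) A(1) rc(1)])
    fix x s assume x: "x \<in> carrier W" "s \<in> S" and "r \<in> inversions x \<longleftrightarrow> r \<in> inversions D"
      "r \<in> inversions (x \<otimes> s) \<longleftrightarrow> r \<in> inversions D"
    then show "P (x \<otimes> s) = P x" using P[OF x] inversions_step[OF x rc(1)] by auto
  qed (use D A in simp)
  ultimately show False using A B by auto
qed

section \<open>Finite rank 2 residues\<close>

lemma pow_flip_mult:
  fixes i j n :: nat
  assumes st: "s \<in> S" "t \<in> S" and n: "(s \<otimes> t) [^] n = \<one>" "0 < n"
  shows "(s \<otimes> t) [^] i \<otimes> s \<otimes> (s \<otimes> t) [^] j = (s \<otimes> t) [^] (i + (n - 1) * j) \<otimes> s"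
proof -
  let ?x = "s \<otimes> t"
  have c: "s \<in> carrier W" "?x \<in> carrier W" using st S_carrier by auto
  \<comment> \<open>The exponent \<open>(n - 1) * j\<close> stands for \<open>- j\<close> modulo
    \<open>n\<close> and keeps all powers natural.\<close>
  have "(n - 1) * j + j = n * j" using n(2) by (cases n) simp_all
  then have "?x [^] ((n - 1) * j) \<otimes> ?x [^] j = ?x [^] (n * j)"
    using c by (simp only: nat_pow_mult)
  also have "\<dots> = (?x [^] n) [^] j" using c by (simp only: nat_pow_pow)
  finally have "?x [^] ((n - 1) * j) \<otimes> ?x [^] j = \<one>" using n(1) by simp
  then have inv: "inv (?x [^] j) = ?x [^] ((n - 1) * j)"
    using c by (intro inv_equality) auto
  have "s \<otimes> ?x [^] j = inv (?x [^] j) \<otimes> s"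
  proof -
    have "(?x [^] j \<otimes> s) \<otimes> ?x [^] j = s"
      unfolding S_pow_flip[OF st] using c by (simp add: m_assoc)
    then have "inv (?x [^] j) \<otimes> (?x [^] j \<otimes> (s \<otimes> ?x [^] j)) = inv (?x [^] j) \<otimes> s"
      using c by (simp add: m_assoc)
    then show ?thesis using c by simp
  qed
  then show ?thesis using c by (simp add: inv m_assoc nat_pow_mult[symmetric])
qed

lemma rank2_refl_mult_gallery:
  assumes g: "g \<in> carrier W" and st: "s \<in> S" "t \<in> S" and n: "(s \<otimes> t) [^] n = \<one>" "0 < (n::nat)"
  shows "\<exists>l. rank2_refl g s t i \<otimes> gallery g s t j = gallery g s t l"
proof -
  let ?x = "s \<otimes> t"
  have c: "s \<in> carrier W" "t \<in> carrier W" using st S_carrier by auto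
  have *: "rank2_refl g s t i \<otimes> (g \<otimes> ?x [^] k) = g \<otimes> ?x [^] (i + (n - 1) * k) \<otimes> s" for k
  proof -
    have "rank2_refl g s t i \<otimes> (g \<otimes> ?x [^] k) = g \<otimes> (?x [^] i \<otimes> s \<otimes> ?x [^] k)"
      using g c by (simp add: rank2_refl_def m_assoc)
    also have "\<dots> = g \<otimes> (?x [^] (i + (n - 1) * k) \<otimes> s)" by (simp only: pow_flip_mult[OF st n])
    finally show ?thesis using g c by (simp add: m_assoc)
  qed
  show ?thesis
  proof (cases "even j")
    case True
    then obtain k where j: "j = 2 * k" by (auto elim: evenE)
    show ?thesis unfolding j gallery_even[OF g st] * gallery_odd[OF g st, symmetric] by blast
  next
    case False
    then obtain k where j: "j = 2 * k + 1" by (auto elim: oddE)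
    have "rank2_refl g s t i \<otimes> (g \<otimes> ?x [^] k \<otimes> s) = rank2_refl g s t i \<otimes> (g \<otimes> ?x [^] k) \<otimes> s"
      using g c st rank2_refl_closed[OF g st] by (simp add: m_assoc)
    also have "\<dots> = g \<otimes> ?x [^] (i + (n - 1) * k)"
      unfolding * using g c st by (simp add: m_assoc S_square)
    finally show ?thesis unfolding j gallery_odd[OF g st] gallery_even[OF g st, symmetric] by blast
  qed
qed

lemma rank2_refl_conj:
  assumes g: "g \<in> carrier W" and st: "s \<in> S" "t \<in> S" and n: "(s \<otimes> t) [^] n = \<one>" "0 < (n::nat)"
  shows "\<exists>l. rank2_refl g s t i \<otimes> rank2_refl g s t j \<otimes> rank2_refl g s t i = rank2_refl g s t l"
proof -
  let ?x = "s \<otimes> t"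
  have c: "s \<in> carrier W" "t \<in> carrier W" using st S_carrier by auto
  have "rank2_refl g s t i \<otimes> rank2_refl g s t j \<otimes> rank2_refl g s t i
      = g \<otimes> (?x [^] i \<otimes> s \<otimes> ?x [^] j \<otimes> (s \<otimes> ?x [^] i \<otimes> s)) \<otimes> inv g"
    using g c by (simp add: rank2_refl_def m_assoc)
  also have "?x [^] i \<otimes> s \<otimes> ?x [^] j \<otimes> (s \<otimes> ?x [^] i \<otimes> s) = ?x [^] (i + (n - 1) * j) \<otimes> s \<otimes> (s \<otimes> ?x [^] i \<otimes> s)"
    by (simp only: pow_flip_mult[OF st n])
  also have "\<dots> = ?x [^] (i + (n - 1) * j) \<otimes> (s \<otimes> s) \<otimes> ?x [^] i \<otimes> s"
    using c by (simp add: m_assoc)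
  also have "\<dots> = ?x [^] (i + (n - 1) * j + i) \<otimes> s"
    using c st by (simp add: S_square nat_pow_mult)
  finally show ?thesis unfolding rank2_refl_def by blast
qed

text \<open>The witness is the gate: a chamber of the residue nearest to \<open>y\<close>. If a wall
  of the residue separated it from \<open>y\<close>, the reflection in that wall would move it to a
  nearer chamber of the same residue.\<close>

lemma rank2_gate:
  assumes g: "g \<in> carrier W" and st: "s \<in> S" "t \<in> S" and n: "(s \<otimes> t) [^] n = \<one>" "0 < (n::nat)"
    and y: "y \<in> carrier W"
  shows "\<exists>j. \<forall>i. rank2_refl g s t i \<in> inversions y \<longleftrightarrow> rank2_refl g s t i \<in> inversions (gallery g s t j)"
proof -
  define d where "d j = len (inv (gallery g s t j) \<otimes> y)" for j
  obtain j where j: "\<And>l. d j \<le> d l"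
    using ex_has_least_nat[of "\<lambda>_. True" 0 d] by auto
  let ?z = "gallery g s t j"
  have z: "?z \<in> carrier W" using gallery_closed g st by blast
  have "rank2_refl g s t i \<in> inversions y \<longleftrightarrow> rank2_refl g s t i \<in> inversions ?z" for i
  proof (rule ccontr)
    let ?r = "rank2_refl g s t i"
    assume "\<not> (?r \<in> inversions y \<longleftrightarrow> ?r \<in> inversions ?z)"
    moreover have r: "?r \<in> carrier W" using rank2_refl_closed g st by blast
    moreover have "?z \<otimes> (inv ?z \<otimes> y) = y" using z y by simp
    ultimately have "inv ?z \<otimes> ?r \<otimes> ?z \<in> inversions (inv ?z \<otimes> y)"
      using inversions_mult[of "inv ?z \<otimes> y" ?z ?r] z y by auto
    then have "len (inv ?z \<otimes> ?r \<otimes> ?z \<otimes> (inv ?z \<otimes> y)) < d j"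
      unfolding d_def using z y by (intro len_inversion_less) auto
    moreover have "?r \<in> reflections"
      using gallery_wall[OF g st, of i] reflectionsI[OF gallery_closed[OF g st, of i]] st
      by (metis (full_types))
    then have "inv ?z \<otimes> ?r \<otimes> ?z \<otimes> (inv ?z \<otimes> y) = inv (?r \<otimes> ?z) \<otimes> y"
      using z y r by (simp add: m_assoc inv_mult_group reflection_inv)
    moreover obtain l where "?r \<otimes> ?z = gallery g s t l"
      using rank2_refl_mult_gallery[OF g st n] by blast
    ultimately have "d l < d j" by (simp add: d_def)
    with j[of l] show False by simp
  qed
  then show ?thesis by blast
qed

lemma rank2_three_walls:
  assumes g: "g \<in> carrier W" and st: "s \<in> S" "t \<in> S" and k: "(s \<otimes> t) [^] k = \<one>" "0 < (k::nat)"
    and t: "t1 = rank2_refl g s t i1" "t2 = rank2_refl g s t i2" "t3 = rank2_refl g s t i3"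
    and distinct: "t1 \<noteq> t2" "t1 \<noteq> t3" "t2 \<noteq> t3"
    and all: "\<And>a b. \<exists>y\<in>carrier W. (t1 \<in> inversions y) = a \<and> (t2 \<in> inversions y) = b \<and> (t3 \<in> inversions y) = w"
  shows False
proof -
  let ?x = "s \<otimes> t" and ?r = "rank2_refl g s t" and ?c = "gallery g s t"
  have x: "?x \<in> carrier W" using st S_carrier by simp
  \<comment> \<open>The first \<open>n\<close> walls are distinct only for the exact order of
    \<open>s \<otimes> t\<close>; about \<open>k\<close> only the relation is known.\<close>
  define n where "n = (LEAST n. ?x [^] n = \<one> \<and> 0 < (n::nat))"
  have n: "?x [^] n = \<one>" "0 < n"
    unfolding n_def using LeastI[of "\<lambda>n. ?x [^] n = \<one> \<and> 0 < (n::nat)" k] k by auto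
  have n_min: "?x [^] i \<noteq> \<one>" if "0 < i" "i < n" for i :: nat
    using not_less_Least[of i "\<lambda>n. ?x [^] n = \<one> \<and> 0 < (n::nat)"] that unfolding n_def by auto
  have pow_inj: "?x [^] i \<noteq> ?x [^] j" if "i < j" "j < n" for i j :: nat
  proof
    assume eq: "?x [^] i = ?x [^] j"
    have "?x [^] i \<otimes> ?x [^] (j - i) = ?x [^] j"
      using that x by (simp add: nat_pow_mult)
    then have "?x [^] (j - i) = \<one>" using x eq l_cancel_one[of "?x [^] i" "?x [^] (j - i)"] by simp
    moreover have "0 < j - i" "j - i < n" using that by linarith+
    ultimately show False using n_min by blast
  qed
  have r_inj: "?r i = ?r j \<longleftrightarrow> i = j" if "i < n" "j < n" for i j
  proof
    assume "?r i = ?r j"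
    then have "?x [^] i = ?x [^] j"
      using g x st S_carrier by (simp add: rank2_refl_def)
    then show "i = j" using pow_inj[of i j] pow_inj[of j i] that by (metis linorder_neqE_nat)
  qed simp
  have r_add: "?r (i + n) = ?r i" for i by (rule rank2_refl_periodic[OF g st n(1)])
  have r_mod: "?r (i mod n) = ?r i" for i
  proof -
    have "?r (i + n * l) = ?r i" for i l
      by (induction l) (simp_all add: r_add add.assoc[symmetric] add.commute[of n])
    from this[of "i mod n" "i div n"] show ?thesis by simp
  qed
  have x_mod: "?x [^] (i mod n) = ?x [^] i" for i :: nat
  proof -
    have "?x [^] (i mod n + n * (i div n)) = ?x [^] (i mod n) \<otimes> (?x [^] n) [^] (i div n)"
      using x by (simp only: nat_pow_mult nat_pow_pow nat_pow_closed)
    then show ?thesis using x n(1) by simp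
  qed
  have c_mod: "\<exists>j'<2 * n. ?c j' = ?c j" for j
  proof (cases "even j")
    case True
    then obtain l where "j = 2 * l" by (auto elim: evenE)
    then have "?c (2 * (l mod n)) = ?c j"
      by (simp only: gallery_even[OF g st] x_mod)
    then show ?thesis using n(2) by (intro exI[of _ "2 * (l mod n)"]) auto
  next
    case False
    then obtain l where "j = 2 * l + 1" by (auto elim: oddE)
    then have "?c (2 * (l mod n) + 1) = ?c j"
      by (simp only: gallery_odd[OF g st] x_mod)
    moreover have "2 * (l mod n) + 1 < 2 * n" using mod_less_divisor[OF n(2), of l] by linarith
    ultimately show ?thesis by blast
  qed
  \<comment> \<open>Wall \<open>a\<close> is crossed by the steps \<open>a\<close> and
    \<open>a + n\<close> of the loop, so it separates \<open>g\<close> from exactly the chambers in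
    between.\<close>
  have sign: "?r a \<in> inversions (?c j) \<longleftrightarrow> (?r a \<in> inversions g) \<noteq> (a < j \<and> j \<le> a + n)"
    if "a < n" "j \<le> 2 * n" for a j
    using that(2)
  proof (induction j)
    case (Suc j)
    have "?r j = ?r a \<longleftrightarrow> j = a \<or> j = a + n"
    proof (cases "j < n")
      case True
      then show ?thesis using r_inj[OF True that(1)] by auto
    next
      case False
      then have "?r j = ?r (j - n)" using r_add[of "j - n"] by simp
      moreover have "j - n < n" using Suc.prems False by linarith
      ultimately show ?thesis using r_inj[of "j - n" a] that(1) False by auto
    qed
    then show ?case
      using Suc gallery_inversions_step[OF g st rank2_refl_closed[OF g st], of a j] that(1)
      by (auto simp del: alt_orbit.simps(2))
  qed simp
  let ?a = "i1 mod n" and ?b = "i2 mod n" and ?d = "i3 mod n"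
  let ?B = "\<lambda>a j. a < j \<and> j \<le> a + n"
  show False
  proof (rule alternating_intervals_three[of ?a n ?b ?d])
    fix u v
    let ?u = "(t1 \<in> inversions g) \<noteq> u" and ?v = "(t2 \<in> inversions g) \<noteq> v"
    from all[of ?u ?v] obtain y where y: "y \<in> carrier W" "(t1 \<in> inversions y) = ?u"
      "(t2 \<in> inversions y) = ?v" "(t3 \<in> inversions y) = w" by (elim bexE conjE)
    obtain j0 where j0: "\<And>i. ?r i \<in> inversions y \<longleftrightarrow> ?r i \<in> inversions (?c j0)"
      using rank2_gate[OF g st n y(1)] by blast
    obtain j where j: "j < 2 * n" "?c j = ?c j0" using c_mod by blast
    have "?r i \<in> inversions y \<longleftrightarrow> (?r i \<in> inversions g) \<noteq> ?B (i mod n) j" for i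
      using j0[of i] sign[of "i mod n" j] j n(2) by (simp add: r_mod)
    from this[of i1] this[of i2] this[of i3] y j(1)
    show "\<exists>j<2 * n. ?B ?a j = u \<and> ?B ?b j = v \<and> ?B ?d j = ((t3 \<in> inversions g) \<noteq> w)"
      unfolding t by (intro exI[of _ j]) auto
  qed (use n(2) distinct t r_mod in \<open>auto, metis+\<close>)
qed

text \<open>At a chamber \<open>x\<close> adjacent to the wall of \<open>r\<close>, if reflecting in \<open>p\<close> does not lead across that wall,
  then the two walls meet at an acute angle around \<open>x\<close>, hence also in the opposite sector.\<close>

lemma acute_angle:
  assumes p: "p \<in> reflections" and r: "r \<in> reflections" and cross: "cross p r"
    and x: "x \<in> carrier W" "s \<in> S" "wall x s = r" "p \<in> inversions x" "r \<notin> inversions x"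
      "r \<notin> inversions (p \<otimes> x)" "r \<notin> inversions (p \<otimes> (x \<otimes> s))"
    and y: "y \<in> carrier W" "r \<in> inversions y" "p \<notin> inversions y"
  shows "r \<in> inversions (p \<otimes> y)"
proof (rule ccontr)
  assume py: "r \<notin> inversions (p \<otimes> y)"
  have pc: "p \<in> carrier W" "r \<in> carrier W" using p r reflections_closed by auto
  have pr: "p \<noteq> r" using x by auto
  obtain g s' t' k i j where res: "g \<in> carrier W" "s' \<in> S" "t' \<in> S" "m s' t' = enat k"
    "p = rank2_refl g s' t' i" "r = rank2_refl g s' t' j"
    using cross_rank2[OF p r pr cross] by blast
  have k: "(s' \<otimes> t') [^] k = \<one>" "0 < k" using relation m_pos res by auto
  \<comment> \<open>The mirror image of the wall of \<open>r\<close> under \<open>p\<close>. The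
    chambers \<open>x\<close>, \<open>x \<otimes> s\<close>, \<open>p \<otimes> x\<close> and
    \<open>y\<close> realise all four sign pairs for \<open>p\<close> and \<open>r\<close>; with
    \<open>py\<close> all four lie on one side of \<open>?q\<close>, which three walls of one
    residue do not permit.\<close>
  let ?q = "p \<otimes> r \<otimes> p"
  obtain l where l: "?q = rank2_refl g s' t' l"
    using rank2_refl_conj[OF res(1-3) k] res by blast
  have q: "r \<in> inversions (p \<otimes> z) \<longleftrightarrow> (r \<in> inversions p) \<noteq> (?q \<in> inversions z)" if "z \<in> carrier W" for z
    using inversions_mult[OF that pc] reflection_inv[OF p] by simp
  have xs: "x \<otimes> s \<in> carrier W" using x S_carrier by simp
  have step: "\<tau> \<in> inversions (x \<otimes> s) \<longleftrightarrow> (\<tau> \<in> inversions x) \<noteq> (r = \<tau>)" if "\<tau> \<in> carrier W" for \<tau>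
    using inversions_step[OF x(1,2) that] x(3) by simp
  have ppx: "p \<otimes> (p \<otimes> x) = x"
    using pc x reflection_square[OF p] by (simp add: m_assoc[symmetric])
  show False
  proof (rule rank2_three_walls[OF res(1-3) k res(5,6) l pr])
    show "p \<noteq> ?q"
    proof
      assume "p = ?q"
      then have "\<one> \<otimes> p = (p \<otimes> r) \<otimes> p" using pc by simp
      then have "\<one> = p \<otimes> r" using pc right_cancel[of p \<one> "p \<otimes> r"] by simp
      then have "p \<otimes> p = p \<otimes> r" using reflection_square[OF p] by simp
      with pr pc show False by simp
    qed
    show "r \<noteq> ?q"
    proof
      assume "r = ?q"
      moreover have "?q \<in> inversions x \<longleftrightarrow> ?q \<in> inversions (x \<otimes> s)"
        using q[OF x(1)] q[OF xs] x by blast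
      ultimately show False using step[OF pc(2)] by auto
    qed
    fix a b
    have 1: "p \<in> inversions (x \<otimes> s)" "r \<in> inversions (x \<otimes> s)"
      using step[OF pc(1)] step[OF pc(2)] x pr by auto
    have 2: "p \<notin> inversions (p \<otimes> x)"
      using inversions_reflection_mult[OF p x(1)] x by simp
    have "?q \<in> inversions x \<longleftrightarrow> r \<in> inversions p" "?q \<in> inversions (x \<otimes> s) \<longleftrightarrow> r \<in> inversions p"
      "?q \<in> inversions (p \<otimes> x) \<longleftrightarrow> r \<in> inversions p" "?q \<in> inversions y \<longleftrightarrow> r \<in> inversions p"
      using q[OF x(1)] q[OF xs] q[of "p \<otimes> x"] q[OF y(1)] x py ppx pc by auto
    then show "\<exists>y\<in>carrier W. (p \<in> inversions y) = a \<and> (r \<in> inversions y) = b \<and>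
        (?q \<in> inversions y) = (r \<in> inversions p)"
      using 1 2 x y xs pc by (cases a; cases b) (blast intro: m_closed)+
  qed
qed

end


section \<open>Small reflections\<close>

context coxeter
begin

lemma len_mult_le:
  assumes "g \<in> carrier W" "h \<in> carrier W"
  shows "len (g \<otimes> h) \<le> len g + len h"
proof -
  obtain us vs where "us \<in> lists S" "ev us = g" "length us = len g"
    "vs \<in> lists S" "ev vs = h" "length vs = len h"
    using assms reduced_word by metis
  then show ?thesis using len_ev_le[of "us @ vs"] by simp
qed

lemma len_S_le: "s \<in> S \<Longrightarrow> len s \<le> 1"
  using len_ev_le[of "[s]"] S_carrier by simp

lemma len_word_wall_le:
  assumes "ws \<in> lists S" "i < length ws"
  shows "len (word_wall ws i) \<le> 2 * i + 1"
proof -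
  have l: "take i ws \<in> lists S" "ws ! i \<in> S" using assms take_lists nth_S by auto
  then have "word_wall ws i = ev (take i ws @ [ws ! i] @ rev (take i ws))"
    using S_carrier by (simp add: word_wall_def inv_ev m_assoc)
  also have "len \<dots> \<le> length (take i ws @ [ws ! i] @ rev (take i ws))"
    using l by (intro len_ev_le) simp
  also have "\<dots> = 2 * i + 1" using assms(2) by simp
  finally show ?thesis .
qed

definition dominates :: "'a \<Rightarrow> 'a \<Rightarrow> bool" where
  "dominates r r' \<longleftrightarrow> (\<forall>g\<in>carrier W. r \<in> inversions g \<longrightarrow> r' \<in> inversions g)"

text \<open>With reflections read as positive roots, \<open>dominates\<close> is the dominance
  order, and these are its minimal elements, the elementary roots.\<close>

definition small :: "'a set" where
  "small = {r \<in> reflections. \<forall>r'\<in>reflections. dominates r r' \<longrightarrow> r' = r}"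

text \<open>The identity lies in one quadrant and \<open>g1\<close>, \<open>g2\<close> in two
  others. As the walls do not cross, the fourth quadrant is empty, which is dominance.\<close>

lemma dominatesI_not_cross:
  assumes "\<not> cross r r'" "g1 \<in> carrier W" "r \<in> inversions g1" "r' \<in> inversions g1"
    "g2 \<in> carrier W" "r \<notin> inversions g2" "r' \<in> inversions g2"
  shows "dominates r r'"
  unfolding dominates_def
proof (intro ballI impI, rule ccontr)
  fix g assume "g \<in> carrier W" "r \<in> inversions g" "r' \<notin> inversions g"
  then have "cross r r'" using assms by (intro crossI[of g1 r r' g g2])
  with assms(1) show False by blast
qed

text \<open>Splits the last letter off a shortest element beyond the wall; what remains is too short
  to lie beyond, so that letter crosses the wall.\<close>

lemma obtain_minimal_crossing:
  assumes r: "r \<in> reflections"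
  obtains xs s where "xs \<in> lists S" "s \<in> S" "length xs = len (ev xs)" "wall (ev xs) s = r"
    "\<And>g. g \<in> carrier W \<Longrightarrow> len g \<le> length xs \<Longrightarrow> r \<notin> inversions g"
proof -
  let ?P = "\<lambda>w. w \<in> carrier W \<and> r \<in> inversions w"
  have "?P r" using r reflection_self_inversion reflections_closed by blast
  then obtain w where w: "?P w" and min: "\<And>g. ?P g \<Longrightarrow> len w \<le> len g"
    using ex_has_least_nat[of ?P r len] by blast
  obtain ws where ws: "ws \<in> lists S" "ev ws = w" "length ws = len w"
    using w reduced_word by blast
  have "ws \<noteq> []" using ws w by auto
  then obtain xs s where xs: "ws = xs @ [s]" by (metis rev_exhaust)
  have l: "xs \<in> lists S" "s \<in> S" using ws xs by auto
  have less: "r \<notin> inversions g" if "g \<in> carrier W" "len g \<le> length xs" for g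
    using min[of g] that ws xs by auto
  have eq: "w = ev xs \<otimes> s" using ws xs l S_carrier by auto
  have "len w \<le> len (ev xs) + len s" unfolding eq using l S_carrier by (intro len_mult_le) auto
  then have "length xs \<le> len (ev xs)" using len_S_le[OF l(2)] ws xs by simp
  then have red: "length xs = len (ev xs)" using len_ev_le[OF l(1)] by simp
  have "wall (ev xs) s = r"
    using inversions_step[of "ev xs" s r] l less[of "ev xs"] red w eq reflections_closed r by auto
  with l red less show ?thesis using that by blast
qed

text \<open>All that is kept of the modular representation: a congruence on \<open>W\<close> with
  finitely many classes that separates the powers of each \<open>s \<otimes> t\<close> with
  \<open>m s t\<close> finite.\<close>

context
  fixes col :: "'a \<Rightarrow> 'c"
  assumes col_finite: "finite (col ` carrier W)"
    and col_mult: "\<And>a b c d. a \<in> carrier W \<Longrightarrow> b \<in> carrier W \<Longrightarrow> c \<in> carrier W \<Longrightarrow> d \<in> carrier W \<Longrightarrow>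
      col a = col c \<Longrightarrow> col b = col d \<Longrightarrow> col (a \<otimes> b) = col (c \<otimes> d)"
    and col_exact: "\<And>s t k i j. s \<in> S \<Longrightarrow> t \<in> S \<Longrightarrow> m s t = enat k \<Longrightarrow>
      col ((s \<otimes> t) [^] (i::nat)) = col ((s \<otimes> t) [^] (j::nat)) \<Longrightarrow> (s \<otimes> t) [^] i = (s \<otimes> t) [^] j"
begin

lemma same_color_not_cross:
  assumes r: "r \<in> reflections" "r' \<in> reflections" "r \<noteq> r'" and col: "col r = col r'"
  shows "\<not> cross r r'"
proof
  assume "cross r r'"
  then obtain g s t k i j where g: "g \<in> carrier W" and st: "s \<in> S" "t \<in> S" "m s t = enat k"
    and ij: "r = rank2_refl g s t i" "r' = rank2_refl g s t j"
    using cross_rank2[OF r] by blast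
  have c: "s \<in> carrier W" "t \<in> carrier W" "r \<in> carrier W" "r' \<in> carrier W"
    using st r S_carrier reflections_closed by auto
  have pow: "(s \<otimes> t) [^] l = inv g \<otimes> rank2_refl g s t l \<otimes> (g \<otimes> s)" for l
    using g c st by (simp add: rank2_refl_def m_assoc S_square)
  have "col ((s \<otimes> t) [^] i) = col ((s \<otimes> t) [^] j)"
    unfolding pow ij[symmetric] using g c col by (intro col_mult) auto
  then have "(s \<otimes> t) [^] i = (s \<otimes> t) [^] j" by (rule col_exact[OF st])
  with ij r(3) show False by (simp add: rank2_refl_def)
qed

text \<open>Among the first walls on a long minimal gallery towards the wall of \<open>r\<close> there are two of the same
  colour, those of \<open>p\<close> and \<open>q\<close>. They do not cross, and neither does the wall of \<open>r\<close> meet its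
  translate under \<open>p \<otimes> q\<close>, since that has the same colour. If \<open>r\<close> is small, then its wall crosses
  those of \<open>p\<close> and \<open>q\<close> at acute angles, so that the translate separates it from the identity.\<close>

lemma small_depth:
  assumes r: "r \<in> small"
  shows "\<exists>w\<in>carrier W. r \<in> inversions w \<and> len w \<le> 4 * card (col ` carrier W) + 3"
proof (rule ccontr)
  let ?K = "card (col ` carrier W)"
  assume none: "\<not> ?thesis"
  have rr: "r \<in> reflections" and rc: "r \<in> carrier W" using r reflections_closed by (auto simp: small_def)
  obtain xs s where xs: "xs \<in> lists S" and s: "s \<in> S" and red: "length xs = len (ev xs)"
    and wall: "wall (ev xs) s = r"
    and near: "\<And>g. g \<in> carrier W \<Longrightarrow> len g \<le> length xs \<Longrightarrow> r \<notin> inversions g"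
    using obtain_minimal_crossing[OF rr] by blast
  define x where "x = ev xs"
  have x: "x \<in> carrier W" and xs_c: "x \<otimes> s \<in> carrier W" and sc: "s \<in> carrier W"
    using xs s S_carrier by (auto simp: x_def)
  have step: "\<tau> \<in> inversions (x \<otimes> s) \<longleftrightarrow> (\<tau> \<in> inversions x) \<noteq> (r = \<tau>)" if "\<tau> \<in> carrier W" for \<tau>
    using inversions_step[OF x s that] wall by (simp add: x_def)
  have rx: "r \<notin> inversions x" using near[OF x] red by (simp add: x_def)
  then have rxs: "r \<in> inversions (x \<otimes> s)" using step[OF rc] by simp
  have long: "4 * ?K + 3 \<le> length xs"
  proof -
    have "len (x \<otimes> s) \<le> length xs + 1"
      using len_mult_le[OF x sc] len_S_le[OF s] red by (simp add: x_def)
    with none xs_c rxs show ?thesis by force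
  qed
  let ?t = "word_wall xs"
  have "\<not> inj_on (\<lambda>i. col (?t i)) {..?K}"
  proof
    assume "inj_on (\<lambda>i. col (?t i)) {..?K}"
    moreover have "(\<lambda>i. col (?t i)) ` {..?K} \<subseteq> col ` carrier W"
      using word_wall_reflection[OF xs] reflections_closed long by fastforce
    ultimately have "card {..?K} \<le> ?K" using col_finite card_inj_on_le by blast
    then show False by simp
  qed
  then obtain i j where ij: "i < j" "j \<le> ?K" "col (?t i) = col (?t j)"
    unfolding inj_on_def by (metis atMost_iff linorder_neqE_nat)
  define p where "p = ?t i"
  define q where "q = ?t j"
  have ij_len: "i < length xs" "j < length xs" using ij long by auto
  have pr: "p \<in> reflections" and qr: "q \<in> reflections"
    using word_wall_reflection[OF xs] ij_len by (auto simp: p_def q_def)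
  have pc: "p \<in> carrier W" and qc: "q \<in> carrier W" using pr qr reflections_closed by auto
  have pp: "p \<otimes> p = \<one>" "q \<otimes> q = \<one>" "inv p = p" "inv q = q"
    using pr qr reflection_square reflection_inv by auto
  have col_pq: "col p = col q" using ij by (simp add: p_def q_def)
  have px: "p \<in> inversions x" and qx: "q \<in> inversions x"
    using reduced_word_inversions[OF xs red, of _ "length xs"] ij_len by (auto simp: p_def q_def x_def)
  have between: "ev (take j xs) \<in> carrier W" "p \<in> inversions (ev (take j xs))" "q \<notin> inversions (ev (take j xs))"
    using reduced_word_inversions[OF xs red, of _ j] ij_len ij take_lists[OF xs]
    by (auto simp: p_def q_def)
  have pq: "p \<noteq> q" using between by auto
  \<comment> \<open>Applying \<open>p\<close>, \<open>q\<close> or both to \<open>x\<close> deletes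
    letters of \<open>xs\<close>. The results, even extended by \<open>s\<close>, are too short to
    lie beyond the wall of \<open>r\<close>.\<close>
  have near_word: "r \<notin> inversions (ev ws)" "r \<notin> inversions (ev ws \<otimes> s)"
    if "ws \<in> lists S" "length ws < length xs" for ws
    using near[of "ev ws"] near[of "ev (ws @ [s])"] len_ev_le[of ws] len_ev_le[of "ws @ [s]"] that s sc
    by auto
  have del: "p \<otimes> x = ev (delete_nth i xs)" "q \<otimes> x = ev (delete_nth j xs)"
    using word_wall_mult[OF xs] ij_len by (auto simp: p_def q_def x_def)
  have p_del: "p = word_wall (delete_nth j xs) i"
    using ij ij_len by (simp add: p_def word_wall_def nth_append)
  have del_pq: "p \<otimes> (q \<otimes> x) = ev (delete_nth i (delete_nth j xs))"
    unfolding del(2) p_del using delete_nth_lists[OF xs] ij ij_len by (intro word_wall_mult) auto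
  have near_p: "r \<notin> inversions (p \<otimes> x)" "r \<notin> inversions (p \<otimes> (x \<otimes> s))"
    using near_word[OF delete_nth_lists[OF xs], of i] ij_len pc x sc
    by (auto simp: del(1)[symmetric] m_assoc)
  have near_q: "r \<notin> inversions (q \<otimes> x)" "r \<notin> inversions (q \<otimes> (x \<otimes> s))"
    using near_word[OF delete_nth_lists[OF xs], of j] ij_len qc x sc
    by (auto simp: del(2)[symmetric] m_assoc)
  have near_pq: "r \<notin> inversions (p \<otimes> (q \<otimes> x))" "r \<notin> inversions (p \<otimes> (q \<otimes> (x \<otimes> s)))"
  proof -
    have "length (delete_nth i (delete_nth j xs)) < length xs" using ij(1) ij_len by simp
    note * = near_word[OF delete_nth_lists[OF delete_nth_lists[OF xs]] this, folded del_pq]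
    from *(1) show "r \<notin> inversions (p \<otimes> (q \<otimes> x))" .
    from *(2) show "r \<notin> inversions (p \<otimes> (q \<otimes> (x \<otimes> s)))"
      using pc qc x sc by (simp add: m_assoc)
  qed
  \<comment> \<open>The source of the constant: \<open>p\<close> and \<open>q\<close> have lengths
    at most \<open>2 * i + 1\<close> and \<open>2 * j + 1\<close> with
    \<open>i < j \<le> ?K\<close>, so \<open>q \<otimes> p\<close> is no longer than
    \<open>xs\<close>.\<close>
  have near_qp: "r \<notin> inversions (q \<otimes> p)"
  proof (rule near)
    have "len p \<le> 2 * i + 1" "len q \<le> 2 * j + 1"
      unfolding p_def q_def using len_word_wall_le[OF xs] ij_len by blast+
    then show "len (q \<otimes> p) \<le> length xs"
      using len_mult_le[OF qc pc] ij(1,2) long by linarith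
  qed (use pc qc in simp)
  have q_p: "dominates q p"
  proof -
    have "\<not> cross q p" using same_color_not_cross qr pr pq col_pq by metis
    then show ?thesis using x px qx between by (intro dominatesI_not_cross[of q p x "ev (take j xs)"])
  qed
  have small: "\<not> dominates r t" if "t \<in> reflections" "t \<noteq> r" for t
    using r that by (auto simp: small_def)
  have "p \<noteq> r" "q \<noteq> r" using px qx rx by auto
  \<comment> \<open>Smallness enters here: some chamber lies beyond the wall of \<open>r\<close> but
    not beyond that of \<open>p\<close>, hence not beyond that of \<open>q\<close> either.\<close>
  then obtain y where y: "y \<in> carrier W" "r \<in> inversions y" "p \<notin> inversions y"
    using small[OF pr] by (auto simp: dominates_def)
  have qy: "q \<notin> inversions y" using q_p y by (auto simp: dominates_def)
  have xs_in: "p \<in> inversions (x \<otimes> s)" "q \<in> inversions (x \<otimes> s)"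
    using step[OF pc] step[OF qc] px qx \<open>p \<noteq> r\<close> \<open>q \<noteq> r\<close> by auto
  have cross: "cross p r" "cross q r"
    using crossI[of "x \<otimes> s" p r x y] crossI[of "x \<otimes> s" q r x y] xs_c xs_in rxs x px qx rx y qy by auto
  have wall_x: "wall x s = r" using wall by (simp add: x_def)
  have py_r: "r \<in> inversions (p \<otimes> y)"
    using acute_angle[OF pr rr cross(1) x s wall_x px rx near_p y] .
  have qy_r: "r \<in> inversions (q \<otimes> y)"
    using acute_angle[OF qr rr cross(2) x s wall_x qx rx near_q y(1,2) qy] .
  define a where "a = p \<otimes> q"
  have ac: "a \<in> carrier W" and inv_a: "inv a = q \<otimes> p"
    using pc qc pp by (auto simp: a_def inv_mult_group)
  have col_a: "col a = col \<one>" "col (inv a) = col \<one>"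
    using col_mult[OF pc qc pc pc HOL.refl col_pq[symmetric]]
      col_mult[OF qc pc qc qc HOL.refl col_pq] pp(1,2) unfolding inv_a by (simp_all add: a_def)
  define r1 where "r1 = a \<otimes> r \<otimes> inv a"
  define r2 where "r2 = inv a \<otimes> r \<otimes> a"
  have r12: "r1 \<in> reflections" "r2 \<in> reflections"
    using reflections_conj[OF rr ac] reflections_conj'[OF rr ac] by (simp_all add: r1_def r2_def)
  have r12c: "r1 \<in> carrier W" "r2 \<in> carrier W" using r12 reflections_closed by auto
  have col_r: "col r1 = col r" "col r2 = col r"
  proof -
    have "col (a \<otimes> r \<otimes> inv a) = col (\<one> \<otimes> r \<otimes> \<one>)"
      using ac rc by (intro col_mult col_a HOL.refl) simp_all
    moreover have "col (inv a \<otimes> r \<otimes> a) = col (\<one> \<otimes> r \<otimes> \<one>)"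
      using ac rc by (intro col_mult col_a HOL.refl) simp_all
    ultimately show "col r1 = col r" "col r2 = col r" using rc by (simp_all add: r1_def r2_def)
  qed
  have sep2: "r \<in> inversions (a \<otimes> g) \<longleftrightarrow> (r \<in> inversions a) \<noteq> (r2 \<in> inversions g)" if "g \<in> carrier W" for g
    using inversions_mult[OF that ac rc] by (simp add: r2_def)
  have sep1: "r \<in> inversions (inv a \<otimes> g) \<longleftrightarrow> (r \<in> inversions (inv a)) \<noteq> (r1 \<in> inversions g)" if "g \<in> carrier W" for g
    using inversions_mult[OF that inv_closed[OF ac] rc] ac by (simp add: r1_def)
  have ax: "r \<notin> inversions (a \<otimes> x)" "r \<notin> inversions (a \<otimes> (x \<otimes> s))"
    using near_pq pc qc x sc by (auto simp: a_def m_assoc)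
  have "r2 \<noteq> r" using sep2[OF x] sep2[OF xs_c] ax rx rxs by auto
  then have "\<not> cross r r2"
    using same_color_not_cross[OF rr r12(2) _ col_r(2)[symmetric]] by blast
  have aqy: "a \<otimes> (q \<otimes> y) = p \<otimes> y"
    using pc qc y(1) pp(2) by (simp add: a_def m_assoc) (simp add: m_assoc[symmetric])
  \<comment> \<open>The chambers \<open>q \<otimes> y\<close>, \<open>x \<otimes> s\<close> and
    \<open>x\<close> realise three of the four combinations of sides of \<open>h\<close> and
    \<open>a \<otimes> h\<close> for \<open>r\<close>. A \<open>g\<close> violating the claim would
    supply the fourth and make \<open>r\<close> and \<open>r2\<close> cross.\<close>
  have a_r: "r \<in> inversions g" if g: "g \<in> carrier W" "r \<in> inversions (a \<otimes> g)" for g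
  proof (rule ccontr)
    assume "r \<notin> inversions g"
    have "cross r r2"
      unfolding cross_def
    proof (intro allI)
      fix u v
      let ?v = "(r \<in> inversions a) \<noteq> v"
      have "\<exists>h\<in>carrier W. (r \<in> inversions h) = u \<and> (r \<in> inversions (a \<otimes> h)) = ?v"
      proof (cases u; cases ?v)
        assume "u" "?v"
        then show ?thesis using qy_r py_r aqy qc y(1) by (intro bexI[of _ "q \<otimes> y"]) auto
      next
        assume "u" "\<not> ?v"
        then show ?thesis using xs_c rxs ax by (intro bexI[of _ "x \<otimes> s"]) auto
      next
        assume "\<not> u" "?v"
        then show ?thesis using g \<open>r \<notin> inversions g\<close> by (intro bexI[of _ g]) auto
      next
        assume "\<not> u" "\<not> ?v"
        then show ?thesis using x rx ax by (intro bexI[of _ x]) auto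
      qed
      then show "\<exists>h\<in>carrier W. (r \<in> inversions h) = u \<and> (r2 \<in> inversions h) = v"
        using sep2 by auto
    qed
    with \<open>\<not> cross r r2\<close> show False ..
  qed
  have "r \<notin> inversions (inv a)" using near_qp by (simp add: inv_a)
  \<comment> \<open>\<open>inv a\<close> keeps \<open>x \<otimes> s\<close> beyond the wall of
    \<open>r\<close>. If it did not bring \<open>x\<close> there too, the step from \<open>x\<close>
    to \<open>x \<otimes> s\<close> would cross the wall of \<open>r1\<close>, forcing
    \<open>r1 = r\<close> and then \<open>r2 = r\<close>.\<close>
  moreover have "r \<in> inversions (inv a \<otimes> x)"
  proof (rule ccontr)
    assume "r \<notin> inversions (inv a \<otimes> x)"
    moreover have "r \<in> inversions (inv a \<otimes> (x \<otimes> s))"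
      using a_r[of "inv a \<otimes> (x \<otimes> s)"] ac xs_c rxs by simp
    ultimately have "(r1 \<in> inversions x) \<noteq> (r1 \<in> inversions (x \<otimes> s))"
      using sep1[OF x] sep1[OF xs_c] by blast
    then have "r1 = r" using step[OF r12c(1)] by blast
    have "r2 = inv a \<otimes> r1 \<otimes> a" using \<open>r1 = r\<close> by (simp add: r2_def)
    also have "\<dots> = r" using ac rc by (simp add: r1_def m_assoc)
    finally show False using \<open>r2 \<noteq> r\<close> by simp
  qed
  ultimately have r1x: "r1 \<in> inversions x" using sep1[OF x] by blast
  then have "r1 \<noteq> r" using rx by auto
  then have "\<not> cross r r1"
    using same_color_not_cross[OF rr r12(1) _ col_r(1)[symmetric]] by blast
  moreover have "r1 \<in> inversions (x \<otimes> s)" using step[OF r12c(1)] r1x \<open>r1 \<noteq> r\<close> by auto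
  ultimately have "dominates r r1"
    using x xs_c rx rxs r1x by (intro dominatesI_not_cross[of r r1 "x \<otimes> s" x])
  then show False using small[OF r12(1) \<open>r1 \<noteq> r\<close>] by blast
qed

lemma finite_small:
  assumes "finite S"
  shows "finite small"
proof -
  let ?n = "4 * card (col ` carrier W) + 3"
  let ?L = "{ws. set ws \<subseteq> S \<and> length ws \<le> ?n}"
  have "small \<subseteq> (\<Union>ws\<in>?L. word_wall ws ` {..<length ws})"
  proof
    fix r assume "r \<in> small"
    then obtain w where w: "w \<in> carrier W" "r \<in> inversions w" "len w \<le> ?n"
      using small_depth by blast
    obtain ws where ws: "ws \<in> lists S" "ev ws = w" "length ws = len w"
      using w(1) by (rule reduced_word)
    then obtain i where "i < length ws" "r = word_wall ws i"
      using inversions_take_subset[of ws "length ws" r] w by auto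
    with ws w show "r \<in> (\<Union>ws\<in>?L. word_wall ws ` {..<length ws})"
      by (intro UN_I[of ws]) auto
  qed
  moreover have "finite ?L" using finite_lists_length_le[OF assms] .
  then have "finite (\<Union>ws\<in>?L. word_wall ws ` {..<length ws})" by simp
  ultimately show ?thesis by (rule finite_subset)
qed

end

text \<open>Descending along dominance decreases the distance of a wall from the identity.\<close>

lemma dominates_small:
  assumes "r \<in> reflections"
  shows "\<exists>r'\<in>small. dominates r r'"
proof -
  define depth where "depth r = (LEAST n. \<exists>w\<in>carrier W. r \<in> inversions w \<and> len w = n)" for r
  have depth_le: "depth r \<le> len w" if "w \<in> carrier W" "r \<in> inversions w" for r w
    unfolding depth_def using that by (intro Least_le) auto
  show ?thesis
    using assms
  proof (induction "depth r" arbitrary: r rule: less_induct)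
    case less
    show ?case
    proof (cases "r \<in> small")
      case True
      then show ?thesis by (auto simp: dominates_def)
    next
      case False
      then obtain t where t: "t \<in> reflections" "dominates r t" "t \<noteq> r"
        using less.prems by (auto simp: small_def)
      obtain xs s where xs: "xs \<in> lists S" "s \<in> S" "length xs = len (ev xs)" "wall (ev xs) s = r"
        "\<And>g. g \<in> carrier W \<Longrightarrow> len g \<le> length xs \<Longrightarrow> r \<notin> inversions g"
        using obtain_minimal_crossing[OF less.prems] by blast
      have c: "ev xs \<in> carrier W" "r \<in> carrier W" "t \<in> carrier W"
        using xs less.prems t reflections_closed by auto
      have "r \<in> inversions (ev xs \<otimes> s)"
        using inversions_step[OF c(1) xs(2) c(2)] xs(3,4) xs(5)[OF c(1)] by simp
      then have "t \<in> inversions (ev xs \<otimes> s)"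
        using t(2) c(1) xs(2) S_carrier by (auto simp: dominates_def)
      then have "t \<in> inversions (ev xs)"
        using inversions_step[OF c(1) xs(2) c(3)] xs(4) t(3) by auto
      then have "depth t \<le> length xs" using depth_le[OF c(1)] xs(3) by simp
      also have "length xs < depth r"
      proof -
        have "\<exists>n. \<exists>w\<in>carrier W. r \<in> inversions w \<and> len w = n"
          using less.prems reflection_self_inversion c by blast
        from LeastI_ex[OF this] obtain w where "w \<in> carrier W" "r \<in> inversions w" "len w = depth r"
          unfolding depth_def by blast
        with xs(5)[of w] show ?thesis by force
      qed
      finally obtain r' where "r' \<in> small" "dominates t r'" using less.hyps t(1) by blast
      with t(2) show ?thesis by (auto simp: dominates_def)
    qed
  qed
qed

end


section \<open>The greedy normal form\<close>

context coxeter
begin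

section \<open>Colouring by the modular representation\<close>

lemma ev_concat_replicate:
  assumes "s \<in> S" "t \<in> S"
  shows "ev (concat (replicate i [s, t])) = (s \<otimes> t) [^] i"
proof (induction i)
  case (Suc i)
  have c: "s \<in> carrier W" "t \<in> carrier W" using assms S_carrier by auto
  then have "ev (concat (replicate (Suc i) [s, t])) = (s \<otimes> t) \<otimes> (s \<otimes> t) [^] i"
    using Suc by (simp add: m_assoc)
  also have "\<dots> = (s \<otimes> t) [^] Suc i" using c nat_pow_Suc2[of "s \<otimes> t" i] by simp
  finally show ?case .
qed simp

lemma finite_coloring:
  assumes fin: "finite S"
  obtains col :: "'a \<Rightarrow> ('a \<Rightarrow> int) \<Rightarrow> ('a \<Rightarrow> int)" where "finite (col ` carrier W)"
    and "\<And>a b c d. a \<in> carrier W \<Longrightarrow> b \<in> carrier W \<Longrightarrow> c \<in> carrier W \<Longrightarrow> d \<in> carrier W \<Longrightarrow>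
      col a = col c \<Longrightarrow> col b = col d \<Longrightarrow> col (a \<otimes> b) = col (c \<otimes> d)"
    and "\<And>s t k i j. s \<in> S \<Longrightarrow> t \<in> S \<Longrightarrow> m s t = enat k \<Longrightarrow>
      col ((s \<otimes> t) [^] (i::nat)) = col ((s \<otimes> t) [^] (j::nat)) \<Longrightarrow> (s \<otimes> t) [^] i = (s \<otimes> t) [^] j"
proof -
  define F where "F = {(s, t) \<in> S \<times> S. m s t \<noteq> \<infinity>}"
  \<comment> \<open>A common multiple of all finite orders: \<open>z ^ (M div k)\<close> then plays
    the root of unity for the pairs of order \<open>k\<close>, all with the same
    \<open>N\<close>.\<close>
  define M where "M = (\<Prod>(s, t)\<in>F. the_enat (m s t))"
  have F: "finite F" using fin by (auto simp: F_def intro: finite_subset[of _ "S \<times> S"])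
  have "0 < the_enat (m s t)" if "(s, t) \<in> F" for s t
    using that m_pos[of s t] by (cases "m s t") (auto simp: F_def)
  then have M_pos: "0 < M" unfolding M_def by (auto intro!: prod_pos)
  have k_dvd: "k dvd M" if "s \<in> S" "t \<in> S" "m s t = enat k" for s t k
    using dvd_prodI[OF F, of "(s, t)" "\<lambda>(s, t). the_enat (m s t)"] that by (simp add: F_def M_def)
  obtain z N :: int where N: "1 < N" and root: "[z ^ (2 * M) = 1] (mod N)"
    and unit: "\<And>j. 0 < j \<Longrightarrow> j < 2 * M \<Longrightarrow> coprime (z ^ j - 1) N"
  proof -
    have "0 < 2 * M" using M_pos by simp
    then show ?thesis using that by (rule strong_primitive_root_of_unity_mod)
  qed
  have root_mod: "root_of_unity_mod (z ^ (M div k)) N k"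
    if "s \<in> S" "t \<in> S" "m s t = enat k" "s \<noteq> t" for s t k
  proof -
    have "k \<noteq> 1" using m_eq_1_iff[of s t] that by (auto simp: one_enat_def)
    then have "2 \<le> k" using m_pos[OF that(1-3)] by linarith
    have Mk: "M div k * k = M" using k_dvd[OF that(1-3)] by simp
    have e: "0 < M div k" using Mk M_pos by (cases "M div k") auto
    show ?thesis
    proof
      have "(z ^ (M div k)) ^ (2 * k) = z ^ (2 * (M div k * k))"
        by (simp only: power_mult[symmetric]) (simp only: ac_simps)
      then show "[(z ^ (M div k)) ^ (2 * k) = 1] (mod N)" using root Mk by simp
      fix j assume j: "0 < j" "j < 2 * k"
      have "M div k * j < M div k * (2 * k)" using e j by simp
      also have "\<dots> = 2 * M" using Mk by simp
      finally show "coprime ((z ^ (M div k)) ^ j - 1) N"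
        unfolding power_mult[symmetric] using e j by (intro unit) simp_all
    qed fact+
  qed
  \<comment> \<open>A pair with \<open>m s t = \<infinity>\<close> has no relation to satisfy and no
    order to preserve; its entry 0 is a default.\<close>
  define c where "c s t = (if s = t then -2 else case m s t of enat k \<Rightarrow>
    z ^ (M div k) + root_of_unity_mod.z' (z ^ (M div k)) k | \<infinity> \<Rightarrow> 0)" for s t
  have c_diag: "c s s = -2" for s by (simp add: c_def)
  have c_eq: "c s t = z ^ (M div k) + root_of_unity_mod.z' (z ^ (M div k)) k"
    if "s \<noteq> t" "m s t = enat k" for s t k
    using that by (simp add: c_def)
  define act where "act = refl_mod S c N"
  define X where "X = vectors_mod S N"
  have closed: "act s f \<in> X" for s f
    by (simp add: act_def X_def refl_mod_closed N)
  have invol: "act s (act s f) = f" if "s \<in> S" "f \<in> X" for s f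
    using refl_mod_involution[where c = c, OF that(1) c_diag N] that(2) by (simp add: act_def X_def)
  have rel: "((act t \<circ> act s) ^^ k) f = f" if st: "s \<in> S" "t \<in> S" "m s t = enat k" and "f \<in> X" for s t k f
  proof (cases "s = t")
    case True
    then have "k = 1" using m_eq_1_iff[of s t] st by (simp add: one_enat_def)
    then show ?thesis using True st invol \<open>f \<in> X\<close> by simp
  next
    case False
    interpret root_of_unity_mod "z ^ (M div k)" N k by (rule root_mod[OF st False])
    show ?thesis
      unfolding act_def using \<open>f \<in> X\<close> False st m_commute[OF st(1,2)]
      by (intro relation_refl_mod) (auto simp: X_def c_diag intro!: c_eq)
  qed
  have fold_eq: "fold act us f = fold act ws f"
    if "us \<in> lists S" "ws \<in> lists S" "ev us = ev ws" "f \<in> X" for us ws f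
    using closed invol rel that by (intro fold_action_eq[where X = X]) blast+
  have fold_closed: "fold act ws f \<in> X" if "ws \<in> lists S" "f \<in> X" for ws f
    using fold_action_closed[where act = act and X = X] closed that by blast
  define word where "word g = (SOME ws. ws \<in> lists S \<and> ev ws = g)" for g
  have word: "word g \<in> lists S" "ev (word g) = g" if "g \<in> carrier W" for g
    using carrier_imp_word[OF that] someI_ex[of "\<lambda>ws. ws \<in> lists S \<and> ev ws = g"]
    unfolding word_def by blast+
  \<comment> \<open>Restricting to \<open>X\<close> turns equality of actions on \<open>X\<close>
    into equality of colours and confines the colours to a finite function space.\<close>
  define col where "col g = restrict (fold act (word g)) X" for g
  have col_ev: "col (ev ws) f = fold act ws f" if "ws \<in> lists S" "f \<in> X" for ws f
    unfolding col_def using that word[of "ev ws"] fold_eq[of "word (ev ws)" ws f] by simp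
  have col_mult: "col (a \<otimes> b) = restrict (\<lambda>f. col b (col a f)) X"
    if "a \<in> carrier W" "b \<in> carrier W" for a b
  proof
    fix f
    show "col (a \<otimes> b) f = restrict (\<lambda>f. col b (col a f)) X f"
    proof (cases "f \<in> X")
      case True
      then have "col (ev (word a @ word b)) f = fold act (word b) (fold act (word a) f)"
        using col_ev[of "word a @ word b" f] word that by simp
      moreover have "ev (word a @ word b) = a \<otimes> b" using word that by simp
      ultimately show ?thesis
        using True fold_closed[OF word(1)[OF that(1)] True] by (simp add: col_def)
    qed (simp add: col_def)
  qed
  show ?thesis
  proof (rule that[of col])
    have "col ` carrier W \<subseteq> X \<rightarrow>\<^sub>E X"
      using fold_closed word by (auto simp: col_def)
    moreover have "finite (X \<rightarrow>\<^sub>E X)"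
      using finite_vectors_mod[OF fin] by (intro finite_PiE) (auto simp: X_def)
    ultimately show "finite (col ` carrier W)" by (rule finite_subset)
  next
    fix a b c d assume "a \<in> carrier W" "b \<in> carrier W" "c \<in> carrier W" "d \<in> carrier W"
      "col a = col c" "col b = col d"
    then show "col (a \<otimes> b) = col (c \<otimes> d)" by (simp only: col_mult)
  next
    fix s t k i j
    assume st: "s \<in> S" "t \<in> S" "m s t = enat k"
      and eq: "col ((s \<otimes> t) [^] (i::nat)) = col ((s \<otimes> t) [^] (j::nat))"
    show "(s \<otimes> t) [^] i = (s \<otimes> t) [^] j"
    proof (cases "s = t")
      case True
      then show ?thesis using st S_square by simp
    next
      case False
      have pow: "col ((s \<otimes> t) [^] l) f = ((act t \<circ> act s) ^^ l) f" if "f \<in> X" for l :: nat and f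
      proof -
        have "concat (replicate l [s, t]) \<in> lists S" using st by (induction l) auto
        from col_ev[OF this that] show ?thesis
          unfolding ev_concat_replicate[OF st(1,2)] by (simp add: fold_concat_replicate)
      qed
      interpret root_of_unity_mod "z ^ (M div k)" N k by (rule root_mod[OF st False])
      obtain f where "f \<in> X" and f: "\<And>a b. ((act t \<circ> act s) ^^ a) f = ((act t \<circ> act s) ^^ b) f
          \<Longrightarrow> a mod k = b mod k"
        unfolding act_def X_def
        using relation_refl_mod_exact[of s S t c] st False m_commute[OF st(1,2)] c_diag c_eq
        by (metis (no_types, lifting))
      then have mod: "i mod k = j mod k" using pow[OF \<open>f \<in> X\<close>] eq by metis
      have pow_mod: "(s \<otimes> t) [^] l = (s \<otimes> t) [^] (l mod k)" for l :: nat
      proof -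
        have x: "s \<otimes> t \<in> carrier W" using st S_carrier by simp
        have "(s \<otimes> t) [^] (l mod k + k * (l div k)) = (s \<otimes> t) [^] (l mod k) \<otimes> ((s \<otimes> t) [^] k) [^] (l div k)"
          using x by (simp only: nat_pow_mult nat_pow_pow nat_pow_closed)
        then show ?thesis using x relation[OF st] by simp
      qed
      show ?thesis using pow_mod[of i] pow_mod[of j] mod by simp
    qed
  qed
qed

section \<open>Parabolic subgroups and longest elements\<close>

lemma parabolic_subgroup: "\<sigma> \<subseteq> S \<Longrightarrow> subgroup (generate W \<sigma>) W"
  using S_carrier by (intro generate_is_subgroup) auto

lemma parabolic_closed: "\<sigma> \<subseteq> S \<Longrightarrow> g \<in> generate W \<sigma> \<Longrightarrow> g \<in> carrier W"
  using subgroup.mem_carrier[OF parabolic_subgroup] by blast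

lemma parabolic_mult:
  "\<sigma> \<subseteq> S \<Longrightarrow> g \<in> generate W \<sigma> \<Longrightarrow> h \<in> generate W \<sigma> \<Longrightarrow> g \<otimes> h \<in> generate W \<sigma>"
  and parabolic_inv: "\<sigma> \<subseteq> S \<Longrightarrow> g \<in> generate W \<sigma> \<Longrightarrow> inv g \<in> generate W \<sigma>"
  using subgroup.m_closed[OF parabolic_subgroup] subgroup.m_inv_closed[OF parabolic_subgroup] by blast+

lemma parabolic_inversions:
  assumes \<sigma>: "\<sigma> \<subseteq> S" and g: "g \<in> generate W \<sigma>" and \<tau>: "\<tau> \<in> inversions g"
  shows "\<tau> \<in> generate W \<sigma>"
proof -
  obtain ws where ws: "ws \<in> lists \<sigma>" "ev ws = g" using g \<sigma> by (rule generate_imp_word)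
  have wsS: "ws \<in> lists S" using ws \<sigma> lists_mono by blast
  obtain i where i: "i < length ws" "\<tau> = word_wall ws i"
    using inversions_take_subset[OF wsS, of "length ws" \<tau>] ws \<tau> by auto
  have "take i ws \<in> lists \<sigma>" "ws ! i \<in> \<sigma>"
    using ws(1) i(1) by (auto simp: in_lists_conv_set dest: in_set_takeD)
  then show ?thesis
    unfolding i(2) word_wall_def
    by (intro parabolic_mult parabolic_inv \<sigma> ev_generate) (auto intro: generate.incl)
qed

text \<open>Exchange for a word that is shortest among the words over \<sigma>: if its first letter
  were not an inversion, that letter would cancel against a later one.\<close>

lemma parabolic_descent:
  assumes \<sigma>: "\<sigma> \<subseteq> S" and g: "g \<in> generate W \<sigma>" "g \<noteq> \<one>"
  shows "\<exists>s\<in>\<sigma>. s \<in> inversions g"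
proof -
  let ?P = "\<lambda>ws. ws \<in> lists \<sigma> \<and> ev ws = g"
  obtain vs where "?P vs" using g(1) \<sigma> generate_imp_word by blast
  then obtain ws where ws: "?P ws" and min: "\<And>us. ?P us \<Longrightarrow> length ws \<le> length us"
    using ex_has_least_nat[of ?P vs length] by blast
  obtain s us where sus: "ws = s # us" using ws g(2) by (cases ws) auto
  have s: "s \<in> \<sigma>" "s \<in> S" and us: "us \<in> lists \<sigma>" "us \<in> lists S"
    using ws sus \<sigma> by (auto simp: in_lists_conv_set)
  have gs: "g = s \<otimes> ev us" using ws sus by auto
  have "s \<in> inversions g"
  proof (rule ccontr)
    assume "s \<notin> inversions g"
    then have "s \<in> inversions (ev us)"
      using inversions_reflection_mult[OF S_reflection[OF s(2)], of "ev us"] us(2) gs by auto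
    then obtain i where i: "i < length us" "s = word_wall us i"
      using inversions_take_subset[OF us(2), of "length us" s] by auto
    have "?P (delete_nth i us)"
      using word_wall_mult[OF us(2) i(1)] i gs us(1) by (auto simp: in_lists_conv_set dest: in_set_takeD in_set_dropD)
    from min[OF this] i(1) sus show False by simp
  qed
  with s show ?thesis by blast
qed

lemma parabolic_Int_S:
  assumes "\<sigma> \<subseteq> S" "t \<in> S" "t \<in> generate W \<sigma>"
  shows "t \<in> \<sigma>"
proof -
  have "t \<noteq> \<one>" using inversions_S[OF assms(2)] by auto
  then show ?thesis using parabolic_descent[OF assms(1,3)] inversions_S[OF assms(2)] by auto
qed

text \<open>Take \<open>a\<close> with \<open>inv a \<otimes> v\<close> shortest; an inversion of it
  inside the parabolic subgroup could be absorbed into \<open>a\<close> and would shorten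
  it.\<close>

lemma parabolic_coset_minimal:
  assumes \<sigma>: "\<sigma> \<subseteq> S" and v: "v \<in> carrier W"
  obtains a b where "a \<in> generate W \<sigma>" "b \<in> carrier W" "v = a \<otimes> b"
    "\<And>\<tau>. \<tau> \<in> inversions b \<Longrightarrow> \<tau> \<notin> generate W \<sigma>"
proof -
  obtain a where a: "a \<in> generate W \<sigma>"
    and min: "\<And>a'. a' \<in> generate W \<sigma> \<Longrightarrow> len (inv a \<otimes> v) \<le> len (inv a' \<otimes> v)"
    using ex_has_least_nat[of "\<lambda>a. a \<in> generate W \<sigma>" \<one> "\<lambda>a. len (inv a \<otimes> v)"] generate.one by blast
  have ac: "a \<in> carrier W" using a \<sigma> parabolic_closed by blast
  show ?thesis
  proof (rule that[of a "inv a \<otimes> v"])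
    fix \<tau> assume \<tau>: "\<tau> \<in> inversions (inv a \<otimes> v)"
    show "\<tau> \<notin> generate W \<sigma>"
    proof
      assume \<tau>\<sigma>: "\<tau> \<in> generate W \<sigma>"
      have r: "\<tau> \<in> reflections" using inversions_reflections[OF _ \<tau>] ac v by simp
      then have c: "\<tau> \<in> carrier W" by (rule reflections_closed)
      have "len (\<tau> \<otimes> (inv a \<otimes> v)) < len (inv a \<otimes> v)"
        using \<tau> ac v by (intro len_inversion_less) auto
      also have "\<tau> \<otimes> (inv a \<otimes> v) = inv (a \<otimes> \<tau>) \<otimes> v"
        using ac c v r by (simp add: inv_mult_group reflection_inv m_assoc)
      finally show False using min[OF parabolic_mult[OF \<sigma> a \<tau>\<sigma>]] by simp
    qed
  qed (use a ac v in simp_all)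
qed

context
  fixes \<sigma> w
  assumes \<sigma>: "\<sigma> \<subseteq> S" and w: "w \<in> generate W \<sigma>"
    and longest: "\<And>v. v \<in> generate W \<sigma> \<Longrightarrow> len v \<le> len w"
begin

lemma longest_inversions: "inversions w = reflections \<inter> generate W \<sigma>"
proof
  show "inversions w \<subseteq> reflections \<inter> generate W \<sigma>"
    using inversions_reflections parabolic_closed[OF \<sigma> w] parabolic_inversions[OF \<sigma> w] by blast
  show "reflections \<inter> generate W \<sigma> \<subseteq> inversions w"
  proof
    fix t assume t: "t \<in> reflections \<inter> generate W \<sigma>"
    show "t \<in> inversions w"
    proof (rule ccontr)
      assume "t \<notin> inversions w"
      then have "t \<in> inversions (t \<otimes> w)"
        using inversions_reflection_mult t parabolic_closed[OF \<sigma> w] by blast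
      then have "len (t \<otimes> (t \<otimes> w)) < len (t \<otimes> w)"
        using t parabolic_closed[OF \<sigma> w] reflections_closed by (intro len_inversion_less) auto
      also have "t \<otimes> (t \<otimes> w) = w"
        using t parabolic_closed[OF \<sigma> w] reflections_closed reflection_square
        by (simp add: m_assoc[symmetric])
      finally show False using longest[OF parabolic_mult[OF \<sigma> _ w], of t] t by simp
    qed
  qed
qed

text \<open>A descent \<open>s\<close> in \<sigma> of \<open>a \<otimes> w\<close> cannot exist:
  \<open>s\<close> is inverted by \<open>a\<close>, its conjugate is inverted by \<open>w\<close>,
  and the two crossings cancel.\<close>

lemma descents_imp_inv_longest:
  assumes a: "a \<in> generate W \<sigma>" "\<sigma> \<subseteq> inversions a"
  shows "a \<otimes> w = \<one>"
proof (rule ccontr)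
  assume "a \<otimes> w \<noteq> \<one>"
  then obtain s where s: "s \<in> \<sigma>" "s \<in> inversions (a \<otimes> w)"
    using parabolic_descent[OF \<sigma> parabolic_mult[OF \<sigma> a(1) w]] by blast
  have ac: "a \<in> carrier W" "w \<in> carrier W" using a w \<sigma> parabolic_closed by auto
  have sS: "s \<in> S" "s \<in> reflections" using s \<sigma> S_reflection by auto
  have "inv a \<otimes> s \<otimes> a \<in> generate W \<sigma>"
    using s a by (intro parabolic_mult parabolic_inv \<sigma>) (auto intro: generate.incl)
  then have "inv a \<otimes> s \<otimes> a \<in> inversions w"
    unfolding longest_inversions using reflections_conj'[OF sS(2) ac(1)] by simp
  then show False
    using inversions_mult[OF ac(2,1) S_carrier[OF sS(1)]] s a(2) by blast
qed

lemma longest_inv: "inv w = w"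
proof -
  have "\<sigma> \<subseteq> inversions w"
    unfolding longest_inversions using S_reflection \<sigma> by (auto intro: generate.incl)
  then have "w \<otimes> w = \<one>" using descents_imp_inv_longest w by blast
  then show ?thesis using inv_equality parabolic_closed[OF \<sigma> w] by blast
qed

lemma descents_imp_longest:
  assumes a: "a \<in> generate W \<sigma>" "\<sigma> \<subseteq> inversions a"
  shows "a = w"
  using descents_imp_inv_longest[OF a] longest_inv inv_equality[of a w] parabolic_closed[OF \<sigma>] a w
  by simp

end

lemma longest_properties:
  assumes "\<sigma> \<in> nerve W S"
  defines "u \<equiv> longest W S \<sigma>"
  shows "u \<in> generate W \<sigma>" "inversions u = reflections \<inter> generate W \<sigma>" "inv u = u"
    "\<And>a. a \<in> generate W \<sigma> \<Longrightarrow> \<sigma> \<subseteq> inversions a \<Longrightarrow> a = u"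
proof -
  have \<sigma>: "\<sigma> \<subseteq> S" "finite (generate W \<sigma>)" using assms(1) by (auto simp: nerve_def)
  let ?P = "\<lambda>w. w \<in> generate W \<sigma> \<and> (\<forall>v\<in>generate W \<sigma>. len v \<le> len w)"
  have "generate W \<sigma> \<noteq> {}" using generate.one by blast
  with \<sigma>(2) have "Max (len ` generate W \<sigma>) \<in> len ` generate W \<sigma>" by (intro Max_in) auto
  then obtain w where "w \<in> generate W \<sigma>" "len w = Max (len ` generate W \<sigma>)" by auto
  then have w: "?P w" using \<sigma>(2) by simp
  have unique: "w' = w" if "?P w'" for w'
  proof (rule descents_imp_longest[OF \<sigma>(1), of w])
    show "\<sigma> \<subseteq> inversions w'"
      using longest_inversions[OF \<sigma>(1), of w'] that S_reflection \<sigma>(1) by (auto intro: generate.incl)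
  qed (use w that in auto)
  have "u = w" unfolding u_def longest_def using w unique by (intro the_equality) blast+
  with w show "u \<in> generate W \<sigma>" "inversions u = reflections \<inter> generate W \<sigma>" "inv u = u"
    "\<And>a. a \<in> generate W \<sigma> \<Longrightarrow> \<sigma> \<subseteq> inversions a \<Longrightarrow> a = u"
    using longest_inversions[OF \<sigma>(1), of w] longest_inv[OF \<sigma>(1), of w]
      descents_imp_longest[OF \<sigma>(1), of w] by auto
qed

section \<open>Descents and cone types\<close>

lemma left_descents_conv_inversions:
  "v \<in> carrier W \<Longrightarrow> left_descents W S v = S \<inter> inversions v"
  using inversion_iff_len S_reflection by (auto simp: left_descents_def)

text \<open>The inverses of the elements of the cone type of \<open>g\<close>.\<close>

definition cone :: "'a \<Rightarrow> 'a set" where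
  "cone g = {v \<in> carrier W. inversions v \<inter> inversions g = {}}"

text \<open>A common inversion of \<open>v\<close> and \<open>g\<close> dominates a small
  reflection, which is then a common inversion as well.\<close>

lemma cone_determined_by_small:
  assumes "g \<in> carrier W"
  shows "cone g = {v \<in> carrier W. inversions v \<inter> (inversions g \<inter> small) = {}}"
proof -
  have "inversions v \<inter> (inversions g \<inter> small) \<noteq> {}"
    if "v \<in> carrier W" "\<tau> \<in> inversions v" "\<tau> \<in> inversions g" for v \<tau>
  proof -
    have "\<tau> \<in> reflections" using inversions_reflections that by blast
    then obtain r where "r \<in> small" "dominates \<tau> r" using dominates_small by blast
    with that assms show ?thesis by (auto simp: dominates_def)
  qed
  then show ?thesis by (auto simp: cone_def)
qed

lemma finite_cones:
  assumes "finite S"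
  shows "finite (cone ` carrier W)"
proof -
  have "finite small"
    by (rule finite_coloring[OF assms]) (rule finite_small[OF _ _ _ assms])
  moreover have "cone ` carrier W \<subseteq> (\<lambda>Z. {v \<in> carrier W. inversions v \<inter> Z = {}}) ` Pow small"
    using cone_determined_by_small by blast
  ultimately show ?thesis by (rule finite_surj[OF finite_Pow_iff[THEN iffD2]])
qed

text \<open>Makes the greedy condition readable from the cone type: \<sigma> consists of descents
  when lengths add in \<open>u \<otimes> g\<close>, and \<open>t\<close> outside \<sigma> is no
  descent when they also add for \<open>u \<otimes> t\<close>.\<close>

lemma left_descents_longest_iff:
  assumes \<sigma>: "\<sigma> \<in> nerve W S" and g: "g \<in> carrier W"
  defines "u \<equiv> longest W S \<sigma>"
  shows "left_descents W S (u \<otimes> g) = \<sigma> \<longleftrightarrow> u \<in> cone g \<and> (\<forall>t\<in>S - \<sigma>. u \<otimes> t \<in> cone g)"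
proof -
  have \<sigma>S: "\<sigma> \<subseteq> S" using \<sigma> by (simp add: nerve_def)
  note u = longest_properties[OF \<sigma>, folded u_def]
  have uc: "u \<in> carrier W" using u(1) \<sigma>S parabolic_closed by blast
  have ug: "\<tau> \<in> inversions (u \<otimes> g) \<longleftrightarrow> (\<tau> \<in> inversions u) \<noteq> (u \<otimes> \<tau> \<otimes> u \<in> inversions g)"
    if "\<tau> \<in> carrier W" for \<tau>
    using inversions_mult[OF g uc that] u(3) by simp
  have conj_u: "u \<otimes> s \<otimes> u \<in> inversions u" if "s \<in> \<sigma>" for s
  proof -
    have "u \<otimes> s \<otimes> u \<in> generate W \<sigma>"
      using that u(1) by (intro parabolic_mult \<sigma>S) (auto intro: generate.incl)
    moreover have "u \<otimes> s \<otimes> u \<in> reflections"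
      using reflections_conj[of s u] S_reflection \<sigma>S that uc u(3) by auto
    ultimately show ?thesis by (simp add: u(2))
  qed
  have s_u: "s \<in> inversions u" if "s \<in> \<sigma>" for s
    using that \<sigma>S S_reflection by (auto simp: u(2) intro: generate.incl)
  have t_u: "t \<notin> inversions u" if "t \<in> S - \<sigma>" for t
    using that parabolic_Int_S[OF \<sigma>S] by (auto simp: u(2))
  have ut: "u \<otimes> t \<in> cone g \<longleftrightarrow> t \<notin> inversions (u \<otimes> g)" if t: "t \<in> S - \<sigma>" and ucone: "u \<in> cone g" for t
  proof -
    have tS: "t \<in> S" "t \<in> carrier W" using t S_carrier by auto
    have step: "\<tau> \<in> inversions (u \<otimes> t) \<longleftrightarrow> (\<tau> \<in> inversions u) \<noteq> (u \<otimes> t \<otimes> u = \<tau>)" if "\<tau> \<in> carrier W" for \<tau>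
      using inversions_step[OF uc tS(1) that] u(3) by simp
    have "u \<otimes> t \<otimes> u \<notin> inversions u"
    proof
      assume "u \<otimes> t \<otimes> u \<in> inversions u"
      then have *: "u \<otimes> t \<otimes> u \<in> generate W \<sigma>" by (simp add: u(2))
      have "u \<otimes> (u \<otimes> t \<otimes> u) \<otimes> u \<in> generate W \<sigma>"
        by (rule parabolic_mult[OF \<sigma>S parabolic_mult[OF \<sigma>S u(1) *] u(1)])
      moreover have "u \<otimes> (u \<otimes> t \<otimes> u) \<otimes> u = (u \<otimes> u) \<otimes> t \<otimes> (u \<otimes> u)"
        using uc tS by (simp add: m_assoc)
      moreover have "u \<otimes> u = \<one>" using r_inv[OF uc] u(3) by simp
      ultimately show False using t parabolic_Int_S[OF \<sigma>S] tS by auto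
    qed
    then have "\<tau> \<in> inversions (u \<otimes> t) \<longleftrightarrow> \<tau> \<in> inversions u \<or> \<tau> = u \<otimes> t \<otimes> u" if "\<tau> \<in> carrier W" for \<tau>
      using step[OF that] by auto
    then have "inversions (u \<otimes> t) = insert (u \<otimes> t \<otimes> u) (inversions u)"
      using inversions_closed uc tS by (intro Set.set_eqI) (metis insert_iff m_closed)
    then have "u \<otimes> t \<in> cone g \<longleftrightarrow> u \<otimes> t \<otimes> u \<notin> inversions g"
      using ucone uc tS by (auto simp: cone_def)
    then show ?thesis using ug[OF tS(2)] t_u[OF t] by simp
  qed
  show ?thesis
  proof
    assume D: "left_descents W S (u \<otimes> g) = \<sigma>"
    then have D': "S \<inter> inversions (u \<otimes> g) = \<sigma>" using left_descents_conv_inversions uc g by simp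
    \<comment> \<open>All of \<sigma> must already be inverted by the parabolic factor
      \<open>a\<close>, so \<open>a = u\<close>; hence \<open>g = b\<close>, and \<open>u\<close>
      and \<open>g\<close> have no common inversion.\<close>
    obtain a b where ab: "a \<in> generate W \<sigma>" "b \<in> carrier W" "u \<otimes> g = a \<otimes> b"
      and b: "\<And>\<tau>. \<tau> \<in> inversions b \<Longrightarrow> \<tau> \<notin> generate W \<sigma>"
      using parabolic_coset_minimal[OF \<sigma>S, of "u \<otimes> g"] uc g by auto
    have ac: "a \<in> carrier W" using ab \<sigma>S parabolic_closed by blast
    have "s \<in> inversions a" if s: "s \<in> \<sigma>" for s
    proof -
      have "inv a \<otimes> s \<otimes> a \<in> generate W \<sigma>"
        using s ab(1) by (intro parabolic_mult parabolic_inv \<sigma>S) (auto intro: generate.incl)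
      then have "inv a \<otimes> s \<otimes> a \<notin> inversions b" using b by blast
      moreover have "s \<in> inversions (a \<otimes> b)" using D' s ab(3) by auto
      ultimately show ?thesis using inversions_mult[OF ab(2) ac, of s] s \<sigma>S S_carrier by auto
    qed
    then have "a = u" using u(4)[OF ab(1)] by blast
    then have "inv u \<otimes> (u \<otimes> g) = inv u \<otimes> (u \<otimes> b)" using ab(3) by simp
    then have "b = g" using ab(2) uc g by simp
    then have ucone: "u \<in> cone g" using b uc by (auto simp: cone_def u(2))
    with D' ut show "u \<in> cone g \<and> (\<forall>t\<in>S - \<sigma>. u \<otimes> t \<in> cone g)" by blast
  next
    assume R: "u \<in> cone g \<and> (\<forall>t\<in>S - \<sigma>. u \<otimes> t \<in> cone g)"
    have "s \<in> inversions (u \<otimes> g)" if "s \<in> \<sigma>" for s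
      using ug[of s] s_u[OF that] conj_u[OF that] R that \<sigma>S S_carrier by (auto simp: cone_def)
    moreover have "t \<notin> inversions (u \<otimes> g)" if "t \<in> S - \<sigma>" for t
      using ut[OF that] R that by blast
    ultimately show "left_descents W S (u \<otimes> g) = \<sigma>"
      using left_descents_conv_inversions uc g \<sigma>S by auto
  qed
qed

text \<open>By \<open>cone\<close>, lengths add in \<open>u \<otimes> g\<close>: its inversions are
  those of \<open>u\<close> together with the translates of those of \<open>g\<close>. So the new
  cone is computed from \<open>u\<close> and the old one.\<close>

lemma cone_mult:
  assumes u: "u \<in> carrier W" and g: "g \<in> carrier W" and cone: "inv u \<in> cone g"
  shows "cone (u \<otimes> g) = {v \<in> carrier W. inversions v \<inter> inversions u = {} \<and> inv u \<otimes> v \<in> cone g}"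
proof -
  let ?c = "\<lambda>\<tau>. inv u \<otimes> \<tau> \<otimes> u"
  have c: "?c \<tau> \<in> inversions (inv u) \<longleftrightarrow> \<tau> \<in> inversions u" if "\<tau> \<in> carrier W" for \<tau>
    using inversions_inv[OF u, of "?c \<tau>"] u that by (simp add: m_assoc)
  have ug: "\<tau> \<in> inversions (u \<otimes> g) \<longleftrightarrow> \<tau> \<in> inversions u \<or> ?c \<tau> \<in> inversions g" if "\<tau> \<in> carrier W" for \<tau>
    using inversions_mult[OF g u that] c[OF that] cone by (auto simp: cone_def)
  have uv: "?c \<tau> \<in> inversions (inv u \<otimes> v) \<longleftrightarrow> (\<tau> \<in> inversions u) \<noteq> (\<tau> \<in> inversions v)"
    if "v \<in> carrier W" "\<tau> \<in> carrier W" for v \<tau>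
    using inversions_mult[OF that(1) inv_closed[OF u], of "?c \<tau>"] c[OF that(2)] u that by (simp add: m_assoc)
  have ex_conj: "\<exists>\<rho>\<in>carrier W. \<tau> = ?c \<rho>" if "\<tau> \<in> carrier W" for \<tau>
    using u that by (intro bexI[of _ "u \<otimes> \<tau> \<otimes> inv u"]) (simp_all add: m_assoc)
  have "v \<in> cone (u \<otimes> g) \<longleftrightarrow> inversions v \<inter> inversions u = {} \<and> inv u \<otimes> v \<in> cone g"
    if v: "v \<in> carrier W" for v
  proof -
    have "v \<in> cone (u \<otimes> g) \<longleftrightarrow> (\<forall>\<tau>\<in>carrier W. \<tau> \<in> inversions v \<longrightarrow> \<tau> \<notin> inversions u \<and> ?c \<tau> \<notin> inversions g)"
      using v ug inversions_closed by (auto simp: cone_def)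
    moreover have "inv u \<otimes> v \<in> cone g \<longleftrightarrow>
        (\<forall>\<tau>\<in>carrier W. ?c \<tau> \<in> inversions (inv u \<otimes> v) \<longrightarrow> ?c \<tau> \<notin> inversions g)"
      using v u ex_conj inversions_closed by (auto simp: cone_def)
    moreover have "?c \<tau> \<notin> inversions g" if "\<tau> \<in> inversions u" for \<tau>
      using c[of \<tau>] that cone inversions_closed by (auto simp: cone_def)
    ultimately show ?thesis using uv[OF v] inversions_closed by blast
  qed
  then show ?thesis by (auto simp: cone_def)
qed

text \<open>The continuations, to the left, of a greedy word with product \<open>g\<close>; this is
  the language accepted from the state of \<open>g\<close>.\<close>

definition greedy_from :: "'a \<Rightarrow> 'a set list set" where
  "greedy_from g = {\<alpha> \<in> lists (proper_nerve W S).
    \<forall>j < length \<alpha>. \<alpha> ! j = left_descents W S (longest_prod W S (drop j \<alpha>) \<otimes> g)}"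

lemma longest_closed: "\<sigma> \<in> proper_nerve W S \<Longrightarrow> longest W S \<sigma> \<in> carrier W"
  using longest_properties(1) parabolic_closed by (auto simp: proper_nerve_def nerve_def)

lemma longest_prod_closed: "\<alpha> \<in> lists (proper_nerve W S) \<Longrightarrow> longest_prod W S \<alpha> \<in> carrier W"
  by (induction \<alpha>) (auto simp: longest_prod_def longest_closed)

lemma longest_prod_snoc:
  assumes "\<alpha> \<in> lists (proper_nerve W S)" "\<sigma> \<in> proper_nerve W S" "g \<in> carrier W"
  shows "longest_prod W S (\<alpha> @ [\<sigma>]) \<otimes> g = longest_prod W S \<alpha> \<otimes> (longest W S \<sigma> \<otimes> g)"
  using assms(1)
proof (induction \<alpha>)
  case Nil
  then show ?case using assms longest_closed by (simp add: longest_prod_def)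
next
  case (Cons \<rho> \<alpha>)
  have "\<alpha> @ [\<sigma>] \<in> lists (proper_nerve W S)" using Cons.hyps assms by simp
  from longest_prod_closed[OF this] longest_prod_closed[OF Cons.hyps(2)] longest_closed[OF Cons.hyps(1)]
  show ?case using Cons.IH assms longest_closed[OF assms(2)] by (simp add: longest_prod_def m_assoc)
qed

lemma greedy_from_snoc:
  assumes g: "g \<in> carrier W" and \<sigma>: "\<sigma> \<in> proper_nerve W S"
  shows "\<alpha> @ [\<sigma>] \<in> greedy_from g \<longleftrightarrow>
    left_descents W S (longest W S \<sigma> \<otimes> g) = \<sigma> \<and> \<alpha> \<in> greedy_from (longest W S \<sigma> \<otimes> g)"
proof (cases "\<alpha> \<in> lists (proper_nerve W S)")
  case True
  have d: "drop j \<alpha> \<in> lists (proper_nerve W S)" for j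
    using True by (auto simp: in_lists_conv_set dest: in_set_dropD)
  have "\<alpha> @ [\<sigma>] \<in> greedy_from g \<longleftrightarrow> (\<forall>j\<le>length \<alpha>. (\<alpha> @ [\<sigma>]) ! j
      = left_descents W S (longest_prod W S (drop j (\<alpha> @ [\<sigma>])) \<otimes> g))"
    using True \<sigma> by (auto simp: greedy_from_def less_Suc_eq_le)
  also have "\<dots> \<longleftrightarrow> (\<forall>j\<le>length \<alpha>. (\<alpha> @ [\<sigma>]) ! j
      = left_descents W S (longest_prod W S (drop j \<alpha>) \<otimes> (longest W S \<sigma> \<otimes> g)))"
    using longest_prod_snoc[OF d \<sigma> g] by simp
  also have "\<dots> \<longleftrightarrow> left_descents W S (longest W S \<sigma> \<otimes> g) = \<sigma> \<and> (\<forall>j<length \<alpha>. \<alpha> ! j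
      = left_descents W S (longest_prod W S (drop j \<alpha>) \<otimes> (longest W S \<sigma> \<otimes> g)))"
    using longest_closed[OF \<sigma>] g
    by (auto simp: le_less nth_append longest_prod_def imp_conjR all_conj_distrib)
  finally show ?thesis using True by (simp add: greedy_from_def)
qed (auto simp: greedy_from_def)

text \<open>The Myhill-Nerode argument for cone types. The word is consumed from its end, by
  \<open>left_descents_longest_iff\<close> for admissibility and \<open>cone_mult\<close> for the
  next state.\<close>

lemma greedy_from_cong:
  assumes "g \<in> carrier W" "h \<in> carrier W" "cone g = cone h"
  shows "greedy_from g = greedy_from h"
proof -
  have "\<alpha> \<in> greedy_from g \<longleftrightarrow> \<alpha> \<in> greedy_from h" if "\<alpha> \<in> lists (proper_nerve W S)" for \<alpha>
    using that assms
  proof (induction \<alpha> arbitrary: g h rule: rev_induct)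
    case Nil
    then show ?case by (simp add: greedy_from_def)
  next
    case (snoc \<sigma> \<alpha>)
    then have \<sigma>: "\<sigma> \<in> proper_nerve W S" "\<sigma> \<in> nerve W S" and \<alpha>: "\<alpha> \<in> lists (proper_nerve W S)"
      by (auto simp: proper_nerve_def)
    let ?u = "longest W S \<sigma>"
    have u: "?u \<in> carrier W" "inv ?u = ?u"
      using longest_closed[OF \<sigma>(1)] longest_properties(3)[OF \<sigma>(2)] by auto
    have desc: "left_descents W S (?u \<otimes> g) = \<sigma> \<longleftrightarrow> left_descents W S (?u \<otimes> h) = \<sigma>"
      using left_descents_longest_iff[OF \<sigma>(2)] snoc.prems by simp
    have "cone (?u \<otimes> g) = cone (?u \<otimes> h)" if "?u \<in> cone g"
      using cone_mult[OF u(1) snoc.prems(2)] cone_mult[OF u(1) snoc.prems(3)] that snoc.prems(4) u(2) by simp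
    then have "\<alpha> \<in> greedy_from (?u \<otimes> g) \<longleftrightarrow> \<alpha> \<in> greedy_from (?u \<otimes> h)"
      if "left_descents W S (?u \<otimes> g) = \<sigma>"
      using snoc.IH[OF \<alpha>, of "?u \<otimes> g" "?u \<otimes> h"] that left_descents_longest_iff[OF \<sigma>(2) snoc.prems(2)]
        u(1) snoc.prems by simp
    then show ?case
      using greedy_from_snoc[OF snoc.prems(2) \<sigma>(1)] greedy_from_snoc[OF snoc.prems(3) \<sigma>(1)] desc by blast
  qed
  moreover have "greedy_from x \<subseteq> lists (proper_nerve W S)" for x
    unfolding greedy_from_def by (rule Collect_restrict)
  ultimately show ?thesis by blast
qed

lemma left_greedy_nf_conv_greedy_from: "left_greedy_nf W S = greedy_from \<one>"
proof -
  have *: "longest_prod W S (drop j \<alpha>) \<otimes> \<one> = longest_prod W S (drop j \<alpha>)"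
    if "\<alpha> \<in> lists (proper_nerve W S)" for j \<alpha>
    using that by (intro r_one longest_prod_closed) (auto simp: in_lists_conv_set dest: in_set_dropD)
  have "\<alpha> \<in> left_greedy_nf W S \<longleftrightarrow> \<alpha> \<in> greedy_from \<one>" for \<alpha>
  proof (cases "\<alpha> \<in> lists (proper_nerve W S)")
    case True
    then show ?thesis unfolding left_greedy_nf_def greedy_from_def by (simp add: *[OF True])
  qed (simp add: left_greedy_nf_def greedy_from_def)
  then show ?thesis by blast
qed

lemma rational_left_greedy_nf:
  assumes fin: "finite S"
  shows "char_series (left_greedy_nf W S) \<in> rational_series (proper_nerve W S)"
proof -
  \<comment> \<open>The transitions are computed on an arbitrary representative of each cone;
    \<open>lang_cone\<close> shows independence of the choice.\<close>
  define rep where "rep q = inv_into (carrier W) cone q" for q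
  have rep: "rep q \<in> carrier W" "cone (rep q) = q" if "q \<in> cone ` carrier W" for q
    using that by (simp_all add: rep_def inv_into_into f_inv_into_f)
  define lang where "lang q = greedy_from (rep q)" for q
  have lang_cone: "lang (cone g) = greedy_from g" if "g \<in> carrier W" for g
    unfolding lang_def using that rep[of "cone g"] by (intro greedy_from_cong) auto
  define \<delta> where "\<delta> q \<sigma> = cone (longest W S \<sigma> \<otimes> rep q)" for q \<sigma>
  define ok where "ok q \<sigma> \<longleftrightarrow> left_descents W S (longest W S \<sigma> \<otimes> rep q) = \<sigma>" for q \<sigma>
  have "char_series (lang (cone \<one>)) \<in> rational_series (proper_nerve W S)"
  proof (rule automaton_rational[OF finite_cones[OF fin]])
    show "finite (proper_nerve W S)"
      by (rule finite_subset[of _ "Pow S"]) (use fin in \<open>auto simp: proper_nerve_def nerve_def\<close>)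
    show "lang q \<subseteq> lists (proper_nerve W S)" for q
      by (auto simp: lang_def greedy_from_def)
    fix q \<sigma> assume q: "q \<in> cone ` carrier W" and \<sigma>: "\<sigma> \<in> proper_nerve W S"
    have c: "longest W S \<sigma> \<otimes> rep q \<in> carrier W" using rep(1)[OF q] longest_closed[OF \<sigma>] by simp
    then show "\<delta> q \<sigma> \<in> cone ` carrier W" by (simp add: \<delta>_def)
    show "\<alpha> @ [\<sigma>] \<in> lang q \<longleftrightarrow> ok q \<sigma> \<and> \<alpha> \<in> lang (\<delta> q \<sigma>)" for \<alpha>
      using greedy_from_snoc[OF rep(1)[OF q] \<sigma>] lang_cone[OF c] by (simp add: lang_def ok_def \<delta>_def)
  qed simp
  then show ?thesis by (simp add: lang_cone left_greedy_nf_conv_greedy_from)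
qed

end

theorem theorem1:
  fixes W :: "('a, 'b) monoid_scheme" and S :: "'a set" and m :: "'a \<Rightarrow> 'a \<Rightarrow> enat"
  assumes "coxeter_system W S m" and "finite S"
  shows "char_series (left_greedy_nf W S) \<in> rational_series (proper_nerve W S)"
proof -
  have "group W" using assms(1) by (simp add: coxeter_system_def has_presentation_def)
  then interpret coxeter W S m
    using assms(1) by (intro coxeter.intro coxeter_axioms.intro)
  show ?thesis using assms(2) by (rule rational_left_greedy_nf)
qed

end
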